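(* Assume GRH for $F$. Let $0<B_1\leq B_2< B_3<1/d_F$ and suppose that for some $c>0$, \[ \tilde{V}_F(X,h)=h X\Big(d_F \log\frac{X}{h}+\log\mathfrak{q}_F-(\gamma_0+\log 2\pi)d_F\Big)+O\big(hX^{1-c}\big) \] uniformly for $X^{1-B_3}\ll h\ll X^{1-B_1}$. Then for every $\varepsilon>0$, \begin{eqnarray*} V_F(X, \delta)&=&\frac{1}{2}\delta X^2\Big(d_F \log\frac{1}{\delta}+\log\mathfrak{q}_F+(1-\gamma_0-\log2\pi)d_F\Big)\\ &&+O_\varepsilon\big(\delta^{1-\varepsilon}X^{2-c/3}\big)+O_\varepsilon\Big(\delta^{1-\varepsilon}X^{2}\big(\delta X^{B_3}\big)^{-2/(3B_3)}\Big) \end{eqnarray*} uniformly for $X^{-B_2}\ll\delta\ll X^{-B_1}$.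
   Context: Let $F(s)=\sum_{n\ge1}a_F(n)n^{-s}$ be a primitive element of the Selberg class: the series converges absolutely for $\mathrm{Re}(s)>1$; $F$ extends meromorphically to $\mathbb C$ with at most a pole at $s=1$, whose order is denoted $m_F\ge0$, and $(s-1)^{m_F}F(s)$ is entire of finite order; $F$ satisfies $\Phi(s)=\varepsilon_F\overline{\Phi}(1-s)$ where $\Phi(s)=Q^s\prod_{j=1}^r\Gamma(\lambda_js+\mu_j)F(s)$ with $Q>0$, $\lambda_j>0$, $\mathrm{Re}(\mu_j)\ge0$, $|\varepsilon_F|=1$, and $\overline{\Phi}(s)=\overline{\Phi(\bar s)}$; $a_F(n)\ll_\varepsilon n^\varepsilon$; and $F(s)=\prod_p\exp\big(\sum_{l\ge1}b_F(p^l)p^{-ls}\big)$ with $b_F(p^l)\ll p^{l\theta}$ for some $\theta<1/2$. The degree is $d_F=2\sum_{j}\lambda_j$ and the conductor is $\mathfrak q_F=(2\pi)^{d_F}Q^2\prod_j\lambda_j^{2\lambda_j}$. Define $\Lambda_F(n)$ by $\frac{F'}{F}(s)=-\sum_{n\ge1}\Lambda_F(n)n^{-s}$ ($\mathrm{Re}(s)>1$) and $\psi_F(x)=\sum_{n\le x}\Lambda_F(n)$. GRH for $F$ means all nontrivial zeros of $F$ are $\rho_F=\tfrac12+i\gamma_F$ with $\gamma_F$ real. Define $V_F(X,\delta)=\int_1^X|\psi_F(x+\delta x)-\psi_F(x)-m_F\delta x|^2dx$, $\tilde V_F(X,h)=\int_1^X|\psi_F(x+h)-\psi_F(x)-m_Fh|^2dx$.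 $\gamma_0$ denotes the Euler–Mascheroni constant. "Uniformly for $a\ll y\ll b$" means: for any fixed positive constants $k_1,k_2$, the estimate holds for all $y$ with $k_1a\le y\le k_2b$ (as the main parameter tends to infinity), with implied constants independent of the variables. *)

theory Defs
  imports "HOL-Analysis.Analysis" "HOL-Computational_Algebra.Primes"
begin

definition Phi :: "real \<Rightarrow> real list \<Rightarrow> complex list \<Rightarrow> (complex \<Rightarrow> complex) \<Rightarrow> complex \<Rightarrow> complex" where
  "Phi Q lam mu F s =
     of_real Q powr s * (\<Prod>j<length lam. Gamma (of_real (lam!j) * s + mu!j)) * F s"

text \<open>F (with Dirichlet coefficients a, pole order m at s = 1, and functional
  equation data Q, lam, mu, eps) satisfies the Selberg class axioms.
  The value F 1 is meaningless when m > 0.\<close>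
definition selberg_data ::
  "(complex \<Rightarrow> complex) \<Rightarrow> (nat \<Rightarrow> complex) \<Rightarrow> nat \<Rightarrow> real \<Rightarrow> real list \<Rightarrow> complex list \<Rightarrow> complex \<Rightarrow> bool" where
  "selberg_data F a m Q lam mu eps \<longleftrightarrow>
     (\<forall>s. 1 < Re s \<longrightarrow> summable (\<lambda>n. norm (a n / of_nat n powr s)) \<and>
                        F s = (\<Sum>n. a n / of_nat n powr s)) \<and>
     (\<exists>G. G holomorphic_on UNIV \<and> (\<forall>s. s \<noteq> 1 \<longrightarrow> G s = (s - 1) ^ m * F s) \<and>
          (m = 0 \<longrightarrow> G 1 = F 1) \<and> (0 < m \<longrightarrow> G 1 \<noteq> 0) \<and>
          (\<exists>A C. \<forall>s. norm (G s) \<le> C * exp (norm s powr A))) \<and>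
     0 < Q \<and> length mu = length lam \<and>
     (\<forall>j<length lam. 0 < lam!j \<and> 0 \<le> Re (mu!j)) \<and> norm eps = 1 \<and>
     (\<forall>s. s \<noteq> 0 \<and> s \<noteq> 1 \<and>
          (\<forall>j<length lam. of_real (lam!j) * s + mu!j \<notin> \<int>\<^sub>\<le>\<^sub>0 \<and>
                          of_real (lam!j) * cnj (1 - s) + mu!j \<notin> \<int>\<^sub>\<le>\<^sub>0) \<longrightarrow>
          Phi Q lam mu F s = eps * cnj (Phi Q lam mu F (cnj (1 - s)))) \<and>
     (\<forall>e>0. \<exists>C. \<forall>n\<ge>1. norm (a n) \<le> C * real n powr e) \<and>
     (\<exists>b :: nat \<Rightarrow> complex. \<exists>\<theta> C. \<theta> < 1/2 \<and>
        (\<forall>p l. prime p \<and> 1 \<le> l \<longrightarrow> norm (b (p ^ l)) \<le> C * real p powr (real l * \<theta>)) \<and>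
        (\<forall>s. 1 < Re s \<longrightarrow>
           (\<lambda>N. \<Prod>p\<in>{p. prime p \<and> p \<le> N}.
                 exp (\<Sum>l. b (p ^ Suc l) / of_nat (p ^ Suc l) powr s)) \<longlonglongrightarrow> F s))"

definition selberg_class :: "(complex \<Rightarrow> complex) \<Rightarrow> bool" where
  "selberg_class F \<longleftrightarrow> (\<exists>a m Q lam mu eps. selberg_data F a m Q lam mu eps)"

definition primitive_selberg :: "(complex \<Rightarrow> complex) \<Rightarrow> bool" where
  "primitive_selberg F \<longleftrightarrow> selberg_class F \<and> \<not> (\<forall>s. 1 < Re s \<longrightarrow> F s = 1) \<and>
     (\<forall>F1 F2. selberg_class F1 \<and> selberg_class F2 \<and> (\<forall>s. 1 < Re s \<longrightarrow> F s = F1 s * F2 s) \<longrightarrow>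
        (\<forall>s. 1 < Re s \<longrightarrow> F1 s = 1) \<or> (\<forall>s. 1 < Re s \<longrightarrow> F2 s = 1))"

text \<open>GRH: every nontrivial zero (zeros with Re s > 0; trivial zeros lie in Re s \<le> 0)
  lies on Re s = 1/2. The point s = 1 is excluded when it is a pole.\<close>
definition GRH :: "(complex \<Rightarrow> complex) \<Rightarrow> nat \<Rightarrow> bool" where
  "GRH F m \<longleftrightarrow> (\<forall>s. 0 < Re s \<and> F s = 0 \<and> (s = 1 \<longrightarrow> m = 0) \<longrightarrow> Re s = 1/2)"

definition degF :: "real list \<Rightarrow> real" where
  "degF lam = 2 * sum_list lam"

definition condF :: "real \<Rightarrow> real list \<Rightarrow> real" where
  "condF Q lam = (2 * pi) powr degF lam * Q ^ 2 * (\<Prod>j<length lam. (lam!j) powr (2 * lam!j))"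

definition psiF :: "(nat \<Rightarrow> complex) \<Rightarrow> real \<Rightarrow> complex" where
  "psiF Lam x = (\<Sum>n\<in>{1..nat \<lfloor>x\<rfloor>}. Lam n)"

definition VF :: "(nat \<Rightarrow> complex) \<Rightarrow> nat \<Rightarrow> real \<Rightarrow> real \<Rightarrow> real" where
  "VF Lam m X \<delta> = integral {1..X}
     (\<lambda>x. (cmod (psiF Lam (x + \<delta> * x) - psiF Lam x - of_nat m * of_real (\<delta> * x)))\<^sup>2)"

definition tVF :: "(nat \<Rightarrow> complex) \<Rightarrow> nat \<Rightarrow> real \<Rightarrow> real \<Rightarrow> real" where
  "tVF Lam m X h = integral {1..X}
     (\<lambda>x. (cmod (psiF Lam (x + h) - psiF Lam x - of_nat m * of_real h))\<^sup>2)"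

end

theory Submission
  imports Defs "HOL-Complex_Analysis.Complex_Analysis" "HOL-Probability.Probability"
    "HOL-Real_Asymp.Real_Asymp"
begin

text \<open>
  Write \<open>f(x, h) = \<psi>(x + h) - \<psi>(x) - m h\<close>. GRH enters only through the bound
  \<open>VF X \<theta> \<le> K X\<^bsup>2+2\<kappa>\<^esup> \<theta>\<^bsup>1-3\<kappa>\<^esup>\<close>, uniform in \<open>0 < \<theta> \<le> 1\<close>. To prove it, put \<open>G(s) = (s - 1)\<^bsup>m\<^esup> F(s)\<close>.
  The functional equation and Phragmen-Lindelof give polynomial growth of \<open>G\<close>, so Borel-Caratheodory
  gives \<open>G'/G \<lesssim> \<bar>t\<bar>\<^bsup>\<kappa>\<^esup>\<close> on \<open>Re s = 1/2 + \<kappa>\<close>; the explicit formula on this line and a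
  Plancherel-type inequality yield the bound.

  Since \<open>f(x, (1 + \<nu>)\<delta>x) - f(x, \<delta>x) = f((1 + \<delta>)x, \<nu>\<delta>x)\<close>, replacing \<open>\<bar>f(x, \<delta>x)\<bar>\<^sup>2\<close> by the mean of
  \<open>\<bar>f(x, (1 + \<nu>)\<delta>x)\<bar>\<^sup>2\<close> over \<open>0 < \<nu> \<le> \<eta>\<close> costs a relative error \<open>\<eta>\<^bsup>1/2\<^esup>\<close>. The mean is an integral over
  a thin sector of the \<open>(x, h)\<close>-plane; slicing the sector along lines of constant \<open>h\<close> expresses it by
  differences of \<open>tVF\<close>, to which the hypothesis applies with relative error \<open>X\<^bsup>-c\<^esup> / \<eta>\<close>. The choice
  \<open>\<eta> = X\<^bsup>-2c/3\<^esup>\<close> balances the two errors. The part \<open>x \<le> 2 \<delta>\<^bsup>-1/B3\<^esup>\<close>, outside the range of the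
  hypothesis, is covered by the GRH bound.
\<close>

section \<open>Integrals along vertical lines\<close>

text \<open>Two losses shape the argument. The hypothesis knows \<open>tVF\<close> up to a relative
  error \<open>X powr (- c)\<close>, while a slice of the sector uses a difference of
  \<open>tVF\<close> of relative size \<eta>; hence the loss 1 / \<eta>. The GRH bound loses small
  powers of X. As \<delta> is at most a constant times \<open>X powr (- B1)\<close>, they turn into
  \<open>\<delta> powr (- e)\<close>, which also absorbs logarithms. The extra degree in the main
  term comes from slicing: on a slice the length is fixed at \<delta> y while the endpoint moves
  from y / (1 + \<eta>) to y, so the logarithm in the hypothesis changes by ln (1 + \<eta>), which
  is \<eta> to first order. The analytic half uses the weight 1 / s^2 and the sums
  \<open>riesz_sum\<close>, whose contour integrals converge absolutely. The function \<psi> is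
  recovered as a one-sided derivative, and Fatou's lemma carries the mean square bound to the limit.
  The part below \<open>2 * \<delta> powr (- 1 / B3)\<close> costs a relative error (\<delta>
  X^B3)^(-2/B3). The weaker exponent -2/(3 B3) of the statement also covers c > 2, where the
  argument runs with \<open>min c 2\<close>.\<close>

lemma vertical_integral_shift:
  fixes \<phi> :: "complex \<Rightarrow> complex" and g :: "real \<Rightarrow> real"
  assumes hol: "\<phi> holomorphic_on S" and S: "open S" "convex S" and "a \<le> b"
    and strip: "\<And>\<sigma> t. a \<le> \<sigma> \<Longrightarrow> \<sigma> \<le> b \<Longrightarrow> Complex \<sigma> t \<in> S"
    and bound: "\<And>\<sigma> t. a \<le> \<sigma> \<Longrightarrow> \<sigma> \<le> b \<Longrightarrow> 1 \<le> \<bar>t\<bar> \<Longrightarrow> cmod (\<phi> (Complex \<sigma> t)) \<le> g \<bar>t\<bar>"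
    and g: "(g \<longlongrightarrow> 0) at_top"
    and inta: "integrable lborel (\<lambda>t. \<phi> (Complex a t))"
    and intb: "integrable lborel (\<lambda>t. \<phi> (Complex b t))"
  shows "(LINT t|lborel. \<phi> (Complex a t)) = (LINT t|lborel. \<phi> (Complex b t))"
proof -
  \<comment> \<open>A primitive on the convex set takes the place of a contour integral over a
    rectangle: each truncated line integral is a difference of two values of \<open>\<Psi>\<close>,
    and two such differences are compared along the horizontal edges.\<close>
  obtain \<Psi> where \<Psi>: "\<And>x. x \<in> S \<Longrightarrow> (\<Psi> has_field_derivative \<phi> x) (at x within S)"
    using holomorphic_convex_primitive'[OF S(2) S(1) hol] by metis
  hence \<Psi>': "\<And>x. x \<in> S \<Longrightarrow> (\<Psi> has_field_derivative \<phi> x) (at x)"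
    using at_within_open[OF _ S(1)] by metis
  have I: "((\<lambda>t. \<phi> (Complex \<sigma> t)) has_integral (\<Psi> (Complex \<sigma> T) - \<Psi> (Complex \<sigma> (-T))) / \<i>) {-T..T}"
    if "a \<le> \<sigma>" "\<sigma> \<le> b" "0 \<le> T" for \<sigma> T
  proof -
    have "((\<lambda>t. \<Psi> (Complex \<sigma> t)) has_vector_derivative (\<i> * \<phi> (Complex \<sigma> t))) (at t within {-T..T})" for t
    proof -
      have 1: "((\<lambda>t. Complex \<sigma> t) has_vector_derivative \<i>) (at t within {-T..T})"
        unfolding Complex_eq by (auto intro!: derivative_eq_intros simp: has_vector_derivative_def scaleR_conv_of_real mult.commute)
      show ?thesis
        using field_vector_diff_chain_at[of "\<lambda>t. Complex \<sigma> t" \<i> t \<Psi> "\<phi> (Complex \<sigma> t)"]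
          \<Psi>'[OF strip[OF that(1,2)], of t]
        by (metis (no_types, lifting) 1 DERIV_subset subset_UNIV comp_def[of \<Psi>] field_vector_diff_chain_within mult.commute has_vector_derivative_at_within ext)
    qed
    from fundamental_theorem_of_calculus[of "-T" T, OF _ this]
    have "((\<lambda>t. \<i> * \<phi> (Complex \<sigma> t)) has_integral (\<Psi> (Complex \<sigma> T) - \<Psi> (Complex \<sigma> (-T)))) {-T..T}"
      using that by simp
    from has_integral_mult_left[OF this, of "1/\<i>"] show ?thesis by (simp add: field_simps)
  qed
  have L: "((\<lambda>T. (\<Psi> (Complex \<sigma> T) - \<Psi> (Complex \<sigma> (-T))) / \<i>) \<longlongrightarrow> (LINT t|lborel. \<phi> (Complex \<sigma> t))) at_top"
    if "a \<le> \<sigma>" "\<sigma> \<le> b" and int: "integrable lborel (\<lambda>t. \<phi> (Complex \<sigma> t))" for \<sigma>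
  proof -
    have "((\<lambda>T. LINT t:{-T..T}|lborel. \<phi> (Complex \<sigma> t)) \<longlongrightarrow> (LINT t|lborel. \<phi> (Complex \<sigma> t))) at_top"
      unfolding set_lebesgue_integral_def
    proof (rule integral_dominated_convergence_at_top[where w = "\<lambda>t. cmod (\<phi> (Complex \<sigma> t))"])
      show "\<forall>\<^sub>F T in at_top. AE t in lborel. cmod (indicat_real {-T..T} t *\<^sub>R \<phi> (Complex \<sigma> t)) \<le> cmod (\<phi> (Complex \<sigma> t))"
        by (intro always_eventually allI AE_I2) (auto simp: indicator_def)
      show "AE t in lborel. ((\<lambda>T. indicat_real {-T..T} t *\<^sub>R \<phi> (Complex \<sigma> t)) \<longlongrightarrow> \<phi> (Complex \<sigma> t)) at_top"
      proof (intro AE_I2 tendsto_eventually)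
        fix t :: real
        show "\<forall>\<^sub>F T in at_top. indicat_real {-T..T} t *\<^sub>R \<phi> (Complex \<sigma> t) = \<phi> (Complex \<sigma> t)"
          using eventually_ge_at_top[of "\<bar>t\<bar>"] by eventually_elim (auto simp: indicator_def)
      qed
    qed (use int borel_measurable_integrable[OF int] in \<open>auto intro: integrable_norm\<close>)
    moreover have "\<forall>\<^sub>F T in at_top. (LINT t:{-T..T}|lborel. \<phi> (Complex \<sigma> t)) = (\<Psi> (Complex \<sigma> T) - \<Psi> (Complex \<sigma> (-T))) / \<i>"
      using eventually_ge_at_top[of 0]
    proof eventually_elim
      case (elim T)
      have "set_integrable lborel {-T..T} (\<lambda>t. \<phi> (Complex \<sigma> t))"
        unfolding set_integrable_def using integrable_mult_indicator[OF _ int, of "{-T..T}"] by simp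
      from set_borel_integral_eq_integral(2)[OF this] I[OF that(1,2) elim] show ?case
        by (simp add: integral_unique)
    qed
    ultimately show ?thesis by (rule Lim_transform_eventually)
  qed
  have D: "((\<lambda>T. (\<Psi> (Complex b T) - \<Psi> (Complex b (-T))) / \<i> - (\<Psi> (Complex a T) - \<Psi> (Complex a (-T))) / \<i>) \<longlongrightarrow> 0) at_top"
  proof (rule Lim_null_comparison)
    show "((\<lambda>T. 2 * ((b - a) * g T)) \<longlongrightarrow> 0) at_top"
      using tendsto_mult_left[OF tendsto_mult_left[OF g, of "b - a"], of 2] by simp
    have H: "cmod (\<Psi> (Complex b t) - \<Psi> (Complex a t)) \<le> (b - a) * g \<bar>t\<bar>" if "1 \<le> \<bar>t\<bar>" for t
    proof -
      have "cmod (\<Psi> (Complex b t) - \<Psi> (Complex a t)) \<le> g \<bar>t\<bar> * cmod (Complex b t - Complex a t)"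
      proof (rule field_differentiable_bound[where S = "closed_segment (Complex a t) (Complex b t)" and f' = \<phi>])
        have *: "\<exists>\<sigma>. z = Complex \<sigma> t \<and> a \<le> \<sigma> \<and> \<sigma> \<le> b" if z: "z \<in> closed_segment (Complex a t) (Complex b t)" for z
        proof -
          obtain u where u: "0 \<le> u" "u \<le> 1" "z = (1 - u) *\<^sub>R Complex a t + u *\<^sub>R Complex b t"
            using z by (auto simp: closed_segment_def)
          have "z = Complex (a + u * (b - a)) t" unfolding u(3) by (simp add: complex_eq_iff algebra_simps)
          moreover have "a \<le> a + u * (b - a)" using u assms(4) by simp
          moreover have "u * (b - a) \<le> 1 * (b - a)" using u assms(4) by (intro mult_right_mono) auto
          ultimately show ?thesis by auto
        qed
        show "(\<Psi> has_field_derivative \<phi> z) (at z within closed_segment (Complex a t) (Complex b t))"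
          if "z \<in> closed_segment (Complex a t) (Complex b t)" for z
          using *[OF that] \<Psi>' strip by (metis DERIV_subset subset_UNIV)
        show "cmod (\<phi> z) \<le> g \<bar>t\<bar>" if "z \<in> closed_segment (Complex a t) (Complex b t)" for z
          using *[OF that] bound \<open>1 \<le> \<bar>t\<bar>\<close> by auto
      qed auto
      also have "cmod (Complex b t - Complex a t) = b - a" using assms(4) by (simp add: cmod_def)
      finally show ?thesis by (simp add: mult.commute)
    qed
    show "\<forall>\<^sub>F T in at_top. cmod ((\<Psi> (Complex b T) - \<Psi> (Complex b (-T))) / \<i> - (\<Psi> (Complex a T) - \<Psi> (Complex a (-T))) / \<i>) \<le> 2 * ((b - a) * g T)"
      using eventually_ge_at_top[of 1]
    proof eventually_elim
      case (elim T)
      have "cmod ((\<Psi> (Complex b T) - \<Psi> (Complex b (-T))) / \<i> - (\<Psi> (Complex a T) - \<Psi> (Complex a (-T))) / \<i>)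
        = cmod ((\<Psi> (Complex b T) - \<Psi> (Complex a T)) - (\<Psi> (Complex b (-T)) - \<Psi> (Complex a (-T))))"
        by (simp only: diff_divide_distrib[symmetric] norm_divide norm_ii div_by_1) (simp add: algebra_simps)
      also have "\<dots> \<le> (b - a) * g T + (b - a) * g T"
        using norm_triangle_ineq4 H[of T] H[of "-T"] elim by (smt (verit))
      finally show ?case by (simp only: mult_2)
    qed
  qed
  have "((\<lambda>T. (\<Psi> (Complex b T) - \<Psi> (Complex b (-T))) / \<i> - (\<Psi> (Complex a T) - \<Psi> (Complex a (-T))) / \<i>) \<longlongrightarrow>
     (LINT t|lborel. \<phi> (Complex b t)) - (LINT t|lborel. \<phi> (Complex a t))) at_top"
    using assms(4) by (intro tendsto_diff L inta intb) auto
  from tendsto_unique[OF _ this D] show ?thesis by simp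
qed


lemma
  fixes \<sigma> :: real
  assumes "\<sigma> \<noteq> 0"
  shows integrable_inverse_sum_squares: "integrable lborel (\<lambda>t. 1 / (\<sigma>\<^sup>2 + t\<^sup>2))"
    and integral_inverse_sum_squares: "(LINT t|lborel. 1 / (\<sigma>\<^sup>2 + t\<^sup>2)) = pi / \<bar>\<sigma>\<bar>"
proof -
  have U: "einterval (-\<infinity>) \<infinity> = UNIV" by (auto simp: einterval_def)
  have i: "integrable lborel (\<lambda>x::real. inverse (1 + x\<^sup>2))"
    using integrable_inverse_1_plus_square by (simp add: set_integrable_def U)
  have v: "(LINT x|lborel. inverse (1 + x\<^sup>2)) = pi"
    using LBINT_inverse_1_plus_square
    by (simp add: interval_lebesgue_integral_def set_lebesgue_integral_def U)
  have eq: "inverse (1 + (0 + inverse \<sigma> * t)\<^sup>2) / \<sigma>\<^sup>2 = 1 / (\<sigma>\<^sup>2 + t\<^sup>2)" for t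
  proof -
    have "\<sigma>\<^sup>2 + t\<^sup>2 > 0" using assms by (simp add: add_pos_nonneg)
    moreover have "1 + (0 + inverse \<sigma> * t)\<^sup>2 = (\<sigma>\<^sup>2 + t\<^sup>2) / \<sigma>\<^sup>2"
      using assms by (simp add: field_simps)
    ultimately show ?thesis using assms by simp
  qed
  have "integrable lborel (\<lambda>t. inverse (1 + (0 + inverse \<sigma> * t)\<^sup>2))"
    using lborel_integrable_real_affine[OF i, of "inverse \<sigma>" 0] assms by simp
  from integrable_divide[OF this, of "\<sigma>\<^sup>2"] show "integrable lborel (\<lambda>t. 1 / (\<sigma>\<^sup>2 + t\<^sup>2))"
    unfolding eq .
  define I where "I = (LINT t|lborel. inverse (1 + (0 + inverse \<sigma> * t)\<^sup>2))"
  have "pi = \<bar>inverse \<sigma>\<bar> * I"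
    using lborel_integral_real_affine[of "inverse \<sigma>" "\<lambda>x. inverse (1 + x\<^sup>2)" 0] assms v
    unfolding I_def by simp
  hence "I = pi * \<bar>\<sigma>\<bar>" using assms by (simp add: field_simps)
  hence "I / \<sigma>\<^sup>2 = pi / \<bar>\<sigma>\<bar>"
    using assms abs_mult_self_eq[of \<sigma>] unfolding power2_eq_square by (metis abs_eq_0 nonzero_mult_divide_mult_cancel_right)
  moreover have "(LINT t|lborel. inverse (1 + (0 + inverse \<sigma> * t)\<^sup>2) / \<sigma>\<^sup>2) = I / \<sigma>\<^sup>2"
    unfolding I_def by (rule integral_divide_zero)
  ultimately show "(LINT t|lborel. 1 / (\<sigma>\<^sup>2 + t\<^sup>2)) = pi / \<bar>\<sigma>\<bar>"
    unfolding eq by simp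
qed

lemma continuous_on_vertical_line:
  assumes "f holomorphic_on S" "\<And>t. Complex \<sigma> t \<in> S"
  shows "continuous_on UNIV (\<lambda>t. f (Complex \<sigma> t))"
proof -
  have "continuous_on UNIV (\<lambda>t. Complex \<sigma> t)" unfolding Complex_eq by (intro continuous_intros)
  from continuous_on_compose2[OF holomorphic_on_imp_continuous_on[OF assms(1)] this] assms(2)
  show ?thesis by blast
qed

lemma integrable_vertical_line:
  assumes "f holomorphic_on S" "\<And>t. Complex \<sigma> t \<in> S" "integrable lborel g"
    "\<And>t. cmod (f (Complex \<sigma> t)) \<le> g t"
  shows "integrable lborel (\<lambda>t. f (Complex \<sigma> t))"
proof (rule Bochner_Integration.integrable_bound[OF assms(3)])
  show "(\<lambda>t. f (Complex \<sigma> t)) \<in> borel_measurable lborel"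
    using borel_measurable_continuous_onI[OF continuous_on_vertical_line[OF assms(1,2)]] by simp
  show "AE t in lborel. cmod (f (Complex \<sigma> t)) \<le> norm (g t)"
    using assms(4) by (intro AE_I2) (metis abs_ge_self order_trans real_norm_def)
qed

text \<open>The line can be moved arbitrarily far to the right without changing the integral, and at
  abscissa \<tau> the bound integrates to pi / \<tau>, which tends to 0. Used wherever the integrand
  has no singularity to the right.\<close>

lemma vertical_integral_eq_0:
  assumes hol: "\<phi> holomorphic_on {s. 0 < Re s}"
    and bound: "\<And>\<sigma> t. 0 < \<sigma> \<Longrightarrow> cmod (\<phi> (Complex \<sigma> t)) \<le> 1 / (\<sigma>\<^sup>2 + t\<^sup>2)"
    and "0 < \<sigma>"
  shows "(LINT t|lborel. \<phi> (Complex \<sigma> t)) = 0"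
proof -
  have int: "integrable lborel (\<lambda>t. \<phi> (Complex \<tau> t))" if "0 < \<tau>" for \<tau>
    using that bound[OF that] by (intro integrable_vertical_line[OF hol _ integrable_inverse_sum_squares[of \<tau>]]) auto
  have eq: "(LINT t|lborel. \<phi> (Complex \<sigma> t)) = (LINT t|lborel. \<phi> (Complex \<tau> t))" if "\<sigma> \<le> \<tau>" for \<tau>
  proof (rule vertical_integral_shift[OF hol _ _ that, where g = "\<lambda>t. 1 / t\<^sup>2"])
    show "((\<lambda>t. 1 / t\<^sup>2) \<longlongrightarrow> (0::real)) at_top" by real_asymp
    show "cmod (\<phi> (Complex \<rho> t)) \<le> 1 / \<bar>t\<bar>\<^sup>2" if "\<sigma> \<le> \<rho>" "1 \<le> \<bar>t\<bar>" for \<rho> t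
    proof -
      have "1 / (\<rho>\<^sup>2 + t\<^sup>2) \<le> 1 / \<bar>t\<bar>\<^sup>2" using that by (intro divide_left_mono) (auto intro!: mult_pos_pos add_nonneg_pos)
      thus ?thesis using bound[of \<rho> t] that assms(3) by auto
    qed
  qed (use int assms(3) that open_halfspace_Re_gt[of 0] convex_halfspace_Re_gt[of 0] in auto)
  have "cmod (LINT t|lborel. \<phi> (Complex \<sigma> t)) \<le> pi / \<tau>" if "\<sigma> \<le> \<tau>" for \<tau>
  proof -
    have "cmod (LINT t|lborel. \<phi> (Complex \<sigma> t)) \<le> (LINT t|lborel. cmod (\<phi> (Complex \<tau> t)))"
      unfolding eq[OF that] by (rule integral_norm_bound)
    also have "\<dots> \<le> (LINT t|lborel. 1 / (\<tau>\<^sup>2 + t\<^sup>2))"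
      using that assms(3) by (intro integral_mono integrable_norm int integrable_inverse_sum_squares bound) auto
    also have "\<dots> = pi / \<tau>" using that assms(3) by (subst integral_inverse_sum_squares) auto
    finally show ?thesis .
  qed
  hence "\<forall>\<^sub>F \<tau> in at_top. cmod (LINT t|lborel. \<phi> (Complex \<sigma> t)) \<le> pi / \<tau>"
    by (rule eventually_mono[OF eventually_ge_at_top[of \<sigma>]])
  moreover have "((\<lambda>\<tau>. pi / \<tau>) \<longlongrightarrow> 0) at_top" by real_asymp
  ultimately have "cmod (LINT t|lborel. \<phi> (Complex \<sigma> t)) \<le> 0"
    by (intro tendsto_lowerbound[of _ 0]) auto
  thus ?thesis by simp
qed

lemma cmod_Complex_power2: "(cmod (Complex \<sigma> t))\<^sup>2 = \<sigma>\<^sup>2 + t\<^sup>2"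
  by (simp add: cmod_power2)

lemma cmod_exp_over_square:
  "cmod (exp (of_real w * Complex \<sigma> t) / (Complex \<sigma> t)\<^sup>2) = exp (w * \<sigma>) * (1 / (\<sigma>\<^sup>2 + t\<^sup>2))"
  by (simp add: norm_divide norm_power cmod_Complex_power2)

lemma integrable_exp_over_square:
  assumes "\<sigma> \<noteq> 0"
  shows "integrable lborel (\<lambda>t. exp (of_real w * Complex \<sigma> t) / (Complex \<sigma> t)\<^sup>2)"
proof (rule integrable_vertical_line[where S = "-{0}"
      and g = "\<lambda>t. exp (w * \<sigma>) * (1 / (\<sigma>\<^sup>2 + t\<^sup>2))"])
  show "integrable lborel (\<lambda>t. exp (w * \<sigma>) * (1 / (\<sigma>\<^sup>2 + t\<^sup>2)))"
    by (intro integrable_mult_right integrable_inverse_sum_squares assms)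
  show "cmod (exp (of_real w * Complex \<sigma> t) / (Complex \<sigma> t)\<^sup>2) \<le> exp (w * \<sigma>) * (1 / (\<sigma>\<^sup>2 + t\<^sup>2))" for t
    unfolding cmod_exp_over_square ..
  show "(\<lambda>s. exp (of_real w * s) / s\<^sup>2) holomorphic_on - {0}" by (auto intro!: holomorphic_intros)
  show "Complex \<sigma> t \<in> - {0}" for t using assms by (auto simp: complex_eq_iff)
qed

lemma integral_exp_over_square_nonpos:
  assumes "w \<le> 0" "0 < \<sigma>"
  shows "(LINT t|lborel. exp (of_real w * Complex \<sigma> t) / (Complex \<sigma> t)\<^sup>2) = 0"
proof (rule vertical_integral_eq_0[OF _ _ assms(2)])
  show "(\<lambda>s. exp (of_real w * s) / s\<^sup>2) holomorphic_on {s. 0 < Re s}"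
    by (auto intro!: holomorphic_intros)
  show "cmod (exp (of_real w * Complex \<sigma> t) / (Complex \<sigma> t)\<^sup>2) \<le> 1 / (\<sigma>\<^sup>2 + t\<^sup>2)" if "0 < \<sigma>" for \<sigma> t
    unfolding cmod_exp_over_square using that assms(1)
    by (intro mult_left_le_one_le) (auto simp: mult_nonpos_nonneg)
qed

text \<open>The value comes from the residue w at the double pole 0. It is obtained by subtracting
  explicit functions until the pole cancels and then moving the line across 0 to Re s = -1/2, where
  every piece is known.\<close>

lemma integral_exp_over_square_nonneg:
  assumes w: "0 \<le> w" and \<sigma>: "0 < \<sigma>"
  shows "(LINT t|lborel. exp (of_real w * Complex \<sigma> t) / (Complex \<sigma> t)\<^sup>2) = of_real (2 * pi * w)"
proof -
  define J where "J w \<sigma> = (LINT t|lborel. exp (of_real w * Complex \<sigma> t) / (Complex \<sigma> t)\<^sup>2)" for w \<sigma>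
  define K where "K \<sigma> = (LINT t|lborel. 1 / (Complex \<sigma> t * (Complex \<sigma> t + 1)))" for \<sigma>
  \<comment> \<open>\<open>N\<close> vanishes to second order at 0, so N(s) / (s^2 (s + 1)) is
    holomorphic for Re s > -1; \<open>q1\<close> and \<open>q2\<close> carry out the two divisions
    by s. The term w / (s (s + 1)) removes the residue, and its factor s + 1 keeps it of order t^-2,
    since w / s alone would not be absolutely integrable.\<close>
  define N where "N = (\<lambda>s::complex. (exp (of_real w * s) - 1) * (s + 1) - of_real w * s)"
  define q1 where "q1 = (\<lambda>s. if s = 0 then deriv N 0 else (N s - N 0) / (s - 0))"
  define q2 where "q2 = (\<lambda>s. if s = 0 then deriv q1 0 else (q1 s - q1 0) / (s - 0))"
  define \<phi> where "\<phi> = (\<lambda>s. q2 s / (s + 1))"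
  have N: "N holomorphic_on UNIV" unfolding N_def by (intro holomorphic_intros)
  have "(N has_field_derivative 0) (at 0)"
    unfolding N_def by (auto intro!: derivative_eq_intros)
  hence q10: "q1 0 = 0" by (simp add: q1_def DERIV_imp_deriv)
  have q1: "q1 holomorphic_on UNIV" unfolding q1_def by (rule pole_lemma_open[OF N]) auto
  have q2: "q2 holomorphic_on UNIV" unfolding q2_def by (rule pole_lemma_open[OF q1]) auto
  have \<phi>h: "\<phi> holomorphic_on {s. -1 < Re s}" unfolding \<phi>_def
    by (intro holomorphic_intros holomorphic_on_subset[OF q2]) (auto simp: complex_eq_iff)
  have \<phi>: "\<phi> s = exp (of_real w * s) / s\<^sup>2 - exp (of_real 0 * s) / s\<^sup>2 - of_real w * (1 / (s * (s + 1)))"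
    if "s \<noteq> 0" "s \<noteq> -1" for s
  proof -
    have "s + 1 \<noteq> 0" using that(2) by (metis add.commute add_eq_0_iff)
    hence "N s / s / s / (s + 1) = (exp (of_real w * s) - 1) / s\<^sup>2 - of_real w * (1 / (s * (s + 1)))"
      using that unfolding N_def by (simp add: divide_simps) (simp add: power2_eq_square algebra_simps)
    moreover have "\<phi> s = N s / s / s / (s + 1)"
      using that q10 by (simp add: \<phi>_def q2_def) (simp add: q1_def N_def)
    moreover have "(exp (of_real w * s) - 1) / s\<^sup>2 = exp (of_real w * s) / s\<^sup>2 - exp (of_real 0 * s) / s\<^sup>2"
      by (simp add: diff_divide_distrib)
    ultimately show ?thesis by simp
  qed
  have s1: "s + 1 \<noteq> 0" if "-1 < Re s" for s :: complex using that by (auto simp: complex_eq_iff)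
  have Kb: "cmod (1 / (Complex \<sigma> t * (Complex \<sigma> t + 1))) \<le> 1 / (\<sigma>\<^sup>2 + t\<^sup>2)" if "- (1/2) \<le> \<sigma>" "\<sigma> \<noteq> 0" for \<sigma> t
  proof -
    have p: "0 < \<sigma>\<^sup>2 + t\<^sup>2" using that by (simp add: add_pos_nonneg)
    have "\<sigma>\<^sup>2 \<le> (\<sigma> + 1)\<^sup>2" using that by (simp add: power2_eq_square algebra_simps)
    hence "(cmod (Complex \<sigma> t))\<^sup>2 \<le> (cmod (Complex \<sigma> t + 1))\<^sup>2"
      by (simp add: cmod_power2)
    hence "cmod (Complex \<sigma> t) \<le> cmod (Complex \<sigma> t + 1)" by (rule power2_le_imp_le) simp
    hence "(cmod (Complex \<sigma> t))\<^sup>2 \<le> cmod (Complex \<sigma> t) * cmod (Complex \<sigma> t + 1)"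
      by (simp add: power2_eq_square mult_left_mono)
    thus ?thesis using p unfolding norm_divide norm_mult norm_one cmod_Complex_power2
      by (intro divide_left_mono) (auto intro: mult_pos_pos order.strict_trans2)
  qed
  have Kint: "integrable lborel (\<lambda>t. 1 / (Complex \<sigma> t * (Complex \<sigma> t + 1)))" if "- (1/2) \<le> \<sigma>" "\<sigma> \<noteq> 0" for \<sigma>
  proof (rule integrable_vertical_line[where S = "{s. -1 < Re s} - {0}" and g = "\<lambda>t. 1 / (\<sigma>\<^sup>2 + t\<^sup>2)" and f = "\<lambda>s. 1 / (s * (s + 1))"])
    show "(\<lambda>s. 1 / (s * (s + 1))) holomorphic_on {s. -1 < Re s} - {0}"
      by (intro holomorphic_intros) (use s1 in auto)
    show "Complex \<sigma> t \<in> {s. -1 < Re s} - {0}" for t using that by (auto simp: complex_eq_iff)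
  qed (use Kb[OF that] integrable_inverse_sum_squares[OF that(2)] in auto)
  have ne: "Complex \<sigma> t \<noteq> 0" "Complex \<sigma> t \<noteq> -1" if "- (1/2) \<le> \<sigma>" "\<sigma> \<noteq> 0" for \<sigma> t
    using that by (auto simp: complex_eq_iff)
  have \<phi>i: "integrable lborel (\<lambda>t. \<phi> (Complex \<sigma> t))"
    and \<phi>v: "(LINT t|lborel. \<phi> (Complex \<sigma> t)) = J w \<sigma> - J 0 \<sigma> - of_real w * K \<sigma>"
    if "- (1/2) \<le> \<sigma>" "\<sigma> \<noteq> 0" for \<sigma>
  proof -
    have e: "(\<lambda>t. \<phi> (Complex \<sigma> t)) = (\<lambda>t. exp (of_real w * Complex \<sigma> t) / (Complex \<sigma> t)\<^sup>2
        - exp (of_real 0 * Complex \<sigma> t) / (Complex \<sigma> t)\<^sup>2 - of_real w * (1 / (Complex \<sigma> t * (Complex \<sigma> t + 1))))"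
      by (intro ext \<phi> ne that)
    note i = integrable_exp_over_square[OF that(2), of w] integrable_exp_over_square[OF that(2), of 0]
      integrable_mult_right[OF Kint[OF that], of "of_real w"]
    note d = Bochner_Integration.integrable_diff[OF i(1,2)]
    show "integrable lborel (\<lambda>t. \<phi> (Complex \<sigma> t))"
      unfolding e by (rule Bochner_Integration.integrable_diff[OF d i(3)])
    show "(LINT t|lborel. \<phi> (Complex \<sigma> t)) = J w \<sigma> - J 0 \<sigma> - of_real w * K \<sigma>"
      unfolding e J_def K_def Bochner_Integration.integral_diff[OF d i(3)]
        Bochner_Integration.integral_diff[OF i(1,2)] integral_mult_right_zero ..
  qed
  have shift: "(LINT t|lborel. \<phi> (Complex (-(1/2)) t)) = (LINT t|lborel. \<phi> (Complex \<sigma> t))"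
  proof (rule vertical_integral_shift[OF \<phi>h, where g = "\<lambda>t. (exp (w * \<sigma>) + 1 + w) / t\<^sup>2"])
    show "((\<lambda>t. (exp (w * \<sigma>) + 1 + w) / t\<^sup>2) \<longlongrightarrow> 0) at_top" by real_asymp
    fix \<rho> t :: real assume *: "- (1/2) \<le> \<rho>" "\<rho> \<le> \<sigma>" "1 \<le> \<bar>t\<bar>"
    have n: "Complex \<rho> t \<noteq> 0" "Complex \<rho> t \<noteq> -1" using * by (auto simp: complex_eq_iff)
    have a: "1 / (\<rho>\<^sup>2 + t\<^sup>2) \<le> 1 / t\<^sup>2"
      using * by (intro divide_left_mono) (auto intro!: mult_pos_pos add_nonneg_pos)
    have b: "cmod (1 / (Complex \<rho> t * (Complex \<rho> t + 1))) \<le> 1 / t\<^sup>2"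
    proof -
      have "\<bar>t\<bar> \<le> cmod (Complex \<rho> t)" "\<bar>t\<bar> \<le> cmod (Complex \<rho> t + 1)"
        using abs_Im_le_cmod[of "Complex \<rho> t"] abs_Im_le_cmod[of "Complex \<rho> t + 1"] by auto
      hence "\<bar>t\<bar> * \<bar>t\<bar> \<le> cmod (Complex \<rho> t) * cmod (Complex \<rho> t + 1)" by (intro mult_mono) auto
      moreover have "0 < \<bar>t\<bar> * \<bar>t\<bar>" using * by (intro mult_pos_pos) auto
      ultimately show ?thesis unfolding norm_divide norm_mult
        by (simp add: divide_simps power2_eq_square)
    qed
    have "cmod (\<phi> (Complex \<rho> t)) \<le> cmod (exp (of_real w * Complex \<rho> t) / (Complex \<rho> t)\<^sup>2)
        + cmod (exp (of_real 0 * Complex \<rho> t) / (Complex \<rho> t)\<^sup>2) + cmod (of_real w * (1 / (Complex \<rho> t * (Complex \<rho> t + 1))))"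
      unfolding \<phi>[OF n] by (intro order_trans[OF norm_triangle_ineq4] add_mono order_trans[OF norm_triangle_ineq4] order_refl)
    also have "\<dots> \<le> exp (w * \<sigma>) * (1 / t\<^sup>2) + 1 * (1 / t\<^sup>2) + w * (1 / t\<^sup>2)"
      unfolding cmod_exp_over_square norm_mult using a b w *
      by (intro add_mono mult_mono) (auto simp: mult_left_mono)
    finally show "cmod (\<phi> (Complex \<rho> t)) \<le> (exp (w * \<sigma>) + 1 + w) / \<bar>t\<bar>\<^sup>2" by (simp add: add_divide_distrib)
  qed (use \<phi>i \<sigma> open_halfspace_Re_gt[of "-1"] convex_halfspace_Re_gt[of "-1"] in auto)
  have K0: "K \<sigma> = 0" unfolding K_def
  proof (rule vertical_integral_eq_0[OF _ _ \<sigma>, where \<phi> = "\<lambda>s. 1 / (s * (s + 1))"])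
    show "(\<lambda>s. 1 / (s * (s + 1))) holomorphic_on {s. 0 < Re s}"
      by (intro holomorphic_intros) (use s1 in force)
  qed (use Kb in auto)
  \<comment> \<open>On Re s = -1/2 one has s + 1 = - cnj s, so s (s + 1) = - |s|^2 is real and an
    arctangent integral remains.\<close>
  have K1: "K (-(1/2)) = - of_real (2 * pi)"
  proof -
    have "1 / (Complex (-(1/2)) t * (Complex (-(1/2)) t + 1)) = - complex_of_real (1 / ((1/2)\<^sup>2 + t\<^sup>2))" for t
    proof -
      have "Complex (-(1/2)) t * (Complex (-(1/2)) t + 1) = - of_real ((1/2)\<^sup>2 + t\<^sup>2)"
        by (simp add: complex_eq_iff power2_eq_square)
      thus ?thesis by (simp del: of_real_add of_real_power)
    qed
    hence "K (-(1/2)) = - of_real (LINT t|lborel. 1 / ((1/2)\<^sup>2 + t\<^sup>2))"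
      unfolding K_def by (simp only: integral_minus integral_complex_of_real)
    also have "(LINT t|lborel. 1 / ((1/2)\<^sup>2 + t\<^sup>2)) = 2 * pi"
      using integral_inverse_sum_squares[of "1/2"] by simp
    finally show ?thesis .
  qed
  \<comment> \<open>Reversing t sends the line Re s = -1/2 to the negative of the line Re s = 1/2,
    where the exponent -v is nonpositive.\<close>
  have Jm: "J v (-(1/2)) = 0" if "0 \<le> v" for v
  proof -
    have "J v (-(1/2)) = (LINT t|lborel. exp (of_real v * Complex (-(1/2)) (0 + (-1) * t)) / (Complex (-(1/2)) (0 + (-1) * t))\<^sup>2)"
      unfolding J_def by (subst lborel_integral_real_affine[where c = "-1" and t = 0]) auto
    also have "\<dots> = J (-v) (1/2)"
    proof -
      have "Complex (-(1/2)) (0 + (-1) * t) = - Complex (1/2) t" for t by (simp add: complex_eq_iff)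
      thus ?thesis unfolding J_def by simp
    qed
    also have "\<dots> = 0" unfolding J_def using that by (intro integral_exp_over_square_nonpos) auto
    finally show ?thesis .
  qed
  have "J 0 \<sigma> = 0" unfolding J_def using \<sigma> integral_exp_over_square_nonpos[of 0 \<sigma>] by simp
  hence "J w \<sigma> = of_real (2 * pi * w)"
    using shift \<phi>v[of \<sigma>] \<phi>v[of "-(1/2)"] \<sigma> K0 K1 Jm[OF w] Jm[of 0] by (simp add: mult_ac)
  thus ?thesis unfolding J_def .
qed

text \<open>Perron's formula for the kernel 1 / s^2. The weight max w 0 instead of a jump is the
  price for absolute convergence, which permits termwise integration of a Dirichlet series.\<close>

lemma integral_exp_over_square:
  assumes "0 < \<sigma>"
  shows "(LINT t|lborel. exp (of_real w * Complex \<sigma> t) / (Complex \<sigma> t)\<^sup>2) = of_real (2 * pi * max w 0)"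
proof (cases "0 \<le> w")
  case True
  thus ?thesis using integral_exp_over_square_nonneg[OF True assms] by (simp only: max_absorb1)
next
  case False
  hence "w \<le> 0" by simp
  thus ?thesis using integral_exp_over_square_nonpos[OF \<open>w \<le> 0\<close> assms] by (simp only: max_absorb2) simp
qed

section \<open>A mean square inequality for Fourier integrals\<close>

text \<open>The characteristic function of the standard normal law, after the substitution u = L
  y.\<close>

lemma gaussian_weight_transform:
  fixes L x :: real
  assumes "0 < L"
  shows "integrable lborel (\<lambda>u. complex_of_real (exp (- (u\<^sup>2) / (2 * L\<^sup>2))) * iexp (u * x))"
    and "(LINT u|lborel. complex_of_real (exp (- (u\<^sup>2) / (2 * L\<^sup>2))) * iexp (u * x))
      = complex_of_real (L * sqrt (2 * pi) * exp (- ((L * x)\<^sup>2) / 2))"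
proof -
  have i0: "integrable lborel (\<lambda>y. std_normal_density y *\<^sub>R iexp (L * x * y))"
    by (rule Bochner_Integration.integrable_bound[OF integrable_normal_density[of 1 0]]) auto
  have v0: "(LINT y|lborel. std_normal_density y *\<^sub>R iexp (L * x * y)) = complex_of_real (exp (- ((L * x)\<^sup>2) / 2))"
    using fun_cong[OF char_std_normal_distribution, of "L * x"]
    by (simp add: char_def integral_density)
  have eq: "sqrt (2 * pi) *\<^sub>R (std_normal_density (0 + inverse L * u) *\<^sub>R iexp (L * x * (0 + inverse L * u)))
      = complex_of_real (exp (- (u\<^sup>2) / (2 * L\<^sup>2))) * iexp (u * x)" for u
    using assms by (simp add: std_normal_density_def field_simps power_mult_distrib scaleR_conv_of_real)
  have "integrable lborel (\<lambda>u. std_normal_density (0 + inverse L * u) *\<^sub>R iexp (L * x * (0 + inverse L * u)))"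
    using lborel_integrable_real_affine[OF i0, of "inverse L" 0] assms by simp
  from integrable_scaleR_right[OF this, of "sqrt (2 * pi)"]
  show "integrable lborel (\<lambda>u. complex_of_real (exp (- (u\<^sup>2) / (2 * L\<^sup>2))) * iexp (u * x))"
    unfolding eq .
  have "(LINT y|lborel. std_normal_density y *\<^sub>R iexp (L * x * y))
      = \<bar>inverse L\<bar> *\<^sub>R (LINT u|lborel. std_normal_density (0 + inverse L * u) *\<^sub>R iexp (L * x * (0 + inverse L * u)))"
    using assms by (intro lborel_integral_real_affine) auto
  hence "(LINT u|lborel. std_normal_density (0 + inverse L * u) *\<^sub>R iexp (L * x * (0 + inverse L * u)))
      = L *\<^sub>R complex_of_real (exp (- ((L * x)\<^sup>2) / 2))"
    unfolding v0 using assms by simp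
  hence "sqrt (2 * pi) *\<^sub>R (LINT u|lborel. std_normal_density (0 + inverse L * u) *\<^sub>R iexp (L * x * (0 + inverse L * u)))
      = complex_of_real (L * sqrt (2 * pi) * exp (- ((L * x)\<^sup>2) / 2))"
    by (simp add: scaleR_conv_of_real)
  thus "(LINT u|lborel. complex_of_real (exp (- (u\<^sup>2) / (2 * L\<^sup>2))) * iexp (u * x))
      = complex_of_real (L * sqrt (2 * pi) * exp (- ((L * x)\<^sup>2) / 2))"
    unfolding eq[symmetric] integral_scaleR_right .
qed

text \<open>The kernel is 2 pi times the normal density of standard deviation 1 / L. Its mass does
  not depend on L, which makes \<open>L2_fourier_bound\<close> uniform in L.\<close>

lemma nn_integral_gaussian_kernel:
  fixes L :: real
  assumes "0 < L"
  shows "(\<integral>\<^sup>+x. ennreal (L * sqrt (2 * pi) * exp (- ((L * x)\<^sup>2) / 2)) \<partial>lborel) = ennreal (2 * pi)"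
proof -
  have eq: "L * sqrt (2 * pi) * exp (- ((L * x)\<^sup>2) / 2) = 2 * pi * (normal_density 0 (inverse L) x)" for x
  proof -
    define S where "S = sqrt (2 * pi)"
    have S: "0 < S" "2 * pi = S * S" unfolding S_def by simp_all
    have 1: "sqrt (2 * pi * (inverse L)\<^sup>2) = S * inverse L"
      unfolding S_def using assms by (subst real_sqrt_mult) simp
    have 2: "- ((x - 0)\<^sup>2) / (2 * (inverse L)\<^sup>2) = - ((L * x)\<^sup>2) / 2"
      using assms by (simp add: field_simps)
    show ?thesis unfolding normal_density_def 1 2 unfolding S_def[symmetric] S(2)
      using S(1) assms by (simp add: field_simps)
  qed
  have "(\<integral>\<^sup>+x. ennreal (2 * pi * (normal_density 0 (inverse L) x)) \<partial>lborel) = ennreal (LINT x|lborel. 2 * pi * normal_density 0 (inverse L) x)"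
    using assms by (intro nn_integral_eq_integral integrable_mult_right integrable_normal_density) (auto simp: normal_density_nonneg)
  also have "(LINT x|lborel. 2 * pi * normal_density 0 (inverse L) x) = 2 * pi"
    using assms by simp
  finally show ?thesis unfolding eq .
qed

text \<open>An inequality of Plancherel type. The square is weighted by a Gaussian and expanded;
  Fubini leaves a bilinear form with a positive convolution kernel, which Schur's test bounds by the
  mass of the kernel.\<close>

lemma L2_fourier_bound:
  fixes a :: "real \<Rightarrow> complex" and L :: real
  assumes a: "integrable lborel a" and a2: "integrable lborel (\<lambda>t. (cmod (a t))\<^sup>2)" and L: "0 < L"
  shows "set_integrable lborel {-L..L} (\<lambda>u. (cmod (LINT t|lborel. a t * iexp (u * t)))\<^sup>2)"
    and "(LINT u:{-L..L}|lborel. (cmod (LINT t|lborel. a t * iexp (u * t)))\<^sup>2) \<le> 2 * pi * exp (1/2) * (LINT t|lborel. (cmod (a t))\<^sup>2)"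
proof -
  have am[measurable]: "a \<in> borel_measurable borel" using borel_measurable_integrable[OF a] by simp
  have [measurable]: "(\<lambda>t. cnj (a t)) \<in> borel_measurable borel"
    by (rule measurable_compose[OF am borel_measurable_continuous_onI]) (intro continuous_intros)
  define w where "w u = exp (- (u\<^sup>2) / (2 * L\<^sup>2))" for u
  define g where "g x = L * sqrt (2 * pi) * exp (- ((L * x)\<^sup>2) / 2)" for x
  define ah where "ah u = (LINT t|lborel. a t * iexp (u * t))" for u
  define N where "N = (LINT t|lborel. cmod (a t))"
  have wm[measurable]: "w \<in> borel_measurable borel" unfolding w_def by measurable
  have gm[measurable]: "g \<in> borel_measurable borel" unfolding g_def by measurable
  have ahm[measurable]: "ah \<in> borel_measurable borel" unfolding ah_def by measurable
  have [measurable]: "(\<lambda>u. cnj (ah u)) \<in> borel_measurable borel"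
    by (rule measurable_compose[OF ahm borel_measurable_continuous_onI]) (intro continuous_intros)
  have N0: "0 \<le> N" unfolding N_def by simp
  have g0: "0 \<le> g x" for x unfolding g_def using L by simp
  have w0: "0 < w u" for u unfolding w_def by simp
  have ai: "integrable lborel (\<lambda>t. a t * iexp (u * t))" for u
    by (rule Bochner_Integration.integrable_bound[OF a]) (auto simp: norm_mult)
  have ahb: "cmod (ah u) \<le> N" for u
    unfolding ah_def N_def by (rule order_trans[OF integral_norm_bound]) (simp add: norm_mult)
  have wi: "integrable lborel w"
    using integrable_norm[OF gaussian_weight_transform(1)[OF L, of 0]] unfolding w_def by (simp add: norm_mult)
  have wg: "integrable lborel (\<lambda>u. complex_of_real (w u) * iexp (u * x))"
    "(LINT u|lborel. complex_of_real (w u) * iexp (u * x)) = complex_of_real (g x)" for x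
    unfolding w_def g_def using gaussian_weight_transform[OF L, of x] by auto
  \<comment> \<open>One integrability statement serves both applications of Fubini: with
    \<open>c\<close> an exponential and \<open>M\<close> = 1, and with \<open>c\<close> the
    conjugate of \<open>ah\<close> and \<open>M\<close> = \<open>N\<close>.\<close>
  have prod: "integrable (lborel \<Otimes>\<^sub>M lborel) (\<lambda>(u, t). of_real (w u) * c u * (e u t * b t))"
    if [measurable]: "c \<in> borel_measurable borel" "case_prod e \<in> borel_measurable (borel \<Otimes>\<^sub>M borel)" "b \<in> borel_measurable borel"
      and "\<And>u. cmod (c u) \<le> M" "\<And>u t. cmod (e u t) = 1" "\<And>t. cmod (b t) = cmod (a t)"
    for c :: "real \<Rightarrow> complex" and e :: "real \<Rightarrow> real \<Rightarrow> complex" and b M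
  proof (rule lborel_pair.Fubini_integrable)
    have [measurable]: "(\<lambda>x. e (fst x) (snd x)) \<in> borel_measurable (lborel \<Otimes>\<^sub>M lborel)"
      using that(2) by (simp add: case_prod_beta' cong: measurable_cong_sets)
    show "(\<lambda>(u, t). of_real (w u) * c u * (e u t * b t)) \<in> borel_measurable (lborel \<Otimes>\<^sub>M lborel)"
      unfolding case_prod_beta' by measurable
    have M0: "0 \<le> M" using that(4)[of 0] norm_ge_zero order_trans by blast
    show "integrable lborel (\<lambda>u. LINT t|lborel. norm (case (u, t) of (u, t) \<Rightarrow> of_real (w u) * c u * (e u t * b t)))"
    proof -
      have "integrable lborel (\<lambda>u. w u * cmod (c u) * N)"
      proof (rule Bochner_Integration.integrable_bound[OF integrable_mult_left[OF wi, of "M * N"]])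
        show "AE u in lborel. norm (w u * cmod (c u) * N) \<le> norm (w u * (M * N))"
          using that(4) N0 M0 w0 by (intro AE_I2) (auto simp: norm_mult less_imp_le mult.assoc intro!: mult_left_mono mult_right_mono)
      qed auto
      thus ?thesis using w0 by (simp add: norm_mult that N_def less_imp_le)
    qed
    show "AE u in lborel. integrable lborel (\<lambda>t. case (u, t) of (u, t) \<Rightarrow> of_real (w u) * c u * (e u t * b t))"
    proof (intro AE_I2)
      fix u :: real
      have [measurable]: "e u \<in> borel_measurable borel" using measurable_Pair2[OF that(2), of u] by simp
      have "integrable lborel (\<lambda>t. of_real (w u) * c u * (e u t * b t))"
        using that by (intro integrable_mult_right Bochner_Integration.integrable_bound[OF a]) (auto simp: norm_mult)
      thus "integrable lborel (\<lambda>t. case (u, t) of (u, t) \<Rightarrow> of_real (w u) * c u * (e u t * b t))" by simp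
    qed
  qed
  define I where "I = (LINT u|lborel. w u * (cmod (ah u))\<^sup>2)"
  have Ii: "integrable lborel (\<lambda>u. w u * (cmod (ah u))\<^sup>2)"
  proof (rule Bochner_Integration.integrable_bound[OF integrable_mult_left[OF wi, of "N\<^sup>2"]])
    show "AE u in lborel. norm (w u * (cmod (ah u))\<^sup>2) \<le> norm (w u * N\<^sup>2)"
      using ahb w0 N0 by (intro AE_I2) (auto simp: abs_mult less_imp_le intro!: mult_left_mono power_mono)
  qed auto
  have inner: "(LINT u|lborel. of_real (w u) * cnj (ah u) * iexp (u * t)) = (LINT t'|lborel. cnj (a t') * of_real (g (t - t')))" for t
  proof -
    have "(LINT u|lborel. of_real (w u) * cnj (ah u) * iexp (u * t))
        = (LINT u|lborel. (LINT t'|lborel. of_real (w u) * iexp (u * t) * (iexp (- (u * t')) * cnj (a t'))))"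
    proof (intro Bochner_Integration.integral_cong refl)
      fix u
      have "cnj (ah u) = (LINT t'|lborel. cnj (a t' * iexp (u * t')))" unfolding ah_def by (rule integral_bounded_linear[OF bounded_linear_cnj ai, symmetric])
      also have "\<dots> = (LINT t'|lborel. iexp (- (u * t')) * cnj (a t'))"
        by (intro Bochner_Integration.integral_cong refl) (simp add: exp_cnj mult.commute)
      finally show "of_real (w u) * cnj (ah u) * iexp (u * t) = (LINT t'|lborel. of_real (w u) * iexp (u * t) * (iexp (- (u * t')) * cnj (a t')))"
        by (simp only: integral_mult_right_zero) (simp only: mult_ac)
    qed
    also have "\<dots> = (LINT t'|lborel. (LINT u|lborel. of_real (w u) * iexp (u * t) * (iexp (- (u * t')) * cnj (a t'))))"
      by (rule lborel_pair.Fubini_integral[symmetric], rule prod[where M = 1]) auto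
    also have "\<dots> = (LINT t'|lborel. cnj (a t') * of_real (g (t - t')))"
    proof (intro Bochner_Integration.integral_cong refl)
      fix t'
      have "(LINT u|lborel. of_real (w u) * iexp (u * t) * (iexp (- (u * t')) * cnj (a t')))
          = (LINT u|lborel. cnj (a t') * (of_real (w u) * iexp (u * (t - t'))))"
        by (intro Bochner_Integration.integral_cong refl) (simp add: right_diff_distrib exp_diff exp_minus field_simps)
      also have "\<dots> = cnj (a t') * of_real (g (t - t'))" by (simp only: integral_mult_right_zero wg)
      finally show "(LINT u|lborel. of_real (w u) * iexp (u * t) * (iexp (- (u * t')) * cnj (a t'))) = cnj (a t') * of_real (g (t - t'))" .
    qed
    finally show ?thesis .
  qed
  have "complex_of_real I = (LINT u|lborel. of_real (w u) * cnj (ah u) * ah u)"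
    unfolding I_def integral_complex_of_real[symmetric]
    by (intro Bochner_Integration.integral_cong refl) (simp add: complex_norm_square mult_ac del: of_real_power)
  also have "\<dots> = (LINT u|lborel. LINT t|lborel. of_real (w u) * cnj (ah u) * (iexp (u * t) * a t))"
  proof (intro Bochner_Integration.integral_cong refl)
    fix u
    have "ah u = (LINT t|lborel. iexp (u * t) * a t)" unfolding ah_def by (simp only: mult.commute)
    thus "of_real (w u) * cnj (ah u) * ah u = (LINT t|lborel. of_real (w u) * cnj (ah u) * (iexp (u * t) * a t))"
      by (simp only: integral_mult_right_zero)
  qed
  also have "\<dots> = (LINT t|lborel. LINT u|lborel. of_real (w u) * cnj (ah u) * (iexp (u * t) * a t))"
    by (rule lborel_pair.Fubini_integral[symmetric], rule prod[where M = N]) (use ahb in auto)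
  also have "\<dots> = (LINT t|lborel. a t * (LINT t'|lborel. cnj (a t') * of_real (g (t - t'))))"
  proof (intro Bochner_Integration.integral_cong refl)
    fix t
    have "(LINT u|lborel. of_real (w u) * cnj (ah u) * (iexp (u * t) * a t)) = (LINT u|lborel. a t * (of_real (w u) * cnj (ah u) * iexp (u * t)))"
      by (intro Bochner_Integration.integral_cong refl) (simp add: mult_ac)
    thus "(LINT u|lborel. of_real (w u) * cnj (ah u) * (iexp (u * t) * a t)) = a t * (LINT t'|lborel. cnj (a t') * of_real (g (t - t')))"
      by (simp only: integral_mult_right_zero inner)
  qed
  finally have Ieq: "complex_of_real I = (LINT t|lborel. a t * (LINT t'|lborel. cnj (a t') * of_real (g (t - t'))))" .
  have norm_le: "ennreal (cmod (LINT x|lborel. f x)) \<le> (\<integral>\<^sup>+x. ennreal (cmod (f x)) \<partial>lborel)" for f :: "real \<Rightarrow> complex"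
    by (cases "integrable lborel f") (auto simp: integral_norm_bound_ennreal not_integrable_integral_eq)
  have "ennreal I \<le> ennreal (cmod (complex_of_real I))" by (intro ennreal_leI) simp
  also have "\<dots> \<le> (\<integral>\<^sup>+t. ennreal (cmod (a t * (LINT t'|lborel. cnj (a t') * of_real (g (t - t'))))) \<partial>lborel)"
    unfolding Ieq by (rule norm_le)
  also have "\<dots> \<le> (\<integral>\<^sup>+t. (\<integral>\<^sup>+t'. ennreal ((cmod (a t))\<^sup>2 / 2 * g (t - t')) + ennreal ((cmod (a t'))\<^sup>2 / 2 * g (t - t')) \<partial>lborel) \<partial>lborel)"
  proof (intro nn_integral_mono)
    fix t :: real
    have "ennreal (cmod (a t * (LINT t'|lborel. cnj (a t') * of_real (g (t - t'))))) = ennreal (cmod (a t)) * ennreal (cmod (LINT t'|lborel. cnj (a t') * of_real (g (t - t'))))"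
      by (simp add: norm_mult ennreal_mult)
    also have "\<dots> \<le> ennreal (cmod (a t)) * (\<integral>\<^sup>+t'. ennreal (cmod (cnj (a t') * of_real (g (t - t')))) \<partial>lborel)"
      by (intro mult_left_mono norm_le) auto
    also have "\<dots> = (\<integral>\<^sup>+t'. ennreal (cmod (a t)) * ennreal (cmod (cnj (a t') * of_real (g (t - t')))) \<partial>lborel)"
      by (intro nn_integral_cmult[symmetric]) measurable
    also have "\<dots> \<le> (\<integral>\<^sup>+t'. ennreal ((cmod (a t))\<^sup>2 / 2 * g (t - t')) + ennreal ((cmod (a t'))\<^sup>2 / 2 * g (t - t')) \<partial>lborel)"
    proof (intro nn_integral_mono)
      fix t' :: real
      \<comment> \<open>Schur's test: after this inequality each term has, apart from the kernel,
        only one of the two variables, and integrating the kernel out gives pi times the integral of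
        |a|^2 for each.\<close>
      have "cmod (a t) * cmod (a t') \<le> (cmod (a t))\<^sup>2 / 2 + (cmod (a t'))\<^sup>2 / 2"
        using sum_squares_bound[of "cmod (a t)" "cmod (a t')"] by simp
      from mult_right_mono[OF this g0[of "t - t'"]]
      have "cmod (a t) * (cmod (a t') * g (t - t')) \<le> (cmod (a t))\<^sup>2 / 2 * g (t - t') + (cmod (a t'))\<^sup>2 / 2 * g (t - t')"
        by (simp add: algebra_simps)
      thus "ennreal (cmod (a t)) * ennreal (cmod (cnj (a t') * of_real (g (t - t')))) \<le> ennreal ((cmod (a t))\<^sup>2 / 2 * g (t - t')) + ennreal ((cmod (a t'))\<^sup>2 / 2 * g (t - t'))"
        using g0 by (simp add: norm_mult ennreal_mult[symmetric] ennreal_plus[symmetric] ennreal_leI del: ennreal_plus)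
    qed
    finally show "ennreal (cmod (a t * (LINT t'|lborel. cnj (a t') * of_real (g (t - t'))))) \<le> (\<integral>\<^sup>+t'. ennreal ((cmod (a t))\<^sup>2 / 2 * g (t - t')) + ennreal ((cmod (a t'))\<^sup>2 / 2 * g (t - t')) \<partial>lborel)" .
  qed
  also have "\<dots> = (\<integral>\<^sup>+t. (\<integral>\<^sup>+t'. ennreal ((cmod (a t))\<^sup>2 / 2 * g (t - t')) \<partial>lborel) \<partial>lborel) + (\<integral>\<^sup>+t. (\<integral>\<^sup>+t'. ennreal ((cmod (a t'))\<^sup>2 / 2 * g (t - t')) \<partial>lborel) \<partial>lborel)"
  proof -
    have "(\<integral>\<^sup>+t. (\<integral>\<^sup>+t'. ennreal ((cmod (a t))\<^sup>2 / 2 * g (t - t')) + ennreal ((cmod (a t'))\<^sup>2 / 2 * g (t - t')) \<partial>lborel) \<partial>lborel)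
      = (\<integral>\<^sup>+t. (\<integral>\<^sup>+t'. ennreal ((cmod (a t))\<^sup>2 / 2 * g (t - t')) \<partial>lborel) + (\<integral>\<^sup>+t'. ennreal ((cmod (a t'))\<^sup>2 / 2 * g (t - t')) \<partial>lborel) \<partial>lborel)"
      by (intro nn_integral_cong nn_integral_add) measurable
    thus ?thesis by (subst (asm) nn_integral_add) measurable
  qed
  also have "(\<integral>\<^sup>+t. (\<integral>\<^sup>+t'. ennreal ((cmod (a t'))\<^sup>2 / 2 * g (t - t')) \<partial>lborel) \<partial>lborel) = (\<integral>\<^sup>+t'. (\<integral>\<^sup>+t. ennreal ((cmod (a t'))\<^sup>2 / 2 * g (t - t')) \<partial>lborel) \<partial>lborel)"
    by (rule lborel_pair.Fubini') measurable
  also have "(\<integral>\<^sup>+t'. (\<integral>\<^sup>+t. ennreal ((cmod (a t'))\<^sup>2 / 2 * g (t - t')) \<partial>lborel) \<partial>lborel) = (\<integral>\<^sup>+t. ennreal (pi * (cmod (a t))\<^sup>2) \<partial>lborel)"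
  proof (intro nn_integral_cong)
    fix t' :: real
    have "(\<integral>\<^sup>+t. ennreal (g (t - t')) \<partial>lborel) = ennreal (2 * pi)"
      using nn_integral_real_affine[of "\<lambda>x. ennreal (g x)" 1 "-t'"] nn_integral_gaussian_kernel[OF L]
      by (simp add: g_def)
    moreover have "(\<integral>\<^sup>+t. ennreal ((cmod (a t'))\<^sup>2 / 2 * g (t - t')) \<partial>lborel)
        = (\<integral>\<^sup>+t. ennreal ((cmod (a t'))\<^sup>2 / 2) * ennreal (g (t - t')) \<partial>lborel)"
      using g0 by (intro nn_integral_cong ennreal_mult) auto
    moreover have "\<dots> = ennreal ((cmod (a t'))\<^sup>2 / 2) * (\<integral>\<^sup>+t. ennreal (g (t - t')) \<partial>lborel)"
      by (intro nn_integral_cmult) measurable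
    moreover have "ennreal ((cmod (a t'))\<^sup>2 / 2) * ennreal (2 * pi) = ennreal (pi * (cmod (a t'))\<^sup>2)"
      by (subst ennreal_mult[symmetric]) (auto simp: mult.commute)
    ultimately show "(\<integral>\<^sup>+t. ennreal ((cmod (a t'))\<^sup>2 / 2 * g (t - t')) \<partial>lborel) = ennreal (pi * (cmod (a t'))\<^sup>2)"
      by (simp only:)
  qed
  also have "(\<integral>\<^sup>+t. (\<integral>\<^sup>+t'. ennreal ((cmod (a t))\<^sup>2 / 2 * g (t - t')) \<partial>lborel) \<partial>lborel) = (\<integral>\<^sup>+t. ennreal (pi * (cmod (a t))\<^sup>2) \<partial>lborel)"
  proof (intro nn_integral_cong)
    fix t :: real
    have "(\<integral>\<^sup>+t'. ennreal (g (t - t')) \<partial>lborel) = ennreal (2 * pi)"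
      using nn_integral_real_affine[of "\<lambda>x. ennreal (g x)" "-1" "t"] nn_integral_gaussian_kernel[OF L]
      by (simp add: g_def)
    moreover have "(\<integral>\<^sup>+t'. ennreal ((cmod (a t))\<^sup>2 / 2 * g (t - t')) \<partial>lborel)
        = (\<integral>\<^sup>+t'. ennreal ((cmod (a t))\<^sup>2 / 2) * ennreal (g (t - t')) \<partial>lborel)"
      using g0 by (intro nn_integral_cong ennreal_mult) auto
    moreover have "\<dots> = ennreal ((cmod (a t))\<^sup>2 / 2) * (\<integral>\<^sup>+t'. ennreal (g (t - t')) \<partial>lborel)"
      by (intro nn_integral_cmult) measurable
    moreover have "ennreal ((cmod (a t))\<^sup>2 / 2) * ennreal (2 * pi) = ennreal (pi * (cmod (a t))\<^sup>2)"
      by (subst ennreal_mult[symmetric]) (auto simp: mult.commute)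
    ultimately show "(\<integral>\<^sup>+t'. ennreal ((cmod (a t))\<^sup>2 / 2 * g (t - t')) \<partial>lborel) = ennreal (pi * (cmod (a t))\<^sup>2)"
      by (simp only:)
  qed
  also have "(\<integral>\<^sup>+t. ennreal (pi * (cmod (a t))\<^sup>2) \<partial>lborel) = ennreal (pi * (LINT t|lborel. (cmod (a t))\<^sup>2))"
    using a2 by (subst nn_integral_eq_integral) auto
  also have "\<dots> + \<dots> = ennreal (2 * pi * (LINT t|lborel. (cmod (a t))\<^sup>2))"
    by (subst ennreal_plus[symmetric]) auto
  finally have Ile: "I \<le> 2 * pi * (LINT t|lborel. (cmod (a t))\<^sup>2)"
    by (subst (asm) ennreal_le_iff) auto
  \<comment> \<open>On [-L, L] the Gaussian weight is at least exp (-1/2); hence the factor exp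
    (1/2) in the bound.\<close>
  have pw: "indicat_real {-L..L} u *\<^sub>R (cmod (ah u))\<^sup>2 \<le> exp (1/2) * (w u * (cmod (ah u))\<^sup>2)" for u
  proof (cases "u \<in> {-L..L}")
    case True
    hence "u\<^sup>2 \<le> L\<^sup>2" by (intro abs_le_square_iff[THEN iffD1]) auto
    hence "exp 0 \<le> exp (1/2 + - (u\<^sup>2) / (2 * L\<^sup>2))" using L by (simp add: field_simps)
    hence "1 \<le> exp (1/2) * w u" unfolding w_def exp_add by simp
    from mult_right_mono[OF this, of "(cmod (ah u))\<^sup>2"] True show ?thesis by (simp add: mult.assoc)
  qed (use w0 in \<open>auto simp: less_imp_le\<close>)
  show s: "set_integrable lborel {-L..L} (\<lambda>u. (cmod (LINT t|lborel. a t * iexp (u * t)))\<^sup>2)"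
    unfolding set_integrable_def ah_def[symmetric]
  proof (rule Bochner_Integration.integrable_bound[OF integrable_mult_right[OF Ii, of "exp (1/2)"]])
    show "AE u in lborel. norm (indicat_real {-L..L} u *\<^sub>R (cmod (ah u))\<^sup>2) \<le> norm (exp (1/2) * (w u * (cmod (ah u))\<^sup>2))"
      using pw w0 by (intro AE_I2) (auto simp: abs_mult less_imp_le)
  qed auto
  have "(LINT u:{-L..L}|lborel. (cmod (LINT t|lborel. a t * iexp (u * t)))\<^sup>2) \<le> (LINT u|lborel. exp (1/2) * (w u * (cmod (ah u))\<^sup>2))"
    unfolding set_lebesgue_integral_def ah_def[symmetric]
    by (rule integral_mono[OF s[unfolded set_integrable_def ah_def[symmetric]] integrable_mult_right[OF Ii] pw])
  also have "\<dots> = exp (1/2) * I" unfolding I_def by simp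
  also have "\<dots> \<le> exp (1/2) * (2 * pi * (LINT t|lborel. (cmod (a t))\<^sup>2))" using Ile by (intro mult_left_mono) auto
  finally show "(LINT u:{-L..L}|lborel. (cmod (LINT t|lborel. a t * iexp (u * t)))\<^sup>2) \<le> 2 * pi * exp (1/2) * (LINT t|lborel. (cmod (a t))\<^sup>2)"
    by (simp add: mult_ac)
qed

section \<open>Growth of the Gamma function and of functions in a strip\<close>

text \<open>Both sides are limits of Euler's products, which are compared factor by factor: for z =
  p + k the inequality |z + q| Re z \<le> |z| (Re z + q) follows from Re z \<le> |z|. In terms of
  \<open>Gamma\<close>: among all p of given real part, |Gamma p / Gamma (p + q)| is largest at the
  real one.\<close>

lemma norm_rGamma_shift_le:
  fixes p :: complex and q :: real
  assumes "0 < Re p" "0 \<le> q"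
  shows "cmod (rGamma (p + of_real q)) * rGamma (Re p) \<le> cmod (rGamma p) * rGamma (Re p + q)"
proof -
  have le: "cmod (rGamma_series (p + of_real q) n) * rGamma_series (Re p) n \<le> cmod (rGamma_series p n) * rGamma_series (Re p + q) n"
    if "n > 0" for n :: nat
  proof -
    have P: "cmod (pochhammer (p + of_real q) k) * pochhammer (Re p) k \<le> cmod (pochhammer p k) * pochhammer (Re p + q) k" for k
    proof (induction k)
      case (Suc k)
      define z where "z = p + of_nat k"
      have "cmod (z + of_real q) \<le> cmod z + q" using assms norm_triangle_ineq[of z "of_real q"] by simp
      hence "cmod (z + of_real q) * Re z \<le> (cmod z + q) * Re z"
        using assms by (intro mult_right_mono) (auto simp: z_def)
      also have "\<dots> \<le> cmod z * (Re z + q)" using complex_Re_le_cmod[of z] assms(2)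
        by (simp add: algebra_simps mult_left_mono)
      finally have *: "cmod (p + of_real q + of_nat k) * (Re p + of_nat k) \<le> cmod (p + of_nat k) * (Re p + q + of_nat k)"
        by (simp add: z_def algebra_simps)
      have "cmod (pochhammer (p + of_real q) (Suc k)) * pochhammer (Re p) (Suc k)
          = (cmod (pochhammer (p + of_real q) k) * pochhammer (Re p) k) * (cmod (p + of_real q + of_nat k) * (Re p + of_nat k))"
        by (simp add: pochhammer_Suc norm_mult mult_ac)
      also have "\<dots> \<le> (cmod (pochhammer p k) * pochhammer (Re p + q) k) * (cmod (p + of_nat k) * (Re p + q + of_nat k))"
        using assms by (intro mult_mono Suc * mult_nonneg_nonneg) (auto intro!: pochhammer_nonneg)
      also have "\<dots> = cmod (pochhammer p (Suc k)) * pochhammer (Re p + q) (Suc k)"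
        by (simp add: pochhammer_Suc norm_mult mult_ac)
      finally show ?case .
    qed simp
    \<comment> \<open>The factorials and powers of n have the same total modulus \<open>E\<close> on
      both sides, so only the Pochhammer symbols have to be compared.\<close>
    define E where "E = fact n * fact n * exp (Re p * ln n) * exp ((Re p + q) * ln n)"
    have E: "0 < E" by (simp add: E_def)
    have "cmod (rGamma_series (p + of_real q) n) * rGamma_series (Re p) n = cmod (pochhammer (p + of_real q) (n+1)) * pochhammer (Re p) (n+1) / E"
      unfolding rGamma_series_def E_def by (simp add: norm_divide norm_mult mult_ac)
    moreover have "cmod (rGamma_series p n) * rGamma_series (Re p + q) n = cmod (pochhammer p (n+1)) * pochhammer (Re p + q) (n+1) / E"
      unfolding rGamma_series_def E_def by (simp add: norm_divide norm_mult mult_ac)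
    ultimately show ?thesis using P[of "n+1"] E by (simp add: divide_right_mono)
  qed
  show ?thesis
  proof (rule tendsto_le)
    show "(\<lambda>n. cmod (rGamma_series p n) * rGamma_series (Re p + q) n) \<longlonglongrightarrow> cmod (rGamma p) * rGamma (Re p + q)"
      by (intro tendsto_intros rGamma_series_LIMSEQ)
    show "(\<lambda>n. cmod (rGamma_series (p + of_real q) n) * rGamma_series (Re p) n) \<longlonglongrightarrow> cmod (rGamma (p + of_real q)) * rGamma (Re p)"
      by (intro tendsto_intros rGamma_series_LIMSEQ)
    show "\<forall>\<^sub>F n in sequentially. cmod (rGamma_series (p + of_real q) n) * rGamma_series (Re p) n \<le> cmod (rGamma_series p n) * rGamma_series (Re p + q) n"
      using eventually_gt_at_top[of 0] by eventually_elim (use le in auto)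
  qed auto
qed

lemma norm_Gamma_le_norm_Gamma_shift:
  fixes p :: complex and q :: real
  assumes "0 < Re p" "0 \<le> q"
  shows "cmod (Gamma p) \<le> Gamma (Re p) / Gamma (Re p + q) * cmod (Gamma (p + of_real q))"
proof -
  have "z \<notin> \<int>\<^sub>\<le>\<^sub>0" if "0 < Re z" for z :: complex
  proof
    assume "z \<in> \<int>\<^sub>\<le>\<^sub>0"
    then obtain n where "z = of_int n" "n \<le> 0" by (elim nonpos_Ints_cases)
    thus False using that by simp
  qed
  hence 1: "0 < cmod (Gamma p)" "0 < cmod (Gamma (p + of_real q))"
    using assms by (simp_all add: Gamma_eq_zero_iff)
  have 2: "0 < Gamma (Re p)" "0 < Gamma (Re p + q)" using assms by (auto intro: Gamma_real_pos)
  have *: "x \<le> A / B * y" if "inverse y * inverse A \<le> inverse x * inverse B" "0 < x" "0 < y" "0 < A" "0 < B"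
    for x y A B :: real using that by (simp add: field_simps)
  show ?thesis using norm_rGamma_shift_le[OF assms] 1 2
    by (intro *) (simp_all only: rGamma_inverse_Gamma norm_inverse)
qed

lemma pochhammer_norm_le: "cmod (pochhammer z n) \<le> (cmod z + real n) ^ n"
proof -
  have "cmod (pochhammer z n) = (\<Prod>i<n. cmod (z + of_nat i))"
    by (simp add: pochhammer_prod prod_norm lessThan_atLeast0)
  also have "\<dots> \<le> (\<Prod>i<n. cmod z + real n)"
    by (intro prod_mono conjI norm_ge_zero order_trans[OF norm_triangle_ineq]) auto
  finally show ?thesis by simp
qed

text \<open>Plays the part of Stirling's formula. The shift is rounded up to an integer n: passing
  from z + w to z + n costs a constant, because Re (z + w) > 0, and returning to z costs a
  Pochhammer symbol. Re z itself may be negative.\<close>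

lemma Gamma_shift_polynomial_bound:
  fixes x w :: real
  assumes "0 \<le> w" "0 < x + w"
  obtains C N where "0 \<le> C" "\<And>z. Re z = x \<Longrightarrow> z \<notin> \<int>\<^sub>\<le>\<^sub>0 \<Longrightarrow> cmod (Gamma (z + of_real w)) \<le> C * (1 + cmod z) ^ N * cmod (Gamma z)"
proof -
  define n where "n = nat \<lceil>w\<rceil>"
  have n: "w \<le> real n" unfolding n_def by linarith
  define K where "K = Gamma (x + w) / Gamma (x + real n)"
  have K: "0 \<le> K" unfolding K_def using assms n by (intro divide_nonneg_nonneg less_imp_le[OF Gamma_real_pos]) auto
  have "cmod (Gamma (z + of_real w)) \<le> (K * (1 + real n) ^ n) * (1 + cmod z) ^ n * cmod (Gamma z)"
    if z: "Re z = x" "z \<notin> \<int>\<^sub>\<le>\<^sub>0" for z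
  proof -
    have "cmod (Gamma (z + of_real w)) \<le> K * cmod (Gamma (z + of_real w + of_real (real n - w)))"
      using norm_Gamma_le_norm_Gamma_shift[of "z + of_real w" "real n - w"] assms n z unfolding K_def by simp
    also have "z + of_real w + of_real (real n - w) = z + of_nat n" by simp
    also have "Gamma (z + of_nat n) = pochhammer z n * Gamma z"
      using pochhammer_Gamma[of z n] z by (simp add: Gamma_eq_zero_iff)
    also have "K * cmod (pochhammer z n * Gamma z) \<le> K * ((cmod z + real n) ^ n * cmod (Gamma z))"
      unfolding norm_mult by (intro mult_left_mono mult_right_mono pochhammer_norm_le K) auto
    also have "\<dots> \<le> K * (((1 + real n) * (1 + cmod z)) ^ n * cmod (Gamma z))"
      using K by (intro mult_left_mono mult_right_mono power_mono) (auto simp: algebra_simps)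
    finally show ?thesis by (simp only: power_mult_distrib mult_ac)
  qed
  moreover have "0 \<le> K * (1 + real n) ^ n" using K by simp
  ultimately show ?thesis by (rule that[rotated]) 
qed

text \<open>Dividing by a power of s + k makes the function bounded on the edges. The multiplier
  \<open>E\<close> forces decay inside the strip, so that the maximum principle applies on a long
  rectangle, and letting \<epsilon> tend to 0 removes it again.\<close>

lemma phragmen_lindelof_strip:
  fixes G :: "complex \<Rightarrow> complex"
  assumes hol: "G holomorphic_on UNIV" and ab: "a < b"
    and growth: "\<And>s. cmod (G s) \<le> C * exp (cmod s powr A)"
    and edge: "\<And>s. Re s = a \<or> Re s = b \<Longrightarrow> cmod (G s) \<le> M * (1 + cmod s) ^ N"
  obtains M' where "0 \<le> M'" "\<And>s. a \<le> Re s \<Longrightarrow> Re s \<le> b \<Longrightarrow> cmod (G s) \<le> M' * (1 + cmod s) ^ N"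
proof -
  \<comment> \<open>With this k the real part of s + k is at least 1 on the strip, so |s + k| stays
    away from 0 and is comparable with 1 + |s|.\<close>
  define k where "k = 1 + \<bar>a\<bar>"
  define M1 where "M1 = max M 0 * (k + 2) ^ N + 1"
  have k: "1 \<le> k" by (simp add: k_def)
  have M1: "0 < M1" unfolding M1_def using k by (intro add_nonneg_pos mult_nonneg_nonneg) auto
  \<comment> \<open>With this \<alpha> the argument of the cosine has real part at most 1/2 < pi/3
    in modulus, so the cosine has real part at least exp (\<alpha> |Im s|) / 4. The multiplier then
    decays doubly exponentially and beats exp (|s|^A) for every A.\<close>
  define \<alpha> where "\<alpha> = 1 / (b - a)"
  have \<alpha>: "0 < \<alpha>" using ab by (simp add: \<alpha>_def)
  define m where "m = \<bar>a\<bar> + \<bar>b\<bar>"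
  have sk: "1 \<le> cmod (s + of_real k)" "1 + cmod s \<le> (k + 2) * cmod (s + of_real k)" "s + of_real k \<noteq> 0"
    if "a \<le> Re s" for s
  proof -
    have "1 \<le> Re (s + of_real k)" using that by (simp add: k_def)
    thus 1: "1 \<le> cmod (s + of_real k)" using complex_Re_le_cmod order_trans by blast
    thus "s + of_real k \<noteq> 0" by auto
    have "cmod s \<le> cmod (s + of_real k) + k" using norm_triangle_ineq4[of "s + of_real k" "of_real k"] k by simp
    moreover have "(k + 1) * 1 \<le> (k + 1) * cmod (s + of_real k)" using 1 k by (intro mult_left_mono) auto
    ultimately show "1 + cmod s \<le> (k + 2) * cmod (s + of_real k)" by (simp add: algebra_simps)
  qed
  define H where "H s = G s / (s + of_real k) ^ N" for s
  define E where "E \<epsilon> s = exp (- of_real \<epsilon> * cos (of_real \<alpha> * (s - of_real ((a + b) / 2))))" for \<epsilon> :: real and s :: complex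
  have E: "cmod (E \<epsilon> s) \<le> exp (- (\<epsilon> * exp (\<alpha> * \<bar>Im s\<bar>) / 4))" if "a \<le> Re s" "Re s \<le> b" "0 \<le> \<epsilon>" for \<epsilon> s
  proof -
    define x where "x = \<alpha> * (Re s - (a + b) / 2)"
    have "\<bar>Re s - (a + b) / 2\<bar> \<le> (b - a) / 2" using that by (auto simp: abs_le_iff field_simps)
    hence "\<bar>x\<bar> \<le> 1 / 2" using ab unfolding x_def \<alpha>_def abs_mult by (simp add: field_simps)
    hence "\<bar>x\<bar> \<le> pi / 3" using pi_gt3 by linarith
    hence "cos (pi / 3) \<le> cos \<bar>x\<bar>" by (intro cos_monotone_0_pi_le) (use pi_gt3 in auto)
    hence c: "1 / 2 \<le> cos x" by (simp add: cos_60)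
    have ch: "exp (\<alpha> * \<bar>Im s\<bar>) / 2 \<le> cosh (\<alpha> * Im s)"
      using \<alpha> by (cases "0 \<le> Im s") (auto simp: cosh_field_def)
    have "1/2 * (exp (\<alpha> * \<bar>Im s\<bar>) / 2) \<le> cos x * cosh (\<alpha> * Im s)"
      using c ch by (intro mult_mono) auto
    also have "cos x * cosh (\<alpha> * Im s) = Re (cos (of_real \<alpha> * (s - of_real ((a + b) / 2))))"
      by (simp add: Re_cos x_def cosh_field_def exp_minus algebra_simps)
    finally have "exp (\<alpha> * \<bar>Im s\<bar>) / 4 \<le> Re (cos (of_real \<alpha> * (s - of_real ((a + b) / 2))))" by simp
    from mult_left_mono[OF this that(3)] show ?thesis unfolding E_def by simp
  qed
  have edgeH: "cmod (H s) \<le> M1" if "Re s = a \<or> Re s = b" for s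
  proof -
    have as: "a \<le> Re s" using that ab by auto
    have "cmod (G s) \<le> max M 0 * (1 + cmod s) ^ N" using edge[OF that] 
      by (meson max.cobounded1 mult_right_mono norm_ge_zero order_trans zero_le_power add_nonneg_nonneg zero_le_one)
    also have "\<dots> \<le> max M 0 * ((k + 2) * cmod (s + of_real k)) ^ N"
      using sk[OF as] by (intro mult_left_mono power_mono) auto
    also have "\<dots> \<le> M1 * cmod (s + of_real k) ^ N"
      unfolding M1_def power_mult_distrib by (simp add: distrib_right)
    finally show ?thesis using sk[OF as] unfolding H_def norm_divide norm_power by (simp add: divide_le_eq)
  qed
  have main: "cmod (H s * E \<epsilon> s) \<le> M1" if s: "a \<le> Re s" "Re s \<le> b" and \<epsilon>: "0 < \<epsilon>" for s \<epsilon>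
  proof -
    \<comment> \<open>T is taken so large that s lies in the rectangle and the growth bound times
      the multiplier is below \<open>M1\<close> on the horizontal edges. Using
      \<open>\<bar>A\<bar>\<close> avoids a distinction by the sign of A.\<close>
    have "((\<lambda>T. C * exp ((m + T) powr \<bar>A\<bar> - \<epsilon> * exp (\<alpha> * T) / 4)) \<longlongrightarrow> 0) at_top"
      using \<epsilon> \<alpha> by real_asymp
    from order_tendstoD(2)[OF this M1]
    have "\<forall>\<^sub>F T in at_top. C * exp ((m + T) powr \<bar>A\<bar> - \<epsilon> * exp (\<alpha> * T) / 4) < M1 \<and> 1 \<le> T \<and> \<bar>Im s\<bar> \<le> T"
      by (intro eventually_conj eventually_ge_at_top)
    then obtain T where T: "C * exp ((m + T) powr \<bar>A\<bar> - \<epsilon> * exp (\<alpha> * T) / 4) < M1" "1 \<le> T" "\<bar>Im s\<bar> \<le> T"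
      by (auto dest: eventually_happens)
    define R where "R = cbox (Complex a (-T)) (Complex b T)"
    have R: "z \<in> R \<longleftrightarrow> a \<le> Re z \<and> Re z \<le> b \<and> \<bar>Im z\<bar> \<le> T" for z
      unfolding R_def in_cbox_complex_iff by auto
    have holR: "(\<lambda>z. H z * E \<epsilon> z) holomorphic_on R"
      unfolding H_def E_def using sk by (intro holomorphic_intros holomorphic_on_subset[OF hol]) (auto simp: R)
    have C0: "0 \<le> C" using growth[of 0] norm_ge_zero[of "G 0"] 
      by (smt (verit) exp_gt_zero mult_neg_pos)
    show ?thesis
    proof (rule maximum_modulus_frontier[where S = R and f = "\<lambda>z. H z * E \<epsilon> z"])
      show "(\<lambda>z. H z * E \<epsilon> z) holomorphic_on interior R"
        using holR interior_subset holomorphic_on_subset by blast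
      show "continuous_on (closure R) (\<lambda>z. H z * E \<epsilon> z)"
        using holomorphic_on_imp_continuous_on[OF holR] by (simp add: R_def)
      show "bounded R" by (simp add: R_def)
      show "s \<in> R" using s T by (simp add: R)
      fix z assume "z \<in> frontier R"
      moreover have "z \<in> R" using \<open>z \<in> frontier R\<close> by (simp add: R_def frontier_cbox split: if_splits)
      ultimately have zR: "a \<le> Re z" "Re z \<le> b" "\<bar>Im z\<bar> \<le> T" and "z \<notin> box (Complex a (-T)) (Complex b T)"
        using R by (auto simp: R_def frontier_cbox split: if_splits)
      hence "Re z = a \<or> Re z = b \<or> \<bar>Im z\<bar> = T" by (auto simp: in_box_complex_iff)
      thus "cmod (H z * E \<epsilon> z) \<le> M1"
      proof (elim disjE)
        have "cmod (E \<epsilon> z) \<le> 1" using E[OF zR(1,2), of \<epsilon>] \<epsilon> by (smt (verit) exp_ge_zero one_le_exp_iff exp_le_one_iff divide_nonneg_pos mult_nonneg_nonneg)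
        moreover assume "Re z = a"
        ultimately show ?thesis using edgeH[of z] M1 unfolding norm_mult
          by (smt (verit) mult_left_le norm_ge_zero)
      next
        have "cmod (E \<epsilon> z) \<le> 1" using E[OF zR(1,2), of \<epsilon>] \<epsilon> by (smt (verit) exp_ge_zero one_le_exp_iff exp_le_one_iff divide_nonneg_pos mult_nonneg_nonneg)
        moreover assume "Re z = b"
        ultimately show ?thesis using edgeH[of z] M1 unfolding norm_mult
          by (smt (verit) mult_left_le norm_ge_zero)
      next
        assume I: "\<bar>Im z\<bar> = T"
        have z1: "1 \<le> cmod z" using I T(2) abs_Im_le_cmod[of z] by linarith
        have z2: "cmod z \<le> m + T" using cmod_le[of z] zR I unfolding m_def by linarith
        have "cmod (H z) \<le> cmod (G z)" unfolding H_def norm_divide norm_power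
          using sk[OF zR(1)] by (intro divide_le_eq[THEN iffD2]) (auto intro!: mult_right_le_one_le simp: mult_le_cancel_left1 one_le_power power_0_left)
        also have "\<dots> \<le> C * exp ((m + T) powr \<bar>A\<bar>)"
        proof (rule order_trans[OF growth])
          have "cmod z powr A \<le> cmod z powr \<bar>A\<bar>" using z1 by (intro powr_mono) auto
          also have "\<dots> \<le> (m + T) powr \<bar>A\<bar>" using z2 by (intro powr_mono2) auto
          finally show "C * exp (cmod z powr A) \<le> C * exp ((m + T) powr \<bar>A\<bar>)" using C0 by (intro mult_left_mono) auto
        qed
        finally have "cmod (H z * E \<epsilon> z) \<le> C * exp ((m + T) powr \<bar>A\<bar>) * exp (- (\<epsilon> * exp (\<alpha> * T) / 4))"
          unfolding norm_mult using E[OF zR(1,2), of \<epsilon>] \<epsilon> I C0 by (intro mult_mono) auto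
        also have "\<dots> = C * exp ((m + T) powr \<bar>A\<bar> - \<epsilon> * exp (\<alpha> * T) / 4)" by (simp only: mult.assoc exp_add[symmetric]) simp
        finally show ?thesis using T by simp
      qed
    qed
  qed
  have HM: "cmod (H s) \<le> M1" if s: "a \<le> Re s" "Re s \<le> b" for s
  proof (rule tendsto_upperbound[of "\<lambda>\<epsilon>. cmod (H s * E \<epsilon> s)" "cmod (H s)" "at_right 0"])
    have "((\<lambda>\<epsilon>. H s * E \<epsilon> s) \<longlongrightarrow> H s * exp (- of_real 0 * cos (of_real \<alpha> * (s - of_real ((a + b) / 2))))) (at_right 0)"
      unfolding E_def by (intro tendsto_intros)
    thus "((\<lambda>\<epsilon>. cmod (H s * E \<epsilon> s)) \<longlongrightarrow> cmod (H s)) (at_right 0)" by (intro tendsto_norm) simp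
    show "\<forall>\<^sub>F \<epsilon> in at_right 0. cmod (H s * E \<epsilon> s) \<le> M1"
      using eventually_at_right_less[of "0::real"] by eventually_elim (use main s in auto)
  qed auto
  have "cmod (G s) \<le> (M1 * k ^ N) * (1 + cmod s) ^ N" if s: "a \<le> Re s" "Re s \<le> b" for s
  proof -
    have "cmod (s + of_real k) \<le> cmod s + k" using norm_triangle_ineq[of s "of_real k"] k by simp
    also have "\<dots> \<le> k * (1 + cmod s)" using k mult_right_mono[of 1 k "cmod s"] by (simp add: algebra_simps)
    finally have *: "cmod (s + of_real k) ^ N \<le> (k * (1 + cmod s)) ^ N" by (intro power_mono) auto
    have "cmod (G s) = cmod (H s) * cmod (s + of_real k) ^ N"
      using sk(3)[OF s(1)] by (simp add: H_def norm_divide norm_power)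
    also have "\<dots> \<le> M1 * (k * (1 + cmod s)) ^ N" using HM[OF s] * M1 by (intro mult_mono) auto
    finally show ?thesis by (simp add: power_mult_distrib mult_ac)
  qed
  moreover have "0 \<le> M1 * k ^ N" using M1 k by simp
  ultimately show ?thesis by (rule that[rotated])
qed

text \<open>Borel-Caratheodory for a branch \<open>g\<close> of the logarithm of G, followed by
  Cauchy's inequality. On a disc without zeros, a bound for log |G| relative to the centre thus
  controls G'/G on a smaller concentric disc.\<close>

lemma log_deriv_bound_of_growth:
  fixes G :: "complex \<Rightarrow> complex"
  assumes hol: "G holomorphic_on ball z0 R" and nz: "\<And>z. z \<in> ball z0 R \<Longrightarrow> G z \<noteq> 0"
    and B: "\<And>z. z \<in> ball z0 R \<Longrightarrow> cmod (G z) \<le> B" and b: "0 < b" "b \<le> cmod (G z0)"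
    and r: "0 < r" "r < R" and z: "cmod (z - z0) \<le> r"
  shows "cmod (deriv G z / G z) \<le> 8 * R / (R - r)\<^sup>2 * (ln (B / b) + 1)"
proof -
  have R: "0 < R" using r by simp
  have "b \<le> B" using B[of z0] b R by auto
  obtain g where g: "g holomorphic_on ball z0 R" "\<And>z. z \<in> ball z0 R \<Longrightarrow> exp (g z) = G z"
    using holomorphic_logarithm_exists[OF convex_ball open_ball hol nz, of z0] R
    by (metis centre_in_ball)
  define f where "f z = g z - g z0" for z
  \<comment> \<open>The summand 1 makes Re f < M strict and keeps M positive even when B =
    b.\<close>
  define M where "M = ln (B / b) + 1"
  have M: "1 \<le> M" unfolding M_def using b \<open>b \<le> B\<close> by simp
  have fh: "f holomorphic_on ball z0 R" unfolding f_def by (intro holomorphic_intros g)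
  have Ref: "Re (f z) < M" if "z \<in> ball z0 R" for z
  proof -
    have "exp (Re (f z)) = cmod (G z) / cmod (G z0)"
      using g(2)[OF that] g(2)[of z0] R unfolding f_def by (simp add: exp_diff flip: norm_exp_eq_Re)
    also have "\<dots> \<le> B / b" using B[OF that] b \<open>b \<le> B\<close> by (intro frac_le) auto
    finally have "Re (f z) \<le> ln (B / b)" using b \<open>b \<le> B\<close> by (simp add: ln_ge_iff)
    thus ?thesis by (simp add: M_def)
  qed
  \<comment> \<open>The Moebius map w / (2 M - w) sends the half-plane Re w < M to the unit disc and
    fixes 0, so Schwarz's lemma applies once the disc is rescaled to radius 1.\<close>
  define h where "h z = f z / (of_real (2 * M) - f z)" for z
  have den: "of_real (2 * M) - f z \<noteq> 0" if "z \<in> ball z0 R" for z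
    using Ref[OF that] M by (auto simp: complex_eq_iff)
  have h1: "cmod (h z) < 1" if "z \<in> ball z0 R" for z
  proof -
    have "(Re (f z))\<^sup>2 < (2 * M - Re (f z))\<^sup>2"
    proof -
      have "0 < 4 * M * (M - Re (f z))" using Ref[OF that] M by simp
      thus ?thesis by (simp add: power2_eq_square algebra_simps)
    qed
    hence "(cmod (f z))\<^sup>2 < (cmod (of_real (2 * M) - f z))\<^sup>2" by (simp add: cmod_power2)
    hence "cmod (f z) < cmod (of_real (2 * M) - f z)" by (rule power2_less_imp_less) simp
    thus ?thesis using den[OF that] by (simp add: h_def norm_divide divide_less_eq)
  qed
  have inb: "z0 + of_real R * x \<in> ball z0 R" if "cmod x < 1" for x
    using that R by (simp add: dist_norm norm_mult)
  have fb: "cmod (f z) \<le> 2 * M * \<rho> / (R - \<rho>)" if "cmod (z - z0) \<le> \<rho>" "0 < \<rho>" "\<rho> < R" for z \<rho>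
  proof -
    define x where "x = (z - z0) / of_real R"
    have x1: "cmod x < 1" and x\<rho>: "cmod x \<le> \<rho> / R" using that R by (auto simp: x_def norm_divide divide_right_mono)
    have zx: "z0 + of_real R * x = z" using R by (simp add: x_def)
    have zb: "z \<in> ball z0 R" using inb[OF x1] zx by simp
    have "cmod ((\<lambda>x. h (z0 + of_real R * x)) x) \<le> cmod x"
    proof (rule Schwarz_Lemma(1))
      have "f \<circ> (\<lambda>x. z0 + of_real R * x) holomorphic_on ball 0 1"
        by (intro holomorphic_on_compose_gen[OF _ fh] holomorphic_intros) (use inb in auto)
      thus "(\<lambda>x. h (z0 + of_real R * x)) holomorphic_on ball 0 1" unfolding h_def comp_def
        using den inb by (intro holomorphic_intros) auto
      show "h (z0 + of_real R * 0) = 0" by (simp add: h_def f_def)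
    qed (use h1 inb x1 in auto)
    hence hz: "cmod (h z) \<le> \<rho> / R" using x\<rho> zx by simp
    have "f z * (1 + h z) = of_real (2 * M) * h z" using den[OF zb] by (simp add: h_def field_simps)
    hence "cmod (f z) * cmod (1 + h z) = 2 * M * cmod (h z)" using M by (metis norm_mult norm_of_real abs_of_nonneg mult_nonneg_nonneg zero_le_numeral order_trans zero_le_one)
    also have "\<dots> \<le> 2 * M * (\<rho> / R)" using hz M by (intro mult_left_mono) auto
    finally have 1: "cmod (f z) * cmod (1 + h z) \<le> 2 * M * (\<rho> / R)" .
    have "1 - \<rho> / R \<le> cmod (1 + h z)" using hz norm_triangle_ineq4[of "1 + h z" "h z"] by simp
    hence "cmod (f z) * (1 - \<rho> / R) \<le> 2 * M * (\<rho> / R)" using 1 by (meson mult_left_mono norm_ge_zero order_trans)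
    moreover have "1 - \<rho> / R = (R - \<rho>) / R" using R by (simp add: field_simps)
    ultimately have "cmod (f z) * (R - \<rho>) / R \<le> 2 * M * \<rho> / R" by simp
    hence "cmod (f z) * (R - \<rho>) \<le> 2 * M * \<rho>" using R by (simp add: divide_le_cancel)
    thus ?thesis using that(3) by (subst pos_le_divide_eq) auto
  qed
  \<comment> \<open>Half of the gap between r and R is spent on the bound for f, the other half is
    the radius of the Cauchy circle; this gives (R - r)^-2.\<close>
  define \<rho> where "\<rho> = (R + r) / 2"
  have \<rho>: "0 < \<rho>" "\<rho> < R" "R - \<rho> = (R - r) / 2" using r by (auto simp: \<rho>_def field_simps)
  define d where "d = (R - r) / 2"
  have d: "0 < d" using r by (simp add: d_def)
  have sub: "cmod (x - z0) \<le> \<rho>" if "cmod (z - x) \<le> d" for x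
  proof -
    have "cmod (x - z0) \<le> cmod (z - x) + cmod (z - z0)" using norm_triangle_ineq4[of "z - z0" "z - x"] by simp
    thus ?thesis using that assms(8) unfolding \<rho>_def d_def by (simp add: field_simps)
  qed
  have sub': "cball z d \<subseteq> ball z0 R" using sub \<rho> by (force simp: dist_norm norm_minus_commute)
  have "cmod ((deriv ^^ 1) f z) \<le> fact 1 * (2 * M * \<rho> / (R - \<rho>)) / d ^ 1"
  proof (rule Cauchy_inequality)
    show "f holomorphic_on ball z d" using fh sub' holomorphic_on_subset ball_subset_cball by (metis order_trans)
    show "continuous_on (cball z d) f" using holomorphic_on_imp_continuous_on[OF holomorphic_on_subset[OF fh sub']] .
    show "cmod (f x) \<le> 2 * M * \<rho> / (R - \<rho>)" if "cmod (z - x) = d" for x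
      by (rule fb[OF sub \<rho>(1,2)]) (simp add: that)
  qed (rule d)
  also have "\<dots> \<le> 8 * R / (R - r)\<^sup>2 * M"
  proof -
    have "fact 1 * (2 * M * \<rho> / (R - \<rho>)) / d ^ 1 = 8 * \<rho> / (R - r)\<^sup>2 * M"
      unfolding \<rho>(3) d_def using r by (simp add: field_simps power2_eq_square)
    also have "\<dots> \<le> 8 * R / (R - r)\<^sup>2 * M" using \<rho> M by (intro mult_right_mono divide_right_mono) auto
    finally show ?thesis .
  qed
  also have "(deriv ^^ 1) f z = deriv G z / G z"
  proof -
    have zb: "z \<in> ball z0 R" using z r by (simp add: dist_norm norm_minus_commute)
    have "(g has_field_derivative deriv g z) (at z)" using g(1) zb holomorphic_derivI by blast
    hence "((\<lambda>z. exp (g z)) has_field_derivative exp (g z) * deriv g z) (at z)" by (intro derivative_intros)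
    hence "(G has_field_derivative exp (g z) * deriv g z) (at z)"
      by (rule has_field_derivative_transform_within_open[OF _ open_ball zb]) (use g in auto)
    hence "deriv G z = G z * deriv g z" using g(2)[OF zb] by (simp add: DERIV_imp_deriv)
    moreover have "(f has_field_derivative deriv g z) (at z)" unfolding f_def
      using \<open>(g has_field_derivative deriv g z) (at z)\<close> by (auto intro!: derivative_eq_intros)
    ultimately show ?thesis using nz[OF zb] by (simp add: DERIV_imp_deriv)
  qed
  finally show ?thesis by (simp add: M_def)
qed

section \<open>The logarithmic derivative under GRH\<close>

lemma norm_of_nat_powr:
  assumes "0 < n"
  shows "cmod (of_nat n powr s) = real n powr Re s"
  using assms norm_powr_real_powr[of "of_nat n" s] by simp

text \<open>The series start at n = 0. Since \<open>0 powr s = 0\<close> and division by 0 yields 0,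
  that term vanishes whatever its coefficient is; the other terms decrease in modulus as Re s
  grows.\<close>

lemma dirichlet_series_bound:
  fixes a :: "nat \<Rightarrow> complex"
  assumes "summable (\<lambda>n. norm (a n / of_nat n powr of_real \<sigma>))" "\<sigma> \<le> Re s"
  shows "summable (\<lambda>n. norm (a n / of_nat n powr s))"
    and "cmod (\<Sum>n. a n / of_nat n powr s) \<le> (\<Sum>n. norm (a n / of_nat n powr of_real \<sigma>))"
proof -
  have le: "norm (a n / of_nat n powr s) \<le> norm (a n / of_nat n powr of_real \<sigma>)" for n
  proof (cases "n = 0")
    case False
    hence "cmod (of_nat n powr of_real \<sigma>) \<le> cmod (of_nat n powr s)" "0 < cmod (of_nat n powr of_real \<sigma>)"
      using assms(2) by (simp_all add: norm_of_nat_powr powr_mono del: of_real_of_nat_eq)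
    thus ?thesis unfolding norm_divide by (intro divide_left_mono) auto
  qed simp
  show s: "summable (\<lambda>n. norm (a n / of_nat n powr s))"
    by (rule summable_comparison_test'[OF assms(1), of 0]) (use le in auto)
  show "cmod (\<Sum>n. a n / of_nat n powr s) \<le> (\<Sum>n. norm (a n / of_nat n powr of_real \<sigma>))"
    by (rule order_trans[OF summable_norm[OF s] suminf_le[OF le s assms(1)]])
qed

text \<open>Far to the right the first nonvanishing coefficient dominates: it comes with
  \<open>N powr (- \<sigma>)\<close>, the tail only with \<open>(N + 1) powr (- \<sigma>)\<close>.
  The result bounds F from below, uniformly in t, at the centres of the discs in
  \<open>selberg_GRH_log_deriv\<close>, which must not lie to the left of Re s = 4.\<close>

lemma dirichlet_series_lower_bound:
  fixes a :: "nat \<Rightarrow> complex"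
  assumes sm: "summable (\<lambda>n. norm (a n / of_nat n powr 2))" and "\<exists>n\<ge>1. a n \<noteq> 0"
  obtains \<sigma>1 c where "4 \<le> \<sigma>1" "0 < c" "\<And>t. c \<le> cmod (\<Sum>n. a n / of_nat n powr Complex \<sigma>1 t)"
proof -
  define n0 where "n0 = (LEAST n. 1 \<le> n \<and> a n \<noteq> 0)"
  have n0: "1 \<le> n0" "a n0 \<noteq> 0" using LeastI_ex[of "\<lambda>n. 1 \<le> n \<and> a n \<noteq> 0"] assms(2) by (auto simp: n0_def)
  have below: "n = 0 \<or> a n = 0" if "n < n0" for n
    using not_less_Least[of n "\<lambda>n. 1 \<le> n \<and> a n \<noteq> 0"] that unfolding n0_def by auto
  define A where "A = (\<Sum>n. norm (a n / of_nat n powr 2))"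
  define N where "N = real n0"
  have N: "1 \<le> N" using n0 by (simp add: N_def)
  have A0: "0 \<le> A" unfolding A_def by (intro suminf_nonneg sm) auto
  have "((\<lambda>\<sigma>. A * (N + 1) powr (2 - \<sigma>) * N powr \<sigma>) \<longlongrightarrow> 0) at_top"
    using N by real_asymp
  from order_tendstoD(2)[OF this, of "cmod (a n0) / 2"]
  have "\<forall>\<^sub>F \<sigma> in at_top. A * (N + 1) powr (2 - \<sigma>) * N powr \<sigma> < cmod (a n0) / 2 \<and> 4 \<le> \<sigma>"
    using n0 by (intro eventually_conj eventually_ge_at_top) auto
  then obtain \<sigma> where \<sigma>: "A * (N + 1) powr (2 - \<sigma>) * N powr \<sigma> < cmod (a n0) / 2" "4 \<le> \<sigma>"
    by (auto dest: eventually_happens)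
  have N\<sigma>: "0 < N powr \<sigma>" using N by simp
  have "cmod (a n0) / 2 / N powr \<sigma> \<le> cmod (\<Sum>n. a n / of_nat n powr Complex \<sigma> t)" for t
  proof -
    define f where "f n = a n / of_nat n powr Complex \<sigma> t" for n
    have sf: "summable (\<lambda>n. norm (f n))" unfolding f_def
      by (rule dirichlet_series_bound(1)[where \<sigma> = 2]) (use sm \<sigma> in auto)
    have sf': "summable f" using sf by (rule summable_norm_cancel)
    \<comment> \<open>Writing n^-\<sigma> as n^-2 n^(2-\<sigma>) splits off a convergent series and
      leaves a factor that is largest at n = N + 1.\<close>
    have tail: "norm (f (n + Suc n0)) \<le> norm (a (n + Suc n0) / of_nat (n + Suc n0) powr 2) * (N + 1) powr (2 - \<sigma>)" for n
    proof -
      define k where "k = real (n + Suc n0)"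
      have k: "N + 1 \<le> k" "0 < k" by (auto simp: k_def N_def)
      have "norm (f (n + Suc n0)) = cmod (a (n + Suc n0)) / k powr \<sigma>"
        unfolding f_def norm_divide k_def by (subst norm_of_nat_powr) (use n0 in auto)
      also have "\<dots> = cmod (a (n + Suc n0)) / k powr 2 * k powr (2 - \<sigma>)"
        using k by (simp add: powr_diff)
      also have "\<dots> \<le> cmod (a (n + Suc n0)) / k powr 2 * (N + 1) powr (2 - \<sigma>)"
        using k N \<sigma> by (intro mult_left_mono powr_mono2') auto
      also have "cmod (a (n + Suc n0)) / k powr 2 = norm (a (n + Suc n0) / of_nat (n + Suc n0) powr 2)"
        unfolding norm_divide k_def by (subst norm_of_nat_powr) (use n0 in auto)
      finally show ?thesis .
    qed
    have smN: "summable (\<lambda>n. norm (a (n + Suc n0) / of_nat (n + Suc n0) powr 2))"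
      using sm by (subst summable_iff_shift[of "\<lambda>n. norm (a n / of_nat n powr 2)" "Suc n0"])
    have "cmod (\<Sum>n. f (n + Suc n0)) \<le> (\<Sum>n. norm (f (n + Suc n0)))"
      using sf by (intro summable_norm) (subst summable_iff_shift[of "\<lambda>n. norm (f n)" "Suc n0"])
    also have "\<dots> \<le> (\<Sum>n. norm (a (n + Suc n0) / of_nat (n + Suc n0) powr 2) * (N + 1) powr (2 - \<sigma>))"
    proof (rule suminf_le[OF tail])
      show "summable (\<lambda>n. norm (f (n + Suc n0)))" using sf by (subst summable_iff_shift[of "\<lambda>n. norm (f n)" "Suc n0"])
      show "summable (\<lambda>n. norm (a (n + Suc n0) / of_nat (n + Suc n0) powr 2) * (N + 1) powr (2 - \<sigma>))"
        by (rule summable_mult2[OF smN])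
    qed
    also have "\<dots> = (\<Sum>n. norm (a (n + Suc n0) / of_nat (n + Suc n0) powr 2)) * (N + 1) powr (2 - \<sigma>)"
      by (rule suminf_mult2[OF smN, symmetric])
    also have "\<dots> \<le> A * (N + 1) powr (2 - \<sigma>)"
    proof (rule mult_right_mono)
      have "A = (\<Sum>n. norm (a (n + Suc n0) / of_nat (n + Suc n0) powr 2)) + (\<Sum>n<Suc n0. norm (a n / of_nat n powr 2))"
        unfolding A_def by (rule suminf_split_initial_segment[OF sm])
      moreover have "0 \<le> (\<Sum>n<Suc n0. norm (a n / of_nat n powr 2))" by (intro sum_nonneg) auto
      ultimately show "(\<Sum>n. norm (a (n + Suc n0) / of_nat (n + Suc n0) powr 2)) \<le> A" by linarith
    qed auto
    also have "\<dots> \<le> cmod (a n0) / 2 / N powr \<sigma>" using \<sigma>(1) N\<sigma> by (simp add: pos_le_divide_eq)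
    finally have tl: "cmod (\<Sum>n. f (n + Suc n0)) \<le> cmod (a n0) / 2 / N powr \<sigma>" .
    have "(\<Sum>n<Suc n0. f n) = f n0"
    proof -
      have "(\<Sum>n<n0. f n) = 0" by (intro sum.neutral ballI) (use below in \<open>force simp: f_def\<close>)
      thus ?thesis by simp
    qed
    hence sumeq: "(\<Sum>n. f n) = (\<Sum>n. f (n + Suc n0)) + f n0"
      using suminf_split_initial_segment[OF sf', of "Suc n0"] by simp
    have "cmod (f n0) = cmod (a n0) / N powr \<sigma>"
      unfolding f_def norm_divide N_def by (subst norm_of_nat_powr) (use n0 in auto)
    moreover have "cmod (f n0) \<le> cmod ((\<Sum>n. f (n + Suc n0)) + f n0) + cmod (\<Sum>n. f (n + Suc n0))"
      using norm_triangle_ineq4[of "(\<Sum>n. f (n + Suc n0)) + f n0" "\<Sum>n. f (n + Suc n0)"] by simp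
    moreover have "cmod (a n0) / N powr \<sigma> = cmod (a n0) / 2 / N powr \<sigma> + cmod (a n0) / 2 / N powr \<sigma>" by simp
    ultimately have "cmod (a n0) / 2 / N powr \<sigma> \<le> cmod ((\<Sum>n. f (n + Suc n0)) + f n0)" using tl by linarith
    thus ?thesis using sumeq unfolding f_def[symmetric] by (simp only:)
  qed
  moreover have "0 < cmod (a n0) / 2 / N powr \<sigma>" using n0 N\<sigma> by simp
  ultimately show ?thesis using that \<sigma>(2) by blast
qed

text \<open>For Re s = -1 one has cnj (1 - s) = s + 3, so the two arguments of each Gamma factor
  differ by the real number 3 \<lambda>, and \<open>Gamma_shift_polynomial_bound\<close> applies to
  one factor at a time. The height T keeps all arguments off the real axis and thus away from the
  poles.\<close>

lemma Gamma_product_ratio_bound: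
  fixes lam :: "real list" and mu :: "complex list"
  assumes "\<And>j. j < k \<Longrightarrow> 0 < lam!j \<and> 0 \<le> Re (mu!j)"
  shows "\<exists>C N T. 0 \<le> C \<and> (\<forall>s. Re s = -1 \<and> T \<le> \<bar>Im s\<bar> \<longrightarrow>
      (\<forall>j<k. of_real (lam!j) * s + mu!j \<notin> \<int>\<^sub>\<le>\<^sub>0 \<and> of_real (lam!j) * cnj (1 - s) + mu!j \<notin> \<int>\<^sub>\<le>\<^sub>0) \<and>
      (\<Prod>j<k. cmod (Gamma (of_real (lam!j) * cnj (1 - s) + mu!j))) \<le> C * (1 + cmod s) ^ N * (\<Prod>j<k. cmod (Gamma (of_real (lam!j) * s + mu!j))))"
  using assms
proof (induction k)
  case 0
  show ?case by (intro exI[of _ 1] exI[of _ 0]) auto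
next
  case (Suc k)
  have "\<exists>C N T. 0 \<le> C \<and> (\<forall>s. Re s = -1 \<and> T \<le> \<bar>Im s\<bar> \<longrightarrow>
      (\<forall>j<k. of_real (lam!j) * s + mu!j \<notin> \<int>\<^sub>\<le>\<^sub>0 \<and> of_real (lam!j) * cnj (1 - s) + mu!j \<notin> \<int>\<^sub>\<le>\<^sub>0) \<and>
      (\<Prod>j<k. cmod (Gamma (of_real (lam!j) * cnj (1 - s) + mu!j))) \<le> C * (1 + cmod s) ^ N * (\<Prod>j<k. cmod (Gamma (of_real (lam!j) * s + mu!j))))"
    by (rule Suc.IH) (rule Suc.prems, simp)
  then obtain C N T where IH: "0 \<le> C" "\<And>s. Re s = -1 \<Longrightarrow> T \<le> \<bar>Im s\<bar> \<Longrightarrow>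
      (\<forall>j<k. of_real (lam!j) * s + mu!j \<notin> \<int>\<^sub>\<le>\<^sub>0 \<and> of_real (lam!j) * cnj (1 - s) + mu!j \<notin> \<int>\<^sub>\<le>\<^sub>0) \<and>
      (\<Prod>j<k. cmod (Gamma (of_real (lam!j) * cnj (1 - s) + mu!j))) \<le> C * (1 + cmod s) ^ N * (\<Prod>j<k. cmod (Gamma (of_real (lam!j) * s + mu!j)))"
    by blast
  define l where "l = lam!k"
  define u where "u = mu!k"
  have l: "0 < l" "0 \<le> Re u" using Suc.prems[of k] by (auto simp: l_def u_def)
  obtain C' N' where G: "0 \<le> C'" "\<And>z. Re z = - l + Re u \<Longrightarrow> z \<notin> \<int>\<^sub>\<le>\<^sub>0 \<Longrightarrow>
      cmod (Gamma (z + of_real (3 * l))) \<le> C' * (1 + cmod z) ^ N' * cmod (Gamma z)"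
    by (rule Gamma_shift_polynomial_bound[of "3 * l" "- l + Re u"]) (use l in auto)
  define K where "K = (1 + l + cmod u) ^ N'"
  define T' where "T' = max T ((\<bar>Im u\<bar> + 1) / l)"
  have step: "of_real l * s + u \<notin> \<int>\<^sub>\<le>\<^sub>0 \<and> of_real l * cnj (1 - s) + u \<notin> \<int>\<^sub>\<le>\<^sub>0 \<and>
      cmod (Gamma (of_real l * cnj (1 - s) + u)) \<le> C' * K * (1 + cmod s) ^ N' * cmod (Gamma (of_real l * s + u))"
    if s: "Re s = -1" "T' \<le> \<bar>Im s\<bar>" for s
  proof -
    have "(\<bar>Im u\<bar> + 1) / l \<le> \<bar>Im s\<bar>" using s by (simp add: T'_def)
    hence "\<bar>Im u\<bar> + 1 \<le> l * \<bar>Im s\<bar>" using l by (simp add: field_simps)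
    hence "\<bar>Im u\<bar> < \<bar>l * Im s\<bar>" using l by (simp add: abs_mult)
    hence im: "l * Im s + Im u \<noteq> 0" by linarith
    have nz: "z \<notin> \<int>\<^sub>\<le>\<^sub>0" if "Im z = l * Im s + Im u" for z
      using that im by (auto elim!: nonpos_Ints_cases)
    have 1: "of_real l * s + u \<notin> \<int>\<^sub>\<le>\<^sub>0" "of_real l * cnj (1 - s) + u \<notin> \<int>\<^sub>\<le>\<^sub>0"
      by (rule nz; simp)+
    have eq: "of_real l * cnj (1 - s) + u = (of_real l * s + u) + of_real (3 * l)"
      using s by (simp add: complex_eq_iff)
    have "cmod (Gamma (of_real l * cnj (1 - s) + u)) \<le> C' * (1 + cmod (of_real l * s + u)) ^ N' * cmod (Gamma (of_real l * s + u))"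
      unfolding eq by (rule G(2)[OF _ 1(1)]) (use s in simp)
    also have "\<dots> \<le> C' * (K * (1 + cmod s) ^ N') * cmod (Gamma (of_real l * s + u))"
    proof -
      have "cmod (of_real l * s + u) \<le> l * cmod s + cmod u"
        using norm_triangle_ineq[of "of_real l * s" u] l by (simp add: norm_mult)
      hence "1 + cmod (of_real l * s + u) \<le> (1 + l + cmod u) * (1 + cmod s)"
      proof -
        have "(1 + l + cmod u) * (1 + cmod s) = 1 + l + cmod u + cmod s + l * cmod s + cmod u * cmod s" by (simp add: algebra_simps)
        moreover have "0 \<le> cmod u * cmod s" by simp
        ultimately show ?thesis using \<open>cmod (of_real l * s + u) \<le> l * cmod s + cmod u\<close> l norm_ge_zero[of s] by linarith
      qed
      hence "(1 + cmod (of_real l * s + u)) ^ N' \<le> K * (1 + cmod s) ^ N'"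
        unfolding K_def power_mult_distrib[symmetric] by (intro power_mono) auto
      thus ?thesis using G(1) by (intro mult_right_mono mult_left_mono) auto
    qed
    finally show ?thesis using 1 by (simp add: mult.assoc)
  qed
  have K0: "0 \<le> K" unfolding K_def using l by simp
  have main: "(\<forall>j<Suc k. of_real (lam!j) * s + mu!j \<notin> \<int>\<^sub>\<le>\<^sub>0 \<and> of_real (lam!j) * cnj (1 - s) + mu!j \<notin> \<int>\<^sub>\<le>\<^sub>0) \<and>
      (\<Prod>j<Suc k. cmod (Gamma (of_real (lam!j) * cnj (1 - s) + mu!j)))
        \<le> C * (C' * K) * (1 + cmod s) ^ (N + N') * (\<Prod>j<Suc k. cmod (Gamma (of_real (lam!j) * s + mu!j)))"
    if s: "Re s = -1" "T' \<le> \<bar>Im s\<bar>" for s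
  proof -
    have T: "T \<le> \<bar>Im s\<bar>" using s by (simp add: T'_def)
    note I = IH(2)[OF s(1) T] and S = step[OF s, unfolded l_def u_def]
    have "(\<Prod>j<Suc k. cmod (Gamma (of_real (lam!j) * cnj (1 - s) + mu!j)))
        = (\<Prod>j<k. cmod (Gamma (of_real (lam!j) * cnj (1 - s) + mu!j))) * cmod (Gamma (of_real (lam!k) * cnj (1 - s) + mu!k))" by simp
    also have "\<dots> \<le> (C * (1 + cmod s) ^ N * (\<Prod>j<k. cmod (Gamma (of_real (lam!j) * s + mu!j)))) * (C' * K * (1 + cmod s) ^ N' * cmod (Gamma (of_real (lam!k) * s + mu!k)))"
      using I S IH(1) by (intro mult_mono mult_nonneg_nonneg prod_nonneg) auto
    also have "\<dots> = C * (C' * K) * (1 + cmod s) ^ (N + N') * (\<Prod>j<Suc k. cmod (Gamma (of_real (lam!j) * s + mu!j)))"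
      by (simp add: power_add mult_ac)
    finally have le: "(\<Prod>j<Suc k. cmod (Gamma (of_real (lam!j) * cnj (1 - s) + mu!j)))
        \<le> C * (C' * K) * (1 + cmod s) ^ (N + N') * (\<Prod>j<Suc k. cmod (Gamma (of_real (lam!j) * s + mu!j)))" .
    have nz: "of_real (lam!j) * s + mu!j \<notin> \<int>\<^sub>\<le>\<^sub>0 \<and> of_real (lam!j) * cnj (1 - s) + mu!j \<notin> \<int>\<^sub>\<le>\<^sub>0" if "j < Suc k" for j
      using I S that by (cases "j = k") auto
    thus ?thesis using le by blast
  qed
  have "0 \<le> C * (C' * K)" using IH G K0 by simp
  thus ?case
    by (intro exI[of _ "C * (C' * K)"] exI[of _ "N + N'"] exI[of _ T'] conjI[of "0 \<le> _"] allI impI, assumption)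
      (elim conjE, rule main)
qed

text \<open>The edges of the strip are Re s = 2, where the Dirichlet series converges absolutely,
  and Re s = -1, which the functional equation reflects onto it.\<close>

lemma selberg_polynomial_growth:
  assumes data: "selberg_data F a m Q lam mu eps"
  obtains G M N where "G holomorphic_on UNIV" "\<And>s. s \<noteq> 1 \<Longrightarrow> G s = (s - 1) ^ m * F s"
    "m = 0 \<longrightarrow> G 1 = F 1" "0 < m \<longrightarrow> G 1 \<noteq> 0"
    "0 \<le> M" "\<And>s. -1 \<le> Re s \<Longrightarrow> cmod (G s) \<le> M * (1 + cmod s) ^ N"
proof -
  note d = data[unfolded selberg_data_def]
  obtain G A C where G: "G holomorphic_on UNIV" "\<And>s. s \<noteq> 1 \<Longrightarrow> G s = (s - 1) ^ m * F s"
    "m = 0 \<longrightarrow> G 1 = F 1" "0 < m \<longrightarrow> G 1 \<noteq> 0" "\<And>s. norm (G s) \<le> C * exp (norm s powr A)"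
    using d by blast
  have Q: "0 < Q" and len: "length mu = length lam" and lm: "\<And>j. j < length lam \<Longrightarrow> 0 < lam!j \<and> 0 \<le> Re (mu!j)" and eps: "norm eps = 1"
    using d by blast+
  have FE: "Phi Q lam mu F s = eps * cnj (Phi Q lam mu F (cnj (1 - s)))"
    if "s \<noteq> 0" "s \<noteq> 1" "\<forall>j<length lam. of_real (lam!j) * s + mu!j \<notin> \<int>\<^sub>\<le>\<^sub>0 \<and> of_real (lam!j) * cnj (1 - s) + mu!j \<notin> \<int>\<^sub>\<le>\<^sub>0" for s
    using d that by blast
  have Fs: "\<And>s. 1 < Re s \<Longrightarrow> summable (\<lambda>n. norm (a n / of_nat n powr s))" "\<And>s. 1 < Re s \<Longrightarrow> F s = (\<Sum>n. a n / of_nat n powr s)"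
    using d by blast+
  define A2 where "A2 = (\<Sum>n. norm (a n / of_nat n powr of_real 2))"
  have sm2: "summable (\<lambda>n. norm (a n / of_nat n powr of_real 2))" using Fs(1)[of "of_real 2"] by simp
  have A2: "0 \<le> A2" unfolding A2_def by (intro suminf_nonneg sm2) auto
  have F2: "cmod (F s) \<le> A2" if "2 \<le> Re s" for s
    using Fs(2)[of s] dirichlet_series_bound(2)[OF sm2 that] that by (simp add: A2_def)
  have s1: "cmod (s - 1) ^ m \<le> (1 + cmod s) ^ m" for s
    using norm_triangle_ineq4[of s 1] by (intro power_mono) auto
  have s1': "s \<noteq> 1" if "2 \<le> Re s" for s :: complex using that by auto
  have G2: "cmod (G s) \<le> A2 * (1 + cmod s) ^ m" if "2 \<le> Re s" for s
  proof -
    have "cmod (G s) = cmod (s - 1) ^ m * cmod (F s)" using G(2)[OF s1'[OF that]] by (simp add: norm_mult norm_power)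
    also have "\<dots> \<le> (1 + cmod s) ^ m * A2" using s1 F2[OF that] by (intro mult_mono) auto
    finally show ?thesis by (simp add: mult.commute)
  qed
  obtain C1 N1 T where R: "0 \<le> C1" "\<And>s. Re s = -1 \<Longrightarrow> T \<le> \<bar>Im s\<bar> \<Longrightarrow>
      (\<forall>j<length lam. of_real (lam!j) * s + mu!j \<notin> \<int>\<^sub>\<le>\<^sub>0 \<and> of_real (lam!j) * cnj (1 - s) + mu!j \<notin> \<int>\<^sub>\<le>\<^sub>0) \<and>
      (\<Prod>j<length lam. cmod (Gamma (of_real (lam!j) * cnj (1 - s) + mu!j))) \<le> C1 * (1 + cmod s) ^ N1 * (\<Prod>j<length lam. cmod (Gamma (of_real (lam!j) * s + mu!j)))"
    using Gamma_product_ratio_bound[of "length lam" lam mu, OF lm] by blast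
  define C2 where "C2 = Q powr 3 * C1 * A2"
  have FL: "cmod (F s) \<le> C2 * (1 + cmod s) ^ N1" if s: "Re s = -1" "T \<le> \<bar>Im s\<bar>" for s
  proof -
    define p where "p = (\<Prod>j<length lam. cmod (Gamma (of_real (lam!j) * s + mu!j)))"
    define q where "q = (\<Prod>j<length lam. cmod (Gamma (of_real (lam!j) * cnj (1 - s) + mu!j)))"
    note Rs = R(2)[OF s]
    have p: "0 < p" unfolding p_def using Rs by (intro prod_pos) (auto simp: Gamma_eq_zero_iff)
    have q: "q \<le> C1 * (1 + cmod s) ^ N1 * p" using Rs by (simp add: p_def q_def)
    have "cmod (Phi Q lam mu F s) = cmod (Phi Q lam mu F (cnj (1 - s)))"
      using FE[of s] s Rs eps by (subst FE) (auto simp: norm_mult)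
    \<comment> \<open>The modulus of Q^s is Q^-1 on Re s = -1 and Q^2 on the reflected line, whence
      the factor Q^3 in \<open>C2\<close>. The product p of Gamma factors is positive and cancels in
      the end.\<close>
    hence "Q powr (-1) * p * cmod (F s) = Q powr 2 * q * cmod (F (cnj (1 - s)))"
      using s Q unfolding Phi_def p_def q_def norm_mult prod_norm[symmetric] by (simp add: norm_powr_real_powr)
    also have "\<dots> \<le> Q powr 2 * (C1 * (1 + cmod s) ^ N1 * p) * A2"
      using q F2[of "cnj (1 - s)"] s R(1) p by (intro mult_mono mult_left_mono mult_nonneg_nonneg) (auto simp: q_def prod_nonneg)
    also have "\<dots> = Q powr (-1) * p * (C2 * (1 + cmod s) ^ N1)"
    proof -
      have "(2::real) = -1 + 3" by simp
      hence "Q powr 2 = Q powr (-1) * Q powr 3" by (metis powr_add)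
      thus ?thesis by (simp add: C2_def mult_ac)
    qed
    finally have "Q powr (-1) * p * cmod (F s) \<le> Q powr (-1) * p * (C2 * (1 + cmod s) ^ N1)" .
    moreover have "0 < Q powr (-1) * p" using p Q by simp
    ultimately show ?thesis using mult_le_cancel_left_pos by blast
  qed
  have C2: "0 \<le> C2" using R A2 by (simp add: C2_def)
  \<comment> \<open>Below height T the Gamma factors may have poles, so there the bound on the edge
    comes from compactness of a segment.\<close>
  have "compact (cbox (Complex (-1) (-\<bar>T\<bar>)) (Complex (-1) \<bar>T\<bar>))" by simp
  hence "bounded (G ` cbox (Complex (-1) (-\<bar>T\<bar>)) (Complex (-1) \<bar>T\<bar>))"
    by (intro compact_imp_bounded compact_continuous_image continuous_on_subset[OF holomorphic_on_imp_continuous_on[OF G(1)]]) auto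
  then obtain C3 where C3: "0 < C3" "\<And>s. s \<in> cbox (Complex (-1) (-\<bar>T\<bar>)) (Complex (-1) \<bar>T\<bar>) \<Longrightarrow> cmod (G s) \<le> C3"
    by (auto simp: bounded_pos)
  define M1 where "M1 = max (max C2 C3) A2"
  define N where "N = N1 + m"
  have M1: "0 \<le> M1" using A2 by (simp add: M1_def)
  have pw: "(1 + cmod s) ^ i \<le> (1 + cmod s) ^ N" if "i \<le> N" for s i using that by (intro power_increasing) auto
  have edge: "cmod (G s) \<le> M1 * (1 + cmod s) ^ N" if "Re s = -1 \<or> Re s = 2" for s
    using that
  proof
    assume s: "Re s = 2"
    have "A2 * (1 + cmod s) ^ m \<le> M1 * (1 + cmod s) ^ N" using pw[of m s] M1 by (intro mult_mono) (auto simp: M1_def N_def)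
    thus ?thesis using G2[of s] s by auto
  next
    assume s: "Re s = -1"
    show ?thesis
    proof (cases "T \<le> \<bar>Im s\<bar>")
      case True
      have "cmod (G s) = cmod (s - 1) ^ m * cmod (F s)" using G(2)[of s] s by (cases "s = 1") (simp_all add: norm_mult norm_power)
      also have "\<dots> \<le> (1 + cmod s) ^ m * (C2 * (1 + cmod s) ^ N1)" using s1 FL[OF s True] by (intro mult_mono) auto
      also have "\<dots> = C2 * (1 + cmod s) ^ N" by (simp add: N_def power_add mult_ac)
      also have "\<dots> \<le> M1 * (1 + cmod s) ^ N" by (intro mult_right_mono) (auto simp: M1_def)
      finally show ?thesis .
    next
      case False
      hence "s \<in> cbox (Complex (-1) (-\<bar>T\<bar>)) (Complex (-1) \<bar>T\<bar>)" using s by (auto simp: in_cbox_complex_iff)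
      hence "cmod (G s) \<le> C3 * 1" using C3(2) by simp
      also have "\<dots> \<le> M1 * (1 + cmod s) ^ N" using pw[of 0 s] M1 by (intro mult_mono) (auto simp: M1_def)
      finally show ?thesis .
    qed
  qed
  obtain M' where M': "0 \<le> M'" "\<And>s. -1 \<le> Re s \<Longrightarrow> Re s \<le> 2 \<Longrightarrow> cmod (G s) \<le> M' * (1 + cmod s) ^ N"
    using phragmen_lindelof_strip[OF G(1) _ G(5) edge] by (metis less_le_trans neg_less_0_iff_less zero_le_numeral zero_less_one)
  have "cmod (G s) \<le> max M' A2 * (1 + cmod s) ^ N" if "-1 \<le> Re s" for s
  proof (cases "Re s \<le> 2")
    case True
    have "M' * (1 + cmod s) ^ N \<le> max M' A2 * (1 + cmod s) ^ N" by (intro mult_right_mono) auto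
    thus ?thesis using M'(2)[OF that True] by linarith
  next
    case False
    have "A2 * (1 + cmod s) ^ m \<le> max M' A2 * (1 + cmod s) ^ N" using pw[of m s] A2 by (intro mult_mono) (auto simp: N_def)
    thus ?thesis using G2[of s] False by auto
  qed
  moreover have "0 \<le> max M' A2" using A2 by simp
  ultimately show ?thesis using that[OF G(1-4)] by blast
qed

lemma selberg_GRH_log_deriv:
  assumes data: "selberg_data F a m Q lam mu eps" and grh: "GRH F m"
  obtains G where "G holomorphic_on UNIV" "\<And>s. s \<noteq> 1 \<Longrightarrow> G s = (s - 1) ^ m * F s" "\<And>s. 1/2 < Re s \<Longrightarrow> G s \<noteq> 0"
    "\<And>\<sigma>0 \<kappa>. 1/2 < \<sigma>0 \<Longrightarrow> \<sigma>0 < 4 \<Longrightarrow> 0 < \<kappa> \<Longrightarrow> \<exists>C\<ge>0. \<forall>s. \<sigma>0 \<le> Re s \<and> Re s \<le> 4 \<longrightarrow> cmod (deriv G s / G s) \<le> C * (1 + \<bar>Im s\<bar>) powr \<kappa>"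
proof -
  obtain G M N where G: "G holomorphic_on UNIV" "\<And>s. s \<noteq> 1 \<Longrightarrow> G s = (s - 1) ^ m * F s"
    "m = 0 \<longrightarrow> G 1 = F 1" "0 < m \<longrightarrow> G 1 \<noteq> 0" and
    M: "0 \<le> M" "\<And>s. -1 \<le> Re s \<Longrightarrow> cmod (G s) \<le> M * (1 + cmod s) ^ N"
    using selberg_polynomial_growth[OF data] by metis
  have F0: "F s \<noteq> 0" if "1/2 < Re s" "s = 1 \<longrightarrow> m = 0" for s
    using grh that unfolding GRH_def by force
  \<comment> \<open>The point s = 1 is special: for m > 0 the value G 1 is nonzero by the Selberg
    data, for m = 0 by GRH.\<close>
  have G0: "G s \<noteq> 0" if "1/2 < Re s" for s
    using F0[of s] F0[of 1] G that by (cases "s = 1"; cases "m = 0") auto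
  have Fs: "summable (\<lambda>n. norm (a n / of_nat n powr 2))" "\<And>s. 1 < Re s \<Longrightarrow> F s = (\<Sum>n. a n / of_nat n powr s)"
    using data unfolding selberg_data_def by (auto dest: spec[of _ 2])
  \<comment> \<open>If all coefficients vanished, F would have a zero at s = 2, off the critical
    line.\<close>
  have "\<exists>n\<ge>1. a n \<noteq> 0"
  proof (rule ccontr)
    assume "\<not> ?thesis"
    hence "(\<lambda>n. a n / of_nat n powr 2) = (\<lambda>_. 0)" by (intro ext) (metis One_nat_def Suc_leI div_0 divide_eq_0_iff neq0_conv of_nat_0 powr_0)
    hence "F 2 = 0" using Fs(2)[of 2] by (simp only:) simp
    thus False using F0[of 2] by simp
  qed
  then obtain \<sigma>1 c where \<sigma>1: "4 \<le> \<sigma>1" "0 < c" "\<And>t. c \<le> cmod (\<Sum>n. a n / of_nat n powr Complex \<sigma>1 t)"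
    using dirichlet_series_lower_bound[OF Fs(1)] by metis
  have "\<exists>C\<ge>0. \<forall>s. \<sigma>0 \<le> Re s \<and> Re s \<le> 4 \<longrightarrow> cmod (deriv G s / G s) \<le> C * (1 + \<bar>Im s\<bar>) powr \<kappa>"
    if \<sigma>0: "1/2 < \<sigma>0" "\<sigma>0 < 4" and \<kappa>: "0 < \<kappa>" for \<sigma>0 \<kappa>
  proof -
    \<comment> \<open>The disc around \<open>z0\<close> of radius R stays to the right of 1/2 + d,
      and the one of radius r reaches the line Re s = \<sigma>0. The gap R - r equals d, whatever
      the height.\<close>
    define d where "d = (\<sigma>0 - 1/2) / 2"
    define R where "R = \<sigma>1 - 1/2 - d"
    define r where "r = \<sigma>1 - \<sigma>0"
    have R: "0 < r" "r < R" "R - r = d" "0 < d" "0 < R" "R \<le> \<sigma>1" using \<sigma>0 \<sigma>1 by (auto simp: R_def r_def d_def field_simps)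
    define M' where "M' = (M + 1) * (1 + 2 * \<sigma>1) ^ N"
    have M': "0 < M'" using M \<sigma>1 by (simp add: M'_def)
    define C where "C = 8 * R / d\<^sup>2 * (\<bar>ln (M' / c)\<bar> + real N / \<kappa> + 1)"
    have "0 \<le> C" unfolding C_def using R \<kappa> by simp
    moreover have "cmod (deriv G s / G s) \<le> C * (1 + \<bar>Im s\<bar>) powr \<kappa>" if s: "\<sigma>0 \<le> Re s" "Re s \<le> 4" for s
    proof -
      define t where "t = \<bar>Im s\<bar>"
      define z0 where "z0 = Complex \<sigma>1 (Im s)"
      have t: "0 \<le> t" by (simp add: t_def)
      have ball: "1/2 < Re z" "cmod (G z) \<le> M' * (1 + t) ^ N" if z: "z \<in> ball z0 R" for z
      proof -
        have "\<bar>Re (z0 - z)\<bar> < R" using z abs_Re_le_cmod[of "z0 - z"] by (simp add: dist_norm)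
        thus "1/2 < Re z" using R by (simp add: z0_def R_def)
        have "cmod z \<le> cmod z0 + R" using z norm_triangle_ineq4[of z0 "z0 - z"] by (simp add: dist_norm)
        also have "cmod z0 \<le> \<sigma>1 + t" using cmod_le[of z0] \<sigma>1 by (simp add: z0_def t_def)
        finally have "1 + cmod z \<le> 1 + 2 * \<sigma>1 + t" using R by simp
        also have "\<dots> \<le> (1 + 2 * \<sigma>1) * (1 + t)" using \<sigma>1 t by (simp add: algebra_simps)
        finally have "(1 + cmod z) ^ N \<le> ((1 + 2 * \<sigma>1) * (1 + t)) ^ N" by (intro power_mono) auto
        hence "M * (1 + cmod z) ^ N \<le> (M + 1) * ((1 + 2 * \<sigma>1) * (1 + t)) ^ N" using M(1) by (intro mult_mono) auto
        thus "cmod (G z) \<le> M' * (1 + t) ^ N" using M(2)[of z] \<open>1/2 < Re z\<close> unfolding M'_def power_mult_distrib mult.assoc by linarith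
      qed
      have z01: "z0 \<noteq> 1" using \<sigma>1 by (auto simp: z0_def complex_eq_iff)
      have "1 ^ m * c \<le> cmod (z0 - 1) ^ m * cmod (F z0)"
      proof (intro mult_mono power_mono)
        have "1 \<le> Re (z0 - 1)" using \<sigma>1 by (simp add: z0_def)
        thus "1 \<le> cmod (z0 - 1)" using complex_Re_le_cmod order_trans by blast
        show "c \<le> cmod (F z0)" using \<sigma>1 Fs(2)[of z0] by (simp add: z0_def)
      qed (use \<sigma>1 in auto)
      hence b: "c \<le> cmod (G z0)" using G(2)[OF z01] by (simp add: norm_mult norm_power)
      have zs: "cmod (s - z0) \<le> r"
      proof -
        have "s - z0 = of_real (Re s - \<sigma>1)" by (simp add: z0_def complex_eq_iff)
        hence "cmod (s - z0) = \<bar>Re s - \<sigma>1\<bar>" by (simp only: norm_of_real)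
        thus ?thesis using s \<sigma>1 by (simp add: r_def)
      qed
      have "cmod (deriv G s / G s) \<le> 8 * R / (R - r)\<^sup>2 * (ln (M' * (1 + t) ^ N / c) + 1)"
        by (rule log_deriv_bound_of_growth[OF holomorphic_on_subset[OF G(1)] G0 _ _ _ _ _ zs, where b = c])
          (use ball b R \<sigma>1 in auto)
      also have "\<dots> \<le> 8 * R / (R - r)\<^sup>2 * ((\<bar>ln (M' / c)\<bar> + real N / \<kappa> + 1) * (1 + t) powr \<kappa>)"
      proof (rule mult_left_mono)
        have t1: "1 \<le> (1 + t) powr \<kappa>" using t \<kappa> by (simp add: ge_one_powr_ge_zero)
        \<comment> \<open>The logarithm of the polynomial growth bound is traded for a small power
          through ln y \<le> y^\<kappa> / \<kappa>.\<close>
        have "ln (1 + t) = ln ((1 + t) powr \<kappa>) / \<kappa>" using t \<kappa> by (simp add: ln_powr)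
        also have "\<dots> \<le> (1 + t) powr \<kappa> / \<kappa>" using \<kappa> t ln_le_minus_one[of "(1 + t) powr \<kappa>"] by (intro divide_right_mono) auto
        finally have l: "real N * ln (1 + t) \<le> real N * ((1 + t) powr \<kappa> / \<kappa>)" by (intro mult_left_mono) auto
        have "ln (M' * (1 + t) ^ N / c) = ln (M' / c) + real N * ln (1 + t)"
          using M' \<sigma>1 t by (simp add: ln_mult ln_div ln_realpow)
        also have "\<dots> \<le> \<bar>ln (M' / c)\<bar> * (1 + t) powr \<kappa> + real N * ((1 + t) powr \<kappa> / \<kappa>)"
          using l t1 mult_left_mono[OF t1, of "\<bar>ln (M' / c)\<bar>"] by (intro add_mono) auto
        finally show "ln (M' * (1 + t) ^ N / c) + 1 \<le> (\<bar>ln (M' / c)\<bar> + real N / \<kappa> + 1) * (1 + t) powr \<kappa>"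
          using t1 by (simp add: algebra_simps)
      qed (use R in auto)
      finally show ?thesis unfolding C_def R(3) t_def by (simp add: mult.assoc)
    qed
    ultimately show ?thesis by blast
  qed
  thus ?thesis using that G(1,2) G0 by blast
qed

section \<open>Explicit formula\<close>

lemma integrable_one_plus_abs_powr:
  assumes "1 < p"
  shows "integrable lborel (\<lambda>t::real. (1 + \<bar>t\<bar>) powr (-p))"
proof -
  have nn: "(\<integral>\<^sup>+t. ennreal ((1 + t) powr (-p)) * indicator {0..} t \<partial>lborel) = ennreal (0 - (- (1 / (p - 1))))"
  proof -
    define F where "F t = - ((1 + t) powr (1 - p) / (p - 1))" for t
    have "(F \<longlongrightarrow> 0) at_top" unfolding F_def using assms by real_asymp
    moreover have "(F has_real_derivative (1 + x) powr - p) (at x)" if "0 \<le> x" for x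
    proof -
      have "((\<lambda>t. (1 + t) powr (1 - p)) has_real_derivative (1 - p) * (1 + x) powr (1 - p - 1)) (at x)"
        using that by (auto intro!: derivative_eq_intros)
      from DERIV_minus[OF DERIV_cdivide[OF this, of "p - 1"]]
      have "(F has_real_derivative - ((1 - p) * (1 + x) powr (1 - p - 1) / (p - 1))) (at x)" unfolding F_def .
      also have "- ((1 - p) * (1 + x) powr (1 - p - 1) / (p - 1)) = (1 + x) powr - p" using assms by (simp add: field_simps)
      finally show ?thesis .
    qed
    ultimately have "(\<integral>\<^sup>+t. ennreal ((1 + t) powr (-p)) * indicator {0..} t \<partial>lborel) = ennreal (0 - F 0)"
      by (intro nn_integral_FTC_atLeast) auto
    thus ?thesis by (simp add: F_def)
  qed
  have "(\<integral>\<^sup>+t. ennreal (norm ((1 + \<bar>t\<bar>) powr (-p))) \<partial>lborel)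
     \<le> (\<integral>\<^sup>+t. ennreal ((1 + t) powr (-p)) * indicator {0..} t + ennreal ((1 + (0 + (-1) * t)) powr (-p)) * indicator {0..} (0 + (-1) * t) \<partial>lborel)"
    by (intro nn_integral_mono) (auto simp: indicator_def)
  also have "\<dots> = (\<integral>\<^sup>+t. ennreal ((1 + t) powr (-p)) * indicator {0..} t \<partial>lborel) + (\<integral>\<^sup>+t. ennreal ((1 + (0 + (-1) * t)) powr (-p)) * indicator {0..} (0 + (-1) * t) \<partial>lborel)"
    by (intro nn_integral_add) measurable
  also have "(\<integral>\<^sup>+t. ennreal ((1 + (0 + (-1) * t)) powr (-p)) * indicator {0..} (0 + (-1) * t) \<partial>lborel) = (\<integral>\<^sup>+t. ennreal ((1 + t) powr (-p)) * indicator {0..} t \<partial>lborel)"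
    using nn_integral_real_affine[of "\<lambda>t. ennreal ((1 + t) powr (-p)) * indicator {0..} t" "-1" 0] by simp
  also have "\<dots> + \<dots> < \<infinity>" unfolding nn by simp
  finally show ?thesis by (intro integrableI_bounded) auto
qed

lemma inverse_cmod_Complex_le:
  assumes "1/2 \<le> \<sigma>"
  shows "1 / cmod (Complex \<sigma> t) \<le> 3 / (1 + \<bar>t\<bar>)"
proof -
  have "\<bar>t\<bar> \<le> cmod (Complex \<sigma> t)" "\<sigma> \<le> cmod (Complex \<sigma> t)"
    using abs_Im_le_cmod[of "Complex \<sigma> t"] complex_Re_le_cmod[of "Complex \<sigma> t"] by auto
  hence "1 + \<bar>t\<bar> \<le> 3 * cmod (Complex \<sigma> t)" using assms by linarith
  moreover have "0 < cmod (Complex \<sigma> t)" using \<open>\<sigma> \<le> _\<close> assms by linarith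
  ultimately show ?thesis by (simp add: field_simps)
qed

lemma norm_exp_minus_1_le:
  fixes z :: complex
  assumes "Re z \<le> r" "0 \<le> r"
  shows "cmod (exp z - 1) \<le> exp r * cmod z"
proof -
  have "cmod (exp z - exp 0) \<le> exp r * cmod (z - 0)"
  proof (rule field_differentiable_bound[where S = "{z. Re z \<le> r}" and f' = exp])
    show "convex {z. Re z \<le> r}" by (rule convex_halfspace_Re_le)
  qed (use assms in \<open>auto intro: DERIV_subset[OF DERIV_exp]\<close>)
  thus ?thesis by simp
qed

text \<open>The contribution of the pole at s = 1, as a convolution: integrating exp w exp ((u - w)
  s) / s^2 over w in [0, u] gives the integrand minus exp u / (s^2 (s - 1)). The left side is
  evaluated by the kernel 1 / s^2, and the subtracted term integrates to 0 over t.\<close>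

lemma integral_exp_over_square_pole:
  assumes "0 \<le> u"
  shows "integrable lborel (\<lambda>t. exp (of_real u * Complex 4 t) / ((Complex 4 t)\<^sup>2 * (Complex 4 t - 1)))"
    and "(LINT t|lborel. exp (of_real u * Complex 4 t) / ((Complex 4 t)\<^sup>2 * (Complex 4 t - 1)))
      = of_real (2 * pi * (exp u - 1 - u))"
proof -
  define s where "s t = Complex 4 t" for t
  have s1: "1 \<le> cmod (s t - 1)" for t
    using complex_Re_le_cmod[of "s t - 1"] by (simp add: s_def)
  have s0: "s t \<noteq> 0" "s t - 1 \<noteq> 0" for t using s1[of t] by (auto simp: s_def complex_eq_iff)
  have nb: "cmod (exp (of_real v * s t) / ((s t)\<^sup>2 * (s t - 1))) \<le> exp (v * 4) * (1 / (4\<^sup>2 + t\<^sup>2))" for v t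
  proof -
    have "cmod (exp (of_real v * s t) / ((s t)\<^sup>2 * (s t - 1))) = cmod (exp (of_real v * s t) / (s t)\<^sup>2) / cmod (s t - 1)"
      by (simp add: norm_divide norm_mult)
    also have "\<dots> \<le> cmod (exp (of_real v * s t) / (s t)\<^sup>2) / 1" using s1[of t] by (intro divide_left_mono) auto
    finally show ?thesis unfolding s_def cmod_exp_over_square by simp
  qed
  have int: "integrable lborel (\<lambda>t. exp (of_real v * s t) / ((s t)\<^sup>2 * (s t - 1)))" for v
    unfolding s_def
  proof (rule integrable_vertical_line[where S = "-{0,1}" and f = "\<lambda>s. exp (of_real v * s) / (s\<^sup>2 * (s - 1))" and g = "\<lambda>t. exp (v * 4) * (1 / (4\<^sup>2 + t\<^sup>2))"])
    show "(\<lambda>s. exp (of_real v * s) / (s\<^sup>2 * (s - 1))) holomorphic_on - {0, 1}" by (intro holomorphic_intros) auto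
    show "Complex 4 t \<in> - {0, 1}" for t by (auto simp: complex_eq_iff)
    show "integrable lborel (\<lambda>t. exp (v * 4) * (1 / ((4::real)\<^sup>2 + t\<^sup>2)))"
      by (intro integrable_mult_right integrable_inverse_sum_squares) auto
  qed (use nb in \<open>simp add: s_def\<close>)
  show "integrable lborel (\<lambda>t. exp (of_real u * Complex 4 t) / ((Complex 4 t)\<^sup>2 * (Complex 4 t - 1)))"
    using int[of u] by (simp add: s_def)
  have Y0: "(LINT t|lborel. exp (of_real 0 * s t) / ((s t)\<^sup>2 * (s t - 1))) = 0"
  proof -
    \<comment> \<open>Translating by 1 moves the pole s = 1 to the boundary of the half-plane Re z >
      0, as \<open>vertical_integral_eq_0\<close> requires.\<close>
    have "(LINT t|lborel. (\<lambda>z. 1 / ((z + 1)\<^sup>2 * z)) (Complex 3 t)) = 0"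
    proof (rule vertical_integral_eq_0[where \<sigma> = 3])
      show "(\<lambda>z. 1 / ((z + 1)\<^sup>2 * z)) holomorphic_on {s. 0 < Re s}"
      proof (intro holomorphic_intros)
        fix z assume "z \<in> {s. 0 < Re s}"
        hence "0 < Re z" "0 < Re (z + 1)" by auto
        hence "z \<noteq> 0" "z + 1 \<noteq> 0" by (metis less_irrefl zero_complex.sel(1))+
        thus "(z + 1)\<^sup>2 * z \<noteq> 0" by simp
      qed
      show "cmod (1 / ((Complex \<sigma> t + 1)\<^sup>2 * Complex \<sigma> t)) \<le> 1 / (\<sigma>\<^sup>2 + t\<^sup>2)" if "0 < \<sigma>" for \<sigma> t
      proof -
        have p: "0 < \<sigma>\<^sup>2 + t\<^sup>2" using that by (simp add: add_pos_nonneg)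
        have "(cmod (Complex \<sigma> t))\<^sup>2 \<le> (cmod (Complex \<sigma> t + 1))\<^sup>2" using that by (auto simp: cmod_power2 intro!: power_mono)
        hence a: "cmod (Complex \<sigma> t) \<le> cmod (Complex \<sigma> t + 1)" by (rule power2_le_imp_le) simp
        have b: "1 \<le> cmod (Complex \<sigma> t + 1)" using complex_Re_le_cmod[of "Complex \<sigma> t + 1"] that by simp
        have "(cmod (Complex \<sigma> t))\<^sup>2 \<le> (cmod (Complex \<sigma> t + 1))\<^sup>2 * cmod (Complex \<sigma> t)"
        proof -
          have "1 * cmod (Complex \<sigma> t) \<le> cmod (Complex \<sigma> t + 1) * cmod (Complex \<sigma> t + 1)" using a b by (intro mult_mono) auto
          from mult_right_mono[OF this, of "cmod (Complex \<sigma> t)"] show ?thesis by (simp add: power2_eq_square)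
        qed
        hence "\<sigma>\<^sup>2 + t\<^sup>2 \<le> cmod ((Complex \<sigma> t + 1)\<^sup>2 * Complex \<sigma> t)" unfolding cmod_Complex_power2 norm_mult norm_power .
        thus ?thesis using p unfolding norm_divide norm_one by (intro divide_left_mono) (auto intro: mult_pos_pos order.strict_trans2)
      qed
    qed auto
    moreover have "Complex 3 t + 1 = s t" "Complex 3 t = s t - 1" for t by (simp_all add: s_def complex_eq_iff)
    ultimately show ?thesis by (simp only: of_real_0 mult_zero_left exp_zero)
  qed
  have inner: "(LINT w:{0..u}|lborel. of_real (exp w) * (exp (of_real (u - w) * s t) / (s t)\<^sup>2))
      = exp (of_real u * s t) / ((s t)\<^sup>2 * (s t - 1)) - of_real (exp u) * (exp (of_real 0 * s t) / ((s t)\<^sup>2 * (s t - 1)))" for t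
  proof -
    define k where "k = s t - 1"
    define B where "B = exp (of_real u * s t) / (s t)\<^sup>2"
    have k: "k \<noteq> 0" using s0 by (simp add: k_def)
    have e: "of_real (exp w) * (exp (of_real (u - w) * s t) / (s t)\<^sup>2) = B * exp (- k * of_real w)" for w
      unfolding B_def k_def by (simp add: exp_of_real[symmetric] exp_diff[symmetric] exp_add[symmetric] algebra_simps)
    have "((\<lambda>w. - B / k * exp (- k * of_real w)) has_vector_derivative B * exp (- k * of_real w)) (at w within {0..u})" for w
    proof -
      have "((\<lambda>w. - B / k * exp (- k * w)) has_field_derivative B * exp (- k * of_real w)) (at (of_real w))"
        using k by (auto intro!: derivative_eq_intros)
      from has_vector_derivative_real_field[OF this] show ?thesis .
    qed
    from fundamental_theorem_of_calculus[OF assms this]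
    have "((\<lambda>w. B * exp (- k * of_real w)) has_integral (- B / k * exp (- k * of_real u) - - B / k * exp (- k * of_real 0))) {0..u}" .
    moreover have "set_integrable lborel {0..u} (\<lambda>w. B * exp (- k * of_real w))"
      by (rule borel_integrable_atLeastAtMost') (intro continuous_intros)
    ultimately have "(LINT w:{0..u}|lborel. B * exp (- k * of_real w)) = - B / k * exp (- k * of_real u) - - B / k * exp (- k * of_real 0)"
      by (simp only: set_borel_integral_eq_integral(2) integral_unique)
    hence "(LINT w:{0..u}|lborel. B * exp (- k * of_real w)) = B / k - B / k * exp (- k * of_real u)"
      by (simp only:) simp
    moreover have "B / k = exp (of_real u * s t) / ((s t)\<^sup>2 * (s t - 1))" by (simp add: B_def k_def)
    moreover have "B / k * exp (- k * of_real u) = of_real (exp u) * (exp (of_real 0 * s t) / ((s t)\<^sup>2 * (s t - 1)))"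
    proof -
      have "exp (of_real u * s t) * exp (- k * of_real u) = of_real (exp u)"
        unfolding k_def by (simp add: exp_of_real[symmetric] exp_add[symmetric] algebra_simps)
      thus ?thesis unfolding B_def k_def[symmetric] by simp
    qed
    ultimately show ?thesis unfolding e by (simp only:)
  qed
  define \<Phi> where "\<Phi> w t = indicat_real {0..u} w *\<^sub>R (of_real (exp w) * (exp (of_real (u - w) * s t) / (s t)\<^sup>2))" for w t
  have sm: "continuous_on UNIV s" unfolding s_def Complex_eq by (intro continuous_intros)
  have [measurable]: "s \<in> borel_measurable borel" using borel_measurable_continuous_onI[OF sm] .
  have c2: "cmod (exp (of_real v * s t) / (s t)\<^sup>2) = exp (v * 4) * (1 / (4\<^sup>2 + t\<^sup>2))" for v t
    unfolding s_def by (rule cmod_exp_over_square)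
  have Fub: "integrable (lborel \<Otimes>\<^sub>M lborel) (\<lambda>(w, t). \<Phi> w t)"
  proof (rule lborel_pair.Fubini_integrable)
    show "(\<lambda>(w, t). \<Phi> w t) \<in> borel_measurable (lborel \<Otimes>\<^sub>M lborel)"
      unfolding \<Phi>_def case_prod_beta' by measurable
    have "norm (\<Phi> w t) = indicat_real {0..u} w * exp w * exp ((u - w) * 4) * (1 / (4\<^sup>2 + t\<^sup>2))" for w t
      unfolding \<Phi>_def norm_scaleR norm_mult c2 by (simp add: indicator_def)
    hence "(\<lambda>w. LINT t|lborel. norm (case (w, t) of (w, t) \<Rightarrow> \<Phi> w t)) = (\<lambda>w. indicat_real {0..u} w *\<^sub>R (exp w * exp ((u - w) * 4) * (LINT t|lborel. 1 / (4\<^sup>2 + t\<^sup>2))))"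
      by (intro ext) (simp only: prod.case integral_mult_right_zero real_scaleR_def mult.assoc)
    moreover have "set_integrable lborel {0..u} (\<lambda>w. exp w * exp ((u - w) * 4) * (LINT t|lborel. 1 / (4\<^sup>2 + t\<^sup>2)))"
      by (rule borel_integrable_atLeastAtMost') (intro continuous_intros)
    ultimately show "integrable lborel (\<lambda>w. LINT t|lborel. norm (case (w, t) of (w, t) \<Rightarrow> \<Phi> w t))"
      by (simp only: set_integrable_def)
    show "AE w in lborel. integrable lborel (\<lambda>t. case (w, t) of (w, t) \<Rightarrow> \<Phi> w t)"
    proof (intro AE_I2)
      fix w
      have "integrable lborel (\<lambda>t. exp (of_real (u - w) * s t) / (s t)\<^sup>2)"
        unfolding s_def by (rule integrable_exp_over_square) simp
      thus "integrable lborel (\<lambda>t. case (w, t) of (w, t) \<Rightarrow> \<Phi> w t)"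
        unfolding \<Phi>_def prod.case by (intro integrable_scaleR_right integrable_mult_right)
    qed
  qed
  have "(LINT t|lborel. LINT w|lborel. \<Phi> w t) = (LINT w|lborel. LINT t|lborel. \<Phi> w t)"
    by (rule lborel_pair.Fubini_integral[OF Fub])
  moreover have "(LINT w|lborel. \<Phi> w t) = exp (of_real u * s t) / ((s t)\<^sup>2 * (s t - 1)) - of_real (exp u) * (exp (of_real 0 * s t) / ((s t)\<^sup>2 * (s t - 1)))" for t
    using inner[of t] unfolding \<Phi>_def set_lebesgue_integral_def .
  moreover have "(LINT t|lborel. \<Phi> w t) = complex_of_real (indicat_real {0..u} w *\<^sub>R (exp w * (2 * pi * (u - w))))" for w
  proof -
    have "(LINT t|lborel. \<Phi> w t) = indicat_real {0..u} w *\<^sub>R (of_real (exp w) * (LINT t|lborel. exp (of_real (u - w) * s t) / (s t)\<^sup>2))"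
      unfolding \<Phi>_def by (simp only: integral_scaleR_right integral_mult_right_zero)
    also have "(LINT t|lborel. exp (of_real (u - w) * s t) / (s t)\<^sup>2) = of_real (2 * pi * max (u - w) 0)"
      unfolding s_def by (rule integral_exp_over_square) simp
    finally show ?thesis by (cases "w \<in> {0..u}") auto
  qed
  ultimately have "(LINT t|lborel. exp (of_real u * s t) / ((s t)\<^sup>2 * (s t - 1)) - of_real (exp u) * (exp (of_real 0 * s t) / ((s t)\<^sup>2 * (s t - 1))))
      = (LINT w|lborel. complex_of_real (indicat_real {0..u} w *\<^sub>R (exp w * (2 * pi * (u - w)))))" by (simp only:)
  also have "\<dots> = complex_of_real (LINT w:{0..u}|lborel. exp w * (2 * pi * (u - w)))"
    unfolding integral_complex_of_real set_lebesgue_integral_def ..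
  also have "(LINT w:{0..u}|lborel. exp w * (2 * pi * (u - w))) = 2 * pi * (exp u - 1 - u)"
  proof -
    have "((\<lambda>w. 2 * pi * (exp w * (u - w + 1))) has_vector_derivative exp w * (2 * pi * (u - w))) (at w within {0..u})" for w
      unfolding has_real_derivative_iff_has_vector_derivative[symmetric]
      by (auto intro!: derivative_eq_intros simp: algebra_simps)
    from fundamental_theorem_of_calculus[OF assms this]
    have "((\<lambda>w. exp w * (2 * pi * (u - w))) has_integral (2 * pi * (exp u * (u - u + 1)) - 2 * pi * (exp 0 * (u - 0 + 1)))) {0..u}" .
    moreover have "set_integrable lborel {0..u} (\<lambda>w. exp w * (2 * pi * (u - w)))"
      by (rule borel_integrable_atLeastAtMost') (intro continuous_intros)
    ultimately have "(LINT w:{0..u}|lborel. exp w * (2 * pi * (u - w))) = 2 * pi * (exp u * (u - u + 1)) - 2 * pi * (exp 0 * (u - 0 + 1))"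
      by (simp only: set_borel_integral_eq_integral(2) integral_unique)
    thus ?thesis by (simp add: algebra_simps)
  qed
  also have "(LINT t|lborel. exp (of_real u * s t) / ((s t)\<^sup>2 * (s t - 1)) - of_real (exp u) * (exp (of_real 0 * s t) / ((s t)\<^sup>2 * (s t - 1))))
      = (LINT t|lborel. exp (of_real u * s t) / ((s t)\<^sup>2 * (s t - 1)))"
    by (subst Bochner_Integration.integral_diff[OF int integrable_mult_right[OF int]]) (simp only: integral_mult_right_zero Y0 mult_zero_right diff_zero)
  finally show "(LINT t|lborel. exp (of_real u * Complex 4 t) / ((Complex 4 t)\<^sup>2 * (Complex 4 t - 1)))
      = of_real (2 * pi * (exp u - 1 - u))" by (simp only: s_def)
qed

text \<open>The logarithmic Riesz mean of order 1. As a function of u it is continuous and piecewise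
  linear with slope \<psi>(exp u), and its weights are those which the kernel 1 / s^2
  produces.\<close>

definition riesz_sum :: "(nat \<Rightarrow> complex) \<Rightarrow> real \<Rightarrow> complex" where
  "riesz_sum Lam u = (\<Sum>n\<in>{1..nat \<lfloor>exp u\<rfloor>}. Lam n * of_real (u - ln n))"

text \<open>On Re s = 4 the modulus of the n-th term is |Lam n| n^-4 times a fixed integrable
  function of t, so sum and integral may be interchanged. \<open>integral_exp_over_square\<close>
  with w = u - ln n then kills all n > exp u.\<close>

lemma riesz_sum_integral:
  assumes sm: "summable (\<lambda>n. norm (Lam n / of_nat n powr 4))"
  shows "integrable lborel (\<lambda>t. (\<Sum>n. Lam n / of_nat n powr Complex 4 t) * exp (of_real u * Complex 4 t) / (Complex 4 t)\<^sup>2)"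
    and "(LINT t|lborel. (\<Sum>n. Lam n / of_nat n powr Complex 4 t) * exp (of_real u * Complex 4 t) / (Complex 4 t)\<^sup>2)
      = of_real (2 * pi) * riesz_sum Lam u"
proof -
  define s where "s t = Complex 4 t" for t
  define f where "f n t = Lam n / of_nat n powr s t * (exp (of_real u * s t) / (s t)\<^sup>2)" for n t
  have f0: "f 0 t = 0" for t by (simp add: f_def)
  have fe: "f n t = Lam n * (exp (of_real (u - ln n) * s t) / (s t)\<^sup>2)" if "n \<noteq> 0" for n t
  proof -
    have "of_nat n powr s t = exp (s t * of_real (ln n))" using that by (simp add: powr_def Ln_of_nat)
    thus ?thesis unfolding f_def by (simp add: exp_diff algebra_simps)
  qed
  have nf: "norm (f n t) = norm (Lam n / of_nat n powr 4) * (exp (u * 4) * (1 / (4\<^sup>2 + t\<^sup>2)))" for n t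
  proof -
    have "cmod (of_nat n powr s t) = cmod (of_nat n powr 4)"
      using norm_powr_real_powr[of "of_nat n" "s t"] norm_powr_real_powr[of "of_nat n" 4] by (cases "n = 0") (auto simp: s_def)
    thus ?thesis unfolding f_def norm_mult norm_divide s_def
      using cmod_exp_over_square[of u 4 t] by (simp only: norm_divide norm_mult)
  qed
  have fi: "integrable lborel (f n)" for n
  proof (cases "n = 0")
    case False
    have "f n = (\<lambda>t. Lam n * (exp (of_real (u - ln n) * s t) / (s t)\<^sup>2))" using fe[OF False] by (intro ext)
    thus ?thesis using integrable_mult_right[OF integrable_exp_over_square[of 4 "u - ln n"], of "Lam n"]
      unfolding s_def by (simp only:)
  next
    case True
    hence "f n = (\<lambda>_. 0)" using f0 by auto
    thus ?thesis by simp
  qed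
  have s1: "AE t in lborel. summable (\<lambda>n. norm (f n t))"
    unfolding nf by (intro AE_I2 summable_mult2 sm)
  have s2: "summable (\<lambda>n. LINT t|lborel. norm (f n t))"
    unfolding nf integral_mult_right_zero by (intro summable_mult2 sm)
  have sumf: "(\<Sum>n. f n t) = (\<Sum>n. Lam n / of_nat n powr Complex 4 t) * exp (of_real u * Complex 4 t) / (Complex 4 t)\<^sup>2" for t
  proof -
    have "norm (Lam n / of_nat n powr s t) = norm (Lam n / of_nat n powr 4)" for n
      using norm_powr_real_powr[of "of_nat n" "s t"] norm_powr_real_powr[of "of_nat n" 4] by (cases "n = 0") (auto simp: s_def norm_divide)
    hence "summable (\<lambda>n. norm (Lam n / of_nat n powr s t))" using sm by (simp only:)
    hence "summable (\<lambda>n. Lam n / of_nat n powr s t)" by (rule summable_norm_cancel)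
    from suminf_mult2[OF this, of "exp (of_real u * s t) / (s t)\<^sup>2"] show ?thesis
      unfolding f_def s_def by (simp only: times_divide_eq_right)
  qed
  show "integrable lborel (\<lambda>t. (\<Sum>n. Lam n / of_nat n powr Complex 4 t) * exp (of_real u * Complex 4 t) / (Complex 4 t)\<^sup>2)"
    using integrable_suminf[OF fi s1 s2] unfolding sumf .
  have "(LINT t|lborel. (\<Sum>n. f n t)) = (\<Sum>n. LINT t|lborel. f n t)" by (rule integral_suminf[OF fi s1 s2])
  also have "(\<lambda>n. LINT t|lborel. f n t) = (\<lambda>n. if n \<in> {1..nat \<lfloor>exp u\<rfloor>} then of_real (2 * pi) * (Lam n * of_real (u - ln n)) else 0)"
  proof
    fix n
    show "(LINT t|lborel. f n t) = (if n \<in> {1..nat \<lfloor>exp u\<rfloor>} then of_real (2 * pi) * (Lam n * of_real (u - ln n)) else 0)"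
    proof (cases "n = 0")
      case False
      have "(LINT t|lborel. f n t) = Lam n * of_real (2 * pi * max (u - ln n) 0)"
        unfolding fe[OF False] integral_mult_right_zero s_def by (subst integral_exp_over_square) auto
      moreover have "n \<in> {1..nat \<lfloor>exp u\<rfloor>} \<longleftrightarrow> ln n \<le> u"
      proof -
        have "ln n \<le> u \<longleftrightarrow> real n \<le> exp u" using exp_le_cancel_iff[of "ln n" u] False by simp
        also have "\<dots> \<longleftrightarrow> n \<le> nat \<lfloor>exp u\<rfloor>" 
        proof
          assume "n \<le> nat \<lfloor>exp u\<rfloor>"
          hence "real n \<le> real (nat \<lfloor>exp u\<rfloor>)" by (rule of_nat_mono)
          also have "\<dots> \<le> exp u" by (rule of_nat_floor) simp
          finally show "real n \<le> exp u" .
        qed (rule le_nat_floor)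
        finally show ?thesis using False by auto
      qed
      ultimately show ?thesis by (auto simp: max_def)
    qed (simp add: f0)
  qed
  also have "(\<Sum>n. if n \<in> {1..nat \<lfloor>exp u\<rfloor>} then of_real (2 * pi) * (Lam n * of_real (u - ln n)) else 0) = of_real (2 * pi) * riesz_sum Lam u"
    by (subst suminf_finite[of "{1..nat \<lfloor>exp u\<rfloor>}"]) (auto simp: riesz_sum_def sum_distrib_left)
  finally show "(LINT t|lborel. (\<Sum>n. Lam n / of_nat n powr Complex 4 t) * exp (of_real u * Complex 4 t) / (Complex 4 t)\<^sup>2)
      = of_real (2 * pi) * riesz_sum Lam u" unfolding sumf .
qed

section \<open>Square deviations and the sector average\<close>

text \<open>x and h are independent arguments, so that the rays h = (1 + \<kappa>) \<delta> x behind
  \<open>VF\<close> and the lines of constant h behind \<open>tVF\<close> are sections of one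
  function of two variables.\<close>

definition sqdev :: "(nat \<Rightarrow> complex) \<Rightarrow> nat \<Rightarrow> real \<Rightarrow> real \<Rightarrow> real" where
  "sqdev Lam m x h = (cmod (psiF Lam (x + h) - psiF Lam x - of_nat m * of_real h))\<^sup>2"

lemma sqdev_nonneg [simp]: "0 \<le> sqdev Lam m x h"
  by (simp add: sqdev_def)

lemma VF_sqdev: "VF Lam m X \<delta> = integral {1..X} (\<lambda>x. sqdev Lam m x (\<delta> * x))"
  by (simp add: VF_def sqdev_def)

lemma tVF_sqdev: "tVF Lam m X h = integral {1..X} (\<lambda>x. sqdev Lam m x h)"
  by (simp add: tVF_def sqdev_def)

lemma psiF_measurable [measurable]: "psiF Lam \<in> borel_measurable borel"
proof -
  have "(\<lambda>x::real. (\<lambda>n::nat. \<Sum>k\<in>{1..n}. Lam k) (nat \<lfloor>x\<rfloor>)) \<in> borel_measurable borel"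
    by (rule measurable_compose[where N = "count_space UNIV"]) auto
  thus ?thesis by (simp add: psiF_def[abs_def])
qed

lemma sqdev_measurable [measurable (raw)]:
  assumes [measurable]: "p \<in> borel_measurable M" "q \<in> borel_measurable M"
  shows "(\<lambda>x. sqdev Lam m (p x) (q x)) \<in> borel_measurable M"
  unfolding sqdev_def by measurable

lemma psiF_bound:
  assumes "x \<le> B"
  shows "cmod (psiF Lam x) \<le> (\<Sum>n\<in>{1..nat \<lfloor>B\<rfloor>}. cmod (Lam n))"
proof -
  have "cmod (psiF Lam x) \<le> (\<Sum>n\<in>{1..nat \<lfloor>x\<rfloor>}. cmod (Lam n))" unfolding psiF_def by (rule norm_sum)
  also have "\<dots> \<le> (\<Sum>n\<in>{1..nat \<lfloor>B\<rfloor>}. cmod (Lam n))"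
    using assms by (intro sum_mono2) (auto intro!: nat_mono floor_mono order_trans)
  finally show ?thesis .
qed

lemma sqdev_bounded:
  obtains K where "\<And>x h. x \<le> B \<Longrightarrow> 0 \<le> h \<Longrightarrow> h \<le> H \<Longrightarrow> sqdev Lam m x h \<le> K"
proof -
  define S where "S C = (\<Sum>n\<in>{1..nat \<lfloor>C\<rfloor>}. cmod (Lam n))" for C :: real
  have "sqdev Lam m x h \<le> (S (B + H) + S B + real m * H)\<^sup>2" if "x \<le> B" "0 \<le> h" "h \<le> H" for x h
  proof -
    have "cmod (psiF Lam (x + h) - psiF Lam x - of_nat m * of_real h)
        \<le> cmod (psiF Lam (x + h)) + cmod (psiF Lam x) + cmod (of_nat m * of_real h)"
      by (intro order_trans[OF norm_triangle_ineq4] add_mono order_trans[OF norm_triangle_ineq4] order_refl)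
    also have "\<dots> \<le> S (B + H) + S B + real m * H"
      unfolding S_def using that by (intro add_mono psiF_bound) (auto simp: norm_mult intro!: mult_left_mono)
    finally show ?thesis unfolding sqdev_def by (intro power_mono) auto
  qed
  thus ?thesis by (rule that)
qed

lemma sqdev_set_integrable:
  assumes [measurable]: "p \<in> borel_measurable borel" and p: "\<And>x. x \<in> {a..b} \<Longrightarrow> 0 \<le> p x \<and> p x \<le> H"
  shows "set_integrable lborel {a..b} (\<lambda>x. sqdev Lam m x (p x))"
proof -
  obtain K where K: "\<And>x h. x \<le> b \<Longrightarrow> 0 \<le> h \<Longrightarrow> h \<le> H \<Longrightarrow> sqdev Lam m x h \<le> K"
    using sqdev_bounded by blast
  have "integrable lborel (\<lambda>x. indicat_real {a..b} x *\<^sub>R sqdev Lam m x (p x))"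
  proof (rule Bochner_Integration.integrable_bound)
    show "integrable lborel (\<lambda>x. indicat_real {a..b} x *\<^sub>R K)"
      by (intro integrable_scaleR_left) (auto simp: emeasure_lborel_Icc_eq)
    show "AE x in lborel. norm (indicat_real {a..b} x *\<^sub>R sqdev Lam m x (p x)) \<le> norm (indicat_real {a..b} x *\<^sub>R K)"
      using K p by (intro AE_I2) (auto simp: indicator_def intro: order_trans[OF _ abs_ge_self])
  qed measurable
  thus ?thesis by (simp add: set_integrable_def)
qed

lemma sqdev_integrable_on:
  assumes "p \<in> borel_measurable borel" and "\<And>x. x \<in> {a..b} \<Longrightarrow> 0 \<le> p x \<and> p x \<le> H"
  shows "(\<lambda>x. sqdev Lam m x (p x)) integrable_on {a..b}"
  using set_borel_integral_eq_integral(1)[OF sqdev_set_integrable[OF assms]] .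

lemma nn_integral_sqdev:
  assumes "p \<in> borel_measurable borel" and "\<And>x. x \<in> {a..b} \<Longrightarrow> 0 \<le> p x \<and> p x \<le> H"
  shows "(\<integral>\<^sup>+x. ennreal (sqdev Lam m x (p x)) * indicator {a..b} x \<partial>lborel) = ennreal (integral {a..b} (\<lambda>x. sqdev Lam m x (p x)))"
proof -
  note s = sqdev_set_integrable[where p = p and a = a and b = b, OF assms]
  have "(\<integral>\<^sup>+x. ennreal (sqdev Lam m x (p x)) * indicator {a..b} x \<partial>lborel) = (\<integral>\<^sup>+x. ennreal (indicat_real {a..b} x *\<^sub>R sqdev Lam m x (p x)) \<partial>lborel)"
    by (intro nn_integral_cong) (auto simp: indicator_def)
  also have "\<dots> = ennreal (LINT x:{a..b}|lborel. sqdev Lam m x (p x))"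
    unfolding set_lebesgue_integral_def using s[of Lam m]
    by (intro nn_integral_eq_integral) (auto simp: set_integrable_def)
  finally show ?thesis using set_borel_integral_eq_integral(2)[OF s] by simp
qed

lemma
  assumes "0 \<le> k" "0 \<le> a"
  shows sqdev_linear_integrable_on: "(\<lambda>x. sqdev Lam m x (k * x)) integrable_on {a..b}"
    and nn_integral_sqdev_linear: "(\<integral>\<^sup>+x. ennreal (sqdev Lam m x (k * x)) * indicator {a..b} x \<partial>lborel)
      = ennreal (integral {a..b} (\<lambda>x. sqdev Lam m x (k * x)))"
proof -
  have m: "(\<lambda>x. k * x) \<in> borel_measurable borel" by measurable
  have b: "0 \<le> k * x \<and> k * x \<le> k * b" if "x \<in> {a..b}" for x
    using that assms by (intro conjI mult_nonneg_nonneg mult_left_mono) auto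
  note rules = sqdev_integrable_on[of "\<lambda>x. k * x"] nn_integral_sqdev[of "\<lambda>x. k * x"]
  show "(\<lambda>x. sqdev Lam m x (k * x)) integrable_on {a..b}"
    "(\<integral>\<^sup>+x. ennreal (sqdev Lam m x (k * x)) * indicator {a..b} x \<partial>lborel) = ennreal (integral {a..b} (\<lambda>x. sqdev Lam m x (k * x)))"
    by (rule rules[OF m b], assumption)+
qed

lemma VF_nonneg: "0 \<le> \<delta> \<Longrightarrow> 0 \<le> VF Lam m X \<delta>"
  unfolding VF_sqdev by (intro integral_nonneg sqdev_linear_integrable_on) auto

text \<open>With y = (1 + \<delta>) x the increment between the two rays becomes f(y, \<theta> y)
  for \<theta> = \<kappa> \<delta> / (1 + \<delta>), so its mean square is a value of
  \<open>VF\<close> at a smaller slope; y runs up to 2 X because \<delta> \<le> 1.\<close>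

lemma VF_shift_comparison:
  assumes "0 < \<delta>" "\<delta> \<le> 1" "0 < \<kappa>" "\<kappa> \<le> 1" "1 \<le> X1" "X1 \<le> X" "0 < \<tau>" "\<tau> \<le> 1"
  shows "\<bar>integral {X1..X} (\<lambda>x. sqdev Lam m x (\<delta> * x)) - integral {X1..X} (\<lambda>x. sqdev Lam m x ((1 + \<kappa>) * \<delta> * x))\<bar>
    \<le> 2 / \<tau> * VF Lam m (2 * X) (\<kappa> * \<delta> / (1 + \<delta>)) + \<tau> * VF Lam m X \<delta>"
proof -
  define \<theta> where "\<theta> = \<kappa> * \<delta> / (1 + \<delta>)"
  define r where "r x = sqdev Lam m ((1 + \<delta>) * x) (\<theta> * ((1 + \<delta>) * x))" for x
  define P where "P x = sqdev Lam m x (\<delta> * x)" for x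
  define N where "N x = sqdev Lam m x ((1 + \<kappa>) * \<delta> * x)" for x
  have \<theta>: "0 < \<theta>" "\<theta> * (1 + \<delta>) = \<kappa> * \<delta>" using assms by (auto simp: \<theta>_def)
  have [measurable]: "r \<in> borel_measurable borel" unfolding r_def by measurable
  have Pi: "P integrable_on {X1..X}" "P integrable_on {1..X}" unfolding P_def
    using assms by (auto intro!: sqdev_linear_integrable_on)
  have Ni: "N integrable_on {X1..X}" unfolding N_def
    using assms by (auto intro!: sqdev_linear_integrable_on)
  have point: "\<bar>P x - N x\<bar> \<le> 2 / \<tau> * r x + \<tau> * P x" for x
  proof -
    define p where "p = psiF Lam (x + \<delta> * x) - psiF Lam x - of_nat m * of_real (\<delta> * x)"
    define q where "q = psiF Lam (x + (1 + \<kappa>) * \<delta> * x) - psiF Lam x - of_nat m * of_real ((1 + \<kappa>) * \<delta> * x)"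
    have e: "\<theta> * ((1 + \<delta>) * x) = \<kappa> * \<delta> * x" using \<theta>(2) by (simp add: mult.assoc[symmetric])
    have a1: "(1 + \<delta>) * x = x + \<delta> * x" "(1 + \<delta>) * x + \<theta> * ((1 + \<delta>) * x) = x + (1 + \<kappa>) * \<delta> * x"
      "\<theta> * ((1 + \<delta>) * x) = (1 + \<kappa>) * \<delta> * x - \<delta> * x"
      unfolding e by (simp_all add: algebra_simps)
    have "q - p = psiF Lam ((1 + \<delta>) * x + \<theta> * ((1 + \<delta>) * x)) - psiF Lam ((1 + \<delta>) * x) - of_nat m * of_real (\<theta> * ((1 + \<delta>) * x))"
      unfolding a1(2) unfolding a1(3) unfolding a1(1) p_def q_def by (simp add: algebra_simps)
    hence r: "r x = (cmod (q - p))\<^sup>2" by (simp add: r_def sqdev_def)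
    have PN: "P x = (cmod p)\<^sup>2" "N x = (cmod q)\<^sup>2" by (simp_all add: P_def N_def sqdev_def p_def q_def)
    define u where "u = cmod (q - p)"
    have "\<bar>cmod p - cmod q\<bar> \<le> u" unfolding u_def using norm_triangle_ineq3[of p q] by (simp add: norm_minus_commute)
    hence "\<bar>(cmod p)\<^sup>2 - (cmod q)\<^sup>2\<bar> \<le> u * (2 * cmod p + u)"
    proof -
      have "(cmod p)\<^sup>2 - (cmod q)\<^sup>2 = (cmod p - cmod q) * (cmod p + cmod q)" by (simp add: power2_eq_square algebra_simps)
      moreover have "\<bar>cmod p - cmod q\<bar> * (cmod p + cmod q) \<le> u * (2 * cmod p + u)"
        using \<open>\<bar>cmod p - cmod q\<bar> \<le> u\<close> by (intro mult_mono) (auto simp: u_def)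
      ultimately show ?thesis by (simp add: abs_mult)
    qed
    also have "\<dots> = u\<^sup>2 + 2 * (u * cmod p)" by (simp add: power2_eq_square algebra_simps)
    \<comment> \<open>Weighted arithmetic-geometric mean. In the application \<tau> is the square
      root of \<eta>, which gives both resulting terms the relative size \<tau>.\<close>
    also have "2 * (u * cmod p) \<le> u\<^sup>2 / \<tau> + \<tau> * (cmod p)\<^sup>2"
    proof -
      have "0 \<le> (u - \<tau> * cmod p)\<^sup>2 / \<tau>" using assms by simp
      also have "\<dots> = u\<^sup>2 / \<tau> + \<tau> * (cmod p)\<^sup>2 - 2 * (u * cmod p)" using assms by (simp add: field_simps power2_eq_square)
      finally show ?thesis by simp
    qed
    also have "u\<^sup>2 + (u\<^sup>2 / \<tau> + \<tau> * (cmod p)\<^sup>2) \<le> 2 / \<tau> * u\<^sup>2 + \<tau> * (cmod p)\<^sup>2"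
    proof -
      have "u\<^sup>2 * \<tau> \<le> u\<^sup>2 * 1" using assms by (intro mult_left_mono) auto
      hence "u\<^sup>2 \<le> u\<^sup>2 / \<tau>" using assms by (simp add: pos_le_divide_eq)
      thus ?thesis by (simp add: mult.commute)
    qed
    finally show ?thesis unfolding PN r u_def by simp
  qed
  define G where "G y = sqdev Lam m y (\<theta> * y)" for y
  have [measurable]: "G \<in> borel_measurable borel" unfolding G_def by measurable
  have \<delta>1: "0 < 1 + \<delta>" using assms by simp
  have nnr: "(\<integral>\<^sup>+x. ennreal (r x) * indicator {X1..X} x \<partial>lborel) \<le> ennreal (VF Lam m (2 * X) \<theta>)"
  proof -
    have "(\<integral>\<^sup>+x. ennreal (r x) * indicator {X1..X} x \<partial>lborel) \<le> (\<integral>\<^sup>+x. (ennreal (G (0 + (1 + \<delta>) * x)) * indicator {1..2*X} (0 + (1 + \<delta>) * x)) \<partial>lborel)"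
    proof (intro nn_integral_mono)
      fix x
      show "ennreal (r x) * indicator {X1..X} x \<le> ennreal (G (0 + (1 + \<delta>) * x)) * indicator {1..2*X} (0 + (1 + \<delta>) * x)"
      proof (cases "x \<in> {X1..X}")
        case True
        have "1 * 1 \<le> (1 + \<delta>) * x" using True assms by (intro mult_mono) auto
        moreover have "(1 + \<delta>) * x \<le> 2 * X" using True assms by (intro mult_mono) auto
        ultimately show ?thesis using True by (simp add: r_def G_def)
      qed simp
    qed
    also have "\<dots> \<le> ennreal \<bar>1 + \<delta>\<bar> * (\<integral>\<^sup>+x. (ennreal (G (0 + (1 + \<delta>) * x)) * indicator {1..2*X} (0 + (1 + \<delta>) * x)) \<partial>lborel)"
    proof -
      have "ennreal 1 \<le> ennreal \<bar>1 + \<delta>\<bar>" using assms by (intro ennreal_leI) auto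
      from mult_right_mono[OF this] show ?thesis by simp
    qed
    also have "\<dots> = (\<integral>\<^sup>+y. ennreal (G y) * indicator {1..2*X} y \<partial>lborel)"
      using \<delta>1 by (subst nn_integral_real_affine[where c = "1 + \<delta>" and t = 0]) auto
    also have "\<dots> = ennreal (VF Lam m (2 * X) \<theta>)" unfolding G_def VF_sqdev
      using \<theta> by (intro nn_integral_sqdev_linear) auto
    finally show ?thesis .
  qed
  have ri: "set_integrable lborel {X1..X} r"
    unfolding set_integrable_def
  proof (rule integrableI_bounded)
    have "(\<integral>\<^sup>+x. ennreal (norm (indicat_real {X1..X} x *\<^sub>R r x)) \<partial>lborel) = (\<integral>\<^sup>+x. ennreal (r x) * indicator {X1..X} x \<partial>lborel)"
      by (intro nn_integral_cong) (auto simp: indicator_def r_def)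
    also note nnr
    finally show "(\<integral>\<^sup>+x. ennreal (norm (indicat_real {X1..X} x *\<^sub>R r x)) \<partial>lborel) < \<infinity>"
      by (simp add: le_less_trans)
  qed measurable
  have rle: "integral {X1..X} r \<le> VF Lam m (2 * X) \<theta>"
  proof -
    have "ennreal (integral {X1..X} r) = (\<integral>\<^sup>+x. ennreal (indicat_real {X1..X} x *\<^sub>R r x) \<partial>lborel)"
      using set_borel_integral_eq_integral(2)[OF ri] ri unfolding set_lebesgue_integral_def set_integrable_def
      by (subst nn_integral_eq_integral) (auto simp: r_def)
    also have "\<dots> = (\<integral>\<^sup>+x. ennreal (r x) * indicator {X1..X} x \<partial>lborel)"
      by (intro nn_integral_cong) (auto simp: indicator_def)
    also note nnr
    finally show ?thesis
      by (subst (asm) ennreal_le_iff) (use \<theta>(1) VF_nonneg less_imp_le in auto)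
  qed
  have rI: "r integrable_on {X1..X}" using set_borel_integral_eq_integral(1)[OF ri] .
  have "\<bar>integral {X1..X} P - integral {X1..X} N\<bar> = \<bar>integral {X1..X} (\<lambda>x. P x - N x)\<bar>"
    using Pi Ni by (subst integral_diff) auto
  also have "\<dots> \<le> integral {X1..X} (\<lambda>x. 2 / \<tau> * r x + \<tau> * P x)"
    unfolding real_norm_def[symmetric]
    by (rule integral_norm_bound_integral) (use Pi Ni rI point in \<open>auto intro!: integrable_diff integrable_add integrable_on_mult_right simp del: times_divide_eq_left\<close>)
  also have "\<dots> = 2 / \<tau> * integral {X1..X} r + \<tau> * integral {X1..X} P"
    using Pi(1) rI by (subst integral_add) (auto intro!: integrable_on_mult_right simp del: times_divide_eq_left)
  also have "\<dots> \<le> 2 / \<tau> * VF Lam m (2 * X) \<theta> + \<tau> * VF Lam m X \<delta>"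
  proof -
    have "integral {X1..X} P \<le> VF Lam m X \<delta>" unfolding VF_sqdev P_def[symmetric]
      using Pi assms by (intro integral_subset_le) (auto simp: P_def)
    thus ?thesis using rle assms by (intro add_mono mult_left_mono) auto
  qed
  finally show ?thesis unfolding P_def N_def \<theta>_def .
qed

text \<open>The sector is swept twice, by the rays h = (1 + \<kappa>) \<delta> x with 0 < \<kappa>
  \<le> \<eta> and by the lines h = \<delta> y; for fixed x the two are related by y = (1 +
  \<kappa>) x. In \<open>hor_lo\<close> the error stands on the right, so that no subtraction in
  \<open>ennreal\<close> occurs.\<close>

lemma sector_average:
  fixes g :: "real \<Rightarrow> real \<Rightarrow> real"
  assumes gm: "(\<lambda>z. g (fst z) (snd z)) \<in> borel_measurable (borel \<Otimes>\<^sub>M borel)"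
    and "0 < \<delta>" "0 < \<eta>" "\<eta> \<le> 1" "1 \<le> X1" "(1 + \<eta>) * X1 \<le> X" "c \<le> 2" "0 \<le> A" "0 \<le> E" "0 \<le> U"
    and ray_up: "\<And>\<kappa>. 0 < \<kappa> \<Longrightarrow> \<kappa> \<le> \<eta> \<Longrightarrow> (\<integral>\<^sup>+x. ennreal (g x ((1 + \<kappa>) * \<delta> * x)) * indicator {X1..X} x \<partial>lborel) \<le> ennreal U"
    and ray_lo: "\<And>\<kappa>. 0 < \<kappa> \<Longrightarrow> \<kappa> \<le> \<eta> \<Longrightarrow> ennreal V \<le> (\<integral>\<^sup>+x. ennreal (g x ((1 + \<kappa>) * \<delta> * x)) * indicator {X1..X} x \<partial>lborel)"
    and hor_up: "\<And>y. X1 \<le> y \<Longrightarrow> y \<le> (1 + \<eta>) * X \<Longrightarrow>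
      (\<integral>\<^sup>+x. ennreal (g x (\<delta> * y)) * indicator {y / (1 + \<eta>)..y} x \<partial>lborel) \<le> ennreal (\<delta> * y\<^sup>2 * A + E * \<delta> * y powr (2 - c))"
    and hor_lo: "\<And>y. X1 \<le> y \<Longrightarrow> y \<le> (1 + \<eta>) * X \<Longrightarrow>
      ennreal (\<delta> * y\<^sup>2 * A) \<le> (\<integral>\<^sup>+x. ennreal (g x (\<delta> * y)) * indicator {y / (1 + \<eta>)..y} x \<partial>lborel) + ennreal (E * \<delta> * y powr (2 - c))"
  shows "\<eta> * V \<le> (1 + \<eta>) * (\<delta> * A * ((1 + \<eta>) * X)\<^sup>2 / 2 + E * \<delta> * (2 * X) powr (2 - c) * ln (2 * X))"
    and "\<delta> * A * (X\<^sup>2 - ((1 + \<eta>) * X1)\<^sup>2) / 2 \<le> \<eta> * U + E * \<delta> * (2 * X) powr (2 - c) * ln (2 * X)"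
proof -
  note pos = assms(2-10)
  have [measurable]: "(\<lambda>z. g (p z) (q z)) \<in> borel_measurable M" if "p \<in> borel_measurable M" "q \<in> borel_measurable M" for p q :: "'z \<Rightarrow> real" and M
    using measurable_compose[OF measurable_Pair[OF that] gm] by simp
  have X1X: "X1 \<le> X" "1 \<le> X" "0 < X1" "0 < X"
  proof -
    have "1 * X1 \<le> (1 + \<eta>) * X1" using pos by (intro mult_right_mono) auto
    thus "X1 \<le> X" using pos(5) by linarith
    thus "1 \<le> X" "0 < X1" "0 < X" using pos(4) by linarith+
  qed
  define S where "S = (\<integral>\<^sup>+\<kappa>. (\<integral>\<^sup>+x. ennreal (g x ((1 + \<kappa>) * \<delta> * x)) * indicator {X1..X} x \<partial>lborel) * indicator {0<..\<eta>} \<kappa> \<partial>lborel)"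
  have S_up: "S \<le> ennreal (\<eta> * U)"
  proof -
    have "S \<le> (\<integral>\<^sup>+\<kappa>. ennreal U * indicator {0<..\<eta>} \<kappa> \<partial>lborel)" unfolding S_def
      using ray_up by (intro nn_integral_mono) (auto simp: indicator_def)
    also have "\<dots> = ennreal (\<eta> * U)" using pos by (subst nn_integral_cmult_indicator) (auto simp: ennreal_mult mult.commute)
    finally show ?thesis .
  qed
  have S_lo: "ennreal (\<eta> * V) \<le> S"
  proof -
    have "ennreal (\<eta> * V) = (\<integral>\<^sup>+\<kappa>. ennreal V * indicator {0<..\<eta>} \<kappa> \<partial>lborel)"
      using pos by (subst nn_integral_cmult_indicator) (auto simp: ennreal_mult'' mult.commute)
    also have "\<dots> \<le> S" unfolding S_def
      using ray_lo by (intro nn_integral_mono) (auto simp: indicator_def)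
    finally show ?thesis .
  qed
  \<comment> \<open>The integrand after the substitution: 1 / x is the Jacobian, and 0 < \<kappa>
    \<le> \<eta> has become x < y \<le> (1 + \<eta>) x.\<close>
  define J where "J x y = ennreal (g x (\<delta> * y)) * indicator {X1..X} x * (ennreal (1 / x) * indicator {x<..(1 + \<eta>) * x} y)" for x y
  have Jm[measurable]: "(\<lambda>z. J (fst z) (snd z)) \<in> borel_measurable (borel \<Otimes>\<^sub>M borel)"
  proof -
    have 1: "indicator {fst z<..(1 + \<eta>) * fst z} (snd z) = (if fst z < snd z \<and> snd z \<le> (1 + \<eta>) * fst z then 1 else (0::ennreal))" for z :: "real \<times> real"
      by (auto simp: indicator_def)
    show ?thesis unfolding J_def 1 by measurable
  qed
  have [measurable]: "(\<lambda>z. J (p z) (q z)) \<in> borel_measurable M" if "p \<in> borel_measurable M" "q \<in> borel_measurable M" for p q :: "'z \<Rightarrow> real" and M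
    using measurable_compose[OF measurable_Pair[OF that] Jm] by simp
  have "S = (\<integral>\<^sup>+\<kappa>. (\<integral>\<^sup>+x. ennreal (g x ((1 + \<kappa>) * \<delta> * x)) * indicator {X1..X} x * indicator {0<..\<eta>} \<kappa> \<partial>lborel) \<partial>lborel)"
    unfolding S_def by (intro nn_integral_cong nn_integral_multc[symmetric]) measurable
  also have "\<dots> = (\<integral>\<^sup>+x. (\<integral>\<^sup>+\<kappa>. ennreal (g x ((1 + \<kappa>) * \<delta> * x)) * indicator {X1..X} x * indicator {0<..\<eta>} \<kappa> \<partial>lborel) \<partial>lborel)"
    by (rule lborel_pair.Fubini') measurable
  also have "\<dots> = (\<integral>\<^sup>+x. (\<integral>\<^sup>+y. J x y \<partial>lborel) \<partial>lborel)"
  proof (rule nn_integral_cong)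
    fix x :: real
    show "(\<integral>\<^sup>+\<kappa>. ennreal (g x ((1 + \<kappa>) * \<delta> * x)) * indicator {X1..X} x * indicator {0<..\<eta>} \<kappa> \<partial>lborel) = (\<integral>\<^sup>+y. J x y \<partial>lborel)"
    proof (cases "x \<in> {X1..X}")
      case True
      hence x: "0 < x" using X1X by auto
      have "(\<integral>\<^sup>+\<kappa>. ennreal (g x ((1 + \<kappa>) * \<delta> * x)) * indicator {X1..X} x * indicator {0<..\<eta>} \<kappa> \<partial>lborel)
          = ennreal \<bar>1 / x\<bar> * (\<integral>\<^sup>+y. ennreal (g x ((1 + (-1 + 1 / x * y)) * \<delta> * x)) * indicator {X1..X} x * indicator {0<..\<eta>} (-1 + 1 / x * y) \<partial>lborel)"
        using x by (intro nn_integral_real_affine) auto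
      also have "\<dots> = (\<integral>\<^sup>+y. ennreal \<bar>1 / x\<bar> * (ennreal (g x ((1 + (-1 + 1 / x * y)) * \<delta> * x)) * indicator {X1..X} x * indicator {0<..\<eta>} (-1 + 1 / x * y)) \<partial>lborel)"
        by (intro nn_integral_cmult[symmetric]) measurable
      also have "\<dots> = (\<integral>\<^sup>+y. J x y \<partial>lborel)"
      proof (intro nn_integral_cong)
        fix y :: real
        have 1: "(1 + (-1 + 1 / x * y)) * \<delta> * x = \<delta> * y" using x by (simp add: field_simps)
        have 2: "(-1 + 1 / x * y \<in> {0<..\<eta>}) = (y \<in> {x<..(1 + \<eta>) * x})" using x by (auto simp: field_simps)
        show "ennreal \<bar>1 / x\<bar> * (ennreal (g x ((1 + (-1 + 1 / x * y)) * \<delta> * x)) * indicator {X1..X} x * indicator {0<..\<eta>} (-1 + 1 / x * y)) = J x y"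
          unfolding 1 J_def indicator_def 2 using x by (simp add: mult_ac)
      qed
      finally show ?thesis .
    qed (simp add: J_def)
  qed
  also have "\<dots> = (\<integral>\<^sup>+y. (\<integral>\<^sup>+x. J x y \<partial>lborel) \<partial>lborel)"
    by (rule lborel_pair.Fubini') measurable
  finally have SJ: "S = (\<integral>\<^sup>+y. (\<integral>\<^sup>+x. J x y \<partial>lborel) \<partial>lborel)" .
  define D where "D y = (\<integral>\<^sup>+x. ennreal (g x (\<delta> * y)) * indicator {y / (1 + \<eta>)..y} x \<partial>lborel)" for y
  define Q where "Q = E * \<delta> * (2 * X) powr (2 - c) * ln (2 * X)"
  have Q0: "0 \<le> Q" unfolding Q_def using pos X1X by (intro mult_nonneg_nonneg) auto
  have powy: "y powr (2 - c) / y = y powr (1 - c)" if "0 < y" for y :: real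
    using that by (simp add: powr_diff power2_eq_square field_simps)
  \<comment> \<open>Since c \<le> 2, y^(2-c) is at most (2 X)^(2-c), and 1 / y remains to be
    integrated. The logarithm costs nothing later, and c = 2 is no special case.\<close>
  have Qint: "(\<integral>\<^sup>+y. ennreal (E * \<delta> * y powr (1 - c)) * indicator {p..q} y \<partial>lborel) \<le> ennreal Q"
    if "1 \<le> p" "q \<le> 2 * X" for p q
  proof -
    have "(\<integral>\<^sup>+y. ennreal (E * \<delta> * y powr (1 - c)) * indicator {p..q} y \<partial>lborel)
        \<le> (\<integral>\<^sup>+y. ennreal (E * \<delta> * (2 * X) powr (2 - c) * (1 / y)) * indicator {1..2*X} y \<partial>lborel)"
    proof (intro nn_integral_mono)
      fix y :: real
      show "ennreal (E * \<delta> * y powr (1 - c)) * indicator {p..q} y \<le> ennreal (E * \<delta> * (2 * X) powr (2 - c) * (1 / y)) * indicator {1..2*X} y"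
      proof (cases "y \<in> {p..q}")
        case True
        hence y: "1 \<le> y" "y \<le> 2 * X" using that by auto
        have "y powr (2 - c) / y \<le> (2 * X) powr (2 - c) / y" using y assms(7) by (intro divide_right_mono powr_mono2) auto
        hence "E * \<delta> * y powr (1 - c) \<le> E * \<delta> * ((2 * X) powr (2 - c) / y)"
          using y pos powy[of y] by (intro mult_left_mono) auto
        hence "ennreal (E * \<delta> * y powr (1 - c)) \<le> ennreal (E * \<delta> * (2 * X) powr (2 - c) * (1 / y))"
          by (intro ennreal_leI) (simp add: mult.assoc)
        thus ?thesis using True y by simp
      qed simp
    qed
    also have "\<dots> = ennreal (E * \<delta> * (2 * X) powr (2 - c) * ln (2 * X) - E * \<delta> * (2 * X) powr (2 - c) * ln 1)"
      using pos X1X by (intro nn_integral_FTC_Icc) (auto intro!: derivative_eq_intros divide_nonneg_pos)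
    finally show ?thesis by (simp add: Q_def)
  qed
  have lin: "(\<integral>\<^sup>+y. ennreal (\<delta> * y * A) * indicator {p..q} y \<partial>lborel) = ennreal (\<delta> * A * (q\<^sup>2 - p\<^sup>2) / 2)"
    if "0 \<le> p" "p \<le> q" for p q
  proof -
    have "(\<integral>\<^sup>+y. ennreal (\<delta> * y * A) * indicator {p..q} y \<partial>lborel) = ennreal (\<delta> * A * q\<^sup>2 / 2 - \<delta> * A * p\<^sup>2 / 2)"
      using pos that by (intro nn_integral_FTC_Icc) (auto intro!: derivative_eq_intros mult_nonneg_nonneg)
    thus ?thesis by (simp add: algebra_simps diff_divide_distrib)
  qed
  have \<eta>1: "0 < 1 + \<eta>" using pos by simp
  \<comment> \<open>For the upper bound the slices are not cut at X1 and X, and 1 / x is at most (1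
    + \<eta>) / y on the slice; this is the origin of the outer factor 1 + \<eta>.\<close>
  have up: "S \<le> ennreal ((1 + \<eta>) * (\<delta> * A * ((1 + \<eta>) * X)\<^sup>2 / 2 + Q))"
  proof -
    have X2: "(1 + \<eta>) * X \<le> 2 * X" "X1 \<le> (1 + \<eta>) * X"
    proof -
      have "1 * X \<le> (1 + \<eta>) * X" "(1 + \<eta>) * X \<le> 2 * X" using pos(2,3) X1X by (auto intro!: mult_right_mono)
      thus "(1 + \<eta>) * X \<le> 2 * X" "X1 \<le> (1 + \<eta>) * X" using X1X by linarith+
    qed
    have "S \<le> (\<integral>\<^sup>+y. ennreal (1 + \<eta>) * (ennreal (\<delta> * y * A) * indicator {X1..(1 + \<eta>) * X} y + ennreal (E * \<delta> * y powr (1 - c)) * indicator {X1..(1 + \<eta>) * X} y) \<partial>lborel)"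
      unfolding SJ
    proof (intro nn_integral_mono)
      fix y :: real
      show "(\<integral>\<^sup>+x. J x y \<partial>lborel) \<le> ennreal (1 + \<eta>) * (ennreal (\<delta> * y * A) * indicator {X1..(1 + \<eta>) * X} y + ennreal (E * \<delta> * y powr (1 - c)) * indicator {X1..(1 + \<eta>) * X} y)"
      proof (cases "y \<in> {X1..(1 + \<eta>) * X}")
        case False
        have "J x y = 0" for x
        proof (rule ccontr)
          assume "J x y \<noteq> 0"
          hence *: "X1 \<le> x" "x \<le> X" "x < y" "y \<le> (1 + \<eta>) * x" by (auto simp: J_def indicator_def split: if_splits)
          have "(1 + \<eta>) * x \<le> (1 + \<eta>) * X" using * \<eta>1 by (intro mult_left_mono) auto
          thus False using False * by auto
        qed
        thus ?thesis by simp
      next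
        case True
        hence y: "0 < y" "1 \<le> y" using X1X pos by auto
        have "(\<integral>\<^sup>+x. J x y \<partial>lborel) \<le> (\<integral>\<^sup>+x. ennreal ((1 + \<eta>) / y) * (ennreal (g x (\<delta> * y)) * indicator {y / (1 + \<eta>)..y} x) \<partial>lborel)"
        proof (intro nn_integral_mono)
          fix x :: real
          show "J x y \<le> ennreal ((1 + \<eta>) / y) * (ennreal (g x (\<delta> * y)) * indicator {y / (1 + \<eta>)..y} x)"
          proof (cases "X1 \<le> x \<and> x \<le> X \<and> x < y \<and> y \<le> (1 + \<eta>) * x")
            case t: True
            hence x: "0 < x" using X1X by auto
            have xr: "x \<in> {y / (1 + \<eta>)..y}" using t \<eta>1 by (auto simp: field_simps)
            have "1 / x \<le> (1 + \<eta>) / y" using t x y by (simp add: field_simps)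
            hence "ennreal (1 / x) * ennreal (g x (\<delta> * y)) \<le> ennreal ((1 + \<eta>) / y) * ennreal (g x (\<delta> * y))"
              by (intro mult_right_mono ennreal_leI) auto
            thus ?thesis using t xr by (simp add: J_def indicator_def mult_ac)
          next
            case f: False
            hence "J x y = 0" by (auto simp: J_def indicator_def)
            thus ?thesis by simp
          qed
        qed
        also have "\<dots> = ennreal ((1 + \<eta>) / y) * D y" unfolding D_def by (intro nn_integral_cmult) measurable
        also have "\<dots> \<le> ennreal ((1 + \<eta>) / y) * ennreal (\<delta> * y\<^sup>2 * A + E * \<delta> * y powr (2 - c))"
          unfolding D_def using True by (intro mult_left_mono hor_up) auto
        also have "\<dots> = ennreal ((1 + \<eta>) * (\<delta> * y * A + E * \<delta> * y powr (1 - c)))"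
        proof -
          have "(1 + \<eta>) / y * (\<delta> * y\<^sup>2 * A + E * \<delta> * y powr (2 - c)) = (1 + \<eta>) * (\<delta> * (y\<^sup>2 / y) * A + E * \<delta> * (y powr (2 - c) / y))"
            using y by (simp add: add_divide_distrib algebra_simps)
          also have "y\<^sup>2 / y = y" using y by (simp add: power2_eq_square)
          finally show ?thesis using y pos \<eta>1 powy[OF y(1)] by (subst ennreal_mult[symmetric]) auto
        qed
        also have "\<dots> = ennreal (1 + \<eta>) * (ennreal (\<delta> * y * A) + ennreal (E * \<delta> * y powr (1 - c)))"
          using y pos \<eta>1 by (simp add: ennreal_mult)
        finally show ?thesis using True by simp
      qed
    qed
    also have "\<dots> = ennreal (1 + \<eta>) * ((\<integral>\<^sup>+y. ennreal (\<delta> * y * A) * indicator {X1..(1 + \<eta>) * X} y \<partial>lborel) + (\<integral>\<^sup>+y. ennreal (E * \<delta> * y powr (1 - c)) * indicator {X1..(1 + \<eta>) * X} y \<partial>lborel))"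
      by (subst nn_integral_cmult) (auto intro!: arg_cong2[where f = "(*)"] nn_integral_add)
    also have "\<dots> \<le> ennreal (1 + \<eta>) * (ennreal (\<delta> * A * (((1 + \<eta>) * X)\<^sup>2 - X1\<^sup>2) / 2) + ennreal Q)"
      using pos X1X X2 by (intro mult_left_mono add_mono Qint order.eq_iff[THEN iffD1, OF lin, THEN conjunct1]) auto
    also have "\<dots> \<le> ennreal (1 + \<eta>) * (ennreal (\<delta> * A * ((1 + \<eta>) * X)\<^sup>2 / 2) + ennreal Q)"
      using pos by (intro mult_left_mono add_mono ennreal_leI divide_right_mono) auto
    also have "\<dots> = ennreal ((1 + \<eta>) * (\<delta> * A * ((1 + \<eta>) * X)\<^sup>2 / 2 + Q))"
      using pos Q0 by (simp add: ennreal_mult)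
    finally show ?thesis .
  qed
  have "ennreal (\<eta> * V) \<le> ennreal ((1 + \<eta>) * (\<delta> * A * ((1 + \<eta>) * X)\<^sup>2 / 2 + Q))" using S_lo up by (rule order_trans)
  moreover have "0 \<le> (1 + \<eta>) * (\<delta> * A * ((1 + \<eta>) * X)\<^sup>2 / 2 + Q)" using pos Q0 by (intro mult_nonneg_nonneg add_nonneg_nonneg divide_nonneg_nonneg) auto
  ultimately show "\<eta> * V \<le> (1 + \<eta>) * (\<delta> * A * ((1 + \<eta>) * X)\<^sup>2 / 2 + E * \<delta> * (2 * X) powr (2 - c) * ln (2 * X))"
    unfolding Q_def[symmetric] by (simp add: ennreal_le_iff)
  \<comment> \<open>For the lower bound y is restricted to [(1 + \<eta>) X1, X], so that the whole
    slice from y / (1 + \<eta>) to y lies between X1 and X. There 1 / x is at least 1 / y.\<close>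
  have "ennreal (\<delta> * A * (X\<^sup>2 - ((1 + \<eta>) * X1)\<^sup>2) / 2) = (\<integral>\<^sup>+y. ennreal (\<delta> * y * A) * indicator {(1 + \<eta>) * X1..X} y \<partial>lborel)"
    using pos by (intro lin[symmetric]) auto
  also have "\<dots> \<le> (\<integral>\<^sup>+y. (\<integral>\<^sup>+x. J x y \<partial>lborel) + ennreal (E * \<delta> * y powr (1 - c)) * indicator {(1 + \<eta>) * X1..X} y \<partial>lborel)"
  proof (intro nn_integral_mono)
    fix y :: real
    show "ennreal (\<delta> * y * A) * indicator {(1 + \<eta>) * X1..X} y \<le> (\<integral>\<^sup>+x. J x y \<partial>lborel) + ennreal (E * \<delta> * y powr (1 - c)) * indicator {(1 + \<eta>) * X1..X} y"
    proof (cases "y \<in> {(1 + \<eta>) * X1..X}")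
      case True
      have "1 * X1 \<le> (1 + \<eta>) * X1" "1 * X \<le> (1 + \<eta>) * X" using pos X1X by (auto intro!: mult_right_mono)
      moreover have "(1 + \<eta>) * X1 \<le> y" "y \<le> X" using True by auto
      ultimately have y: "0 < y" "1 \<le> y" "X1 \<le> y" "y \<le> (1 + \<eta>) * X" using X1X pos(4) by linarith+
      have "ennreal (\<delta> * y * A) = ennreal (1 / y) * ennreal (\<delta> * y\<^sup>2 * A)"
        using y pos by (subst ennreal_mult[symmetric]) (auto simp: power2_eq_square)
      also have "\<dots> \<le> ennreal (1 / y) * (D y + ennreal (E * \<delta> * y powr (2 - c)))"
        unfolding D_def using y by (intro mult_left_mono hor_lo) auto
      also have "\<dots> = ennreal (1 / y) * D y + ennreal (E * \<delta> * y powr (1 - c))"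
        using y pos powy[OF y(1)] by (simp add: distrib_left ennreal_mult[symmetric] mult.commute[of "1/y"] flip: times_divide_eq_right)
      also have "ennreal (1 / y) * D y = (\<integral>\<^sup>+x. ennreal (1 / y) * (ennreal (g x (\<delta> * y)) * indicator {y / (1 + \<eta>)..y} x) \<partial>lborel)"
        unfolding D_def by (intro nn_integral_cmult[symmetric]) measurable
      also have "\<dots> \<le> (\<integral>\<^sup>+x. J x y \<partial>lborel)"
      proof (rule nn_integral_mono_AE)
        \<comment> \<open>The slice is closed at x = y, whereas \<open>J\<close> requires x <
          y.\<close>
        have "AE x in lborel. x \<noteq> y" by (rule AE_lborel_singleton)
        thus "AE x in lborel. ennreal (1 / y) * (ennreal (g x (\<delta> * y)) * indicator {y / (1 + \<eta>)..y} x) \<le> J x y"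
        proof eventually_elim
          case (elim x)
          show ?case
          proof (cases "x \<in> {y / (1 + \<eta>)..y}")
            case xr: True
            have "X1 \<le> y / (1 + \<eta>)" using True \<eta>1 by (simp add: field_simps)
            moreover have xy: "y / (1 + \<eta>) \<le> x" "x \<le> y" "y \<le> X" using xr True by auto
            moreover have "y \<le> (1 + \<eta>) * x" using xy(1) \<eta>1 by (simp add: field_simps)
            ultimately have x: "X1 \<le> x" "0 < x" "x \<le> X" "x < y" "y \<le> (1 + \<eta>) * x" using elim X1X by linarith+
            have "1 / y \<le> 1 / x" using x y by (simp add: field_simps)
            hence "ennreal (1 / y) * ennreal (g x (\<delta> * y)) \<le> ennreal (1 / x) * ennreal (g x (\<delta> * y))"
              by (intro mult_right_mono ennreal_leI) auto
            thus ?thesis using x xr by (simp add: J_def indicator_def mult_ac)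
          qed simp
        qed
      qed
      finally show ?thesis using True by simp
    qed simp
  qed
  also have "\<dots> = S + (\<integral>\<^sup>+y. ennreal (E * \<delta> * y powr (1 - c)) * indicator {(1 + \<eta>) * X1..X} y \<partial>lborel)"
    unfolding SJ by (intro nn_integral_add) measurable
  also have "\<dots> \<le> ennreal (\<eta> * U) + ennreal Q"
  proof (intro add_mono S_up Qint)
    have "1 * 1 \<le> (1 + \<eta>) * X1" using pos by (intro mult_mono) auto
    thus "1 \<le> (1 + \<eta>) * X1" by simp
  qed (use X1X in auto)
  also have "\<dots> = ennreal (\<eta> * U + Q)" using pos Q0 by (subst ennreal_plus) auto
  finally show "\<delta> * A * (X\<^sup>2 - ((1 + \<eta>) * X1)\<^sup>2) / 2 \<le> \<eta> * U + E * \<delta> * (2 * X) powr (2 - c) * ln (2 * X)"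
    unfolding Q_def[symmetric] using pos Q0 by (subst (asm) ennreal_le_iff) auto
qed

section \<open>Mean square bound under GRH\<close>

text \<open>In the application h = - G'/G, which is holomorphic for Re s > 1/2: under GRH there are
  no zeros, and the pole of F has been multiplied away. Moving the line from 4 to \<sigma> therefore
  meets no residue, and the main term comes from the explicit m / (s - 1) in \<open>h4\<close>. With
  \<kappa> < 1 the decay |t|^(\<kappa>-2) is integrable.\<close>

lemma explicit_formula:
  assumes hol: "h holomorphic_on {s. 1/2 < Re s}"
    and bound: "\<And>s. \<sigma> \<le> Re s \<Longrightarrow> Re s \<le> 4 \<Longrightarrow> cmod (h s) \<le> C * (1 + \<bar>Im s\<bar>) powr \<kappa>"
    and \<sigma>: "1/2 < \<sigma>" "\<sigma> \<le> 1" and \<kappa>: "\<kappa> < 1" and C: "0 \<le> C"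
    and h4: "\<And>t. h (Complex 4 t) = (\<Sum>n. Lam n / of_nat n powr Complex 4 t) - of_nat m / (Complex 4 t - 1)"
    and sm: "summable (\<lambda>n. norm (Lam n / of_nat n powr 4))" and u: "0 \<le> u"
  shows "integrable lborel (\<lambda>t. h (Complex \<sigma> t) * exp (of_real u * Complex \<sigma> t) / (Complex \<sigma> t)\<^sup>2)"
    and "(LINT t|lborel. h (Complex \<sigma> t) * exp (of_real u * Complex \<sigma> t) / (Complex \<sigma> t)\<^sup>2)
      = of_real (2 * pi) * (riesz_sum Lam u - of_nat m * of_real (exp u - 1 - u))"
proof -
  define \<phi> where "\<phi> s = h s * exp (of_real u * s) / s\<^sup>2" for s
  have \<phi>h: "\<phi> holomorphic_on {s. 1/2 < Re s}" unfolding \<phi>_def by (intro holomorphic_intros hol) auto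
  have alg: "(S - M / k) * D / q = S * D / q - M * (D / (q * k))" for S M k D q :: complex
    by (simp add: left_diff_distrib diff_divide_distrib)
  have e4: "(\<lambda>t. \<phi> (Complex 4 t)) = (\<lambda>t. (\<Sum>n. Lam n / of_nat n powr Complex 4 t) * exp (of_real u * Complex 4 t) / (Complex 4 t)\<^sup>2
      - of_nat m * (exp (of_real u * Complex 4 t) / ((Complex 4 t)\<^sup>2 * (Complex 4 t - 1))))"
    unfolding \<phi>_def h4 by (intro ext alg)
  note i1 = riesz_sum_integral(1)[OF sm, of u] and i2 = integrable_mult_right[OF integral_exp_over_square_pole(1)[OF u], of "of_nat m"]
  have int4: "integrable lborel (\<lambda>t. \<phi> (Complex 4 t))" unfolding e4 by (rule Bochner_Integration.integrable_diff[OF i1 i2])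
  have v4: "(LINT t|lborel. \<phi> (Complex 4 t)) = of_real (2 * pi) * (riesz_sum Lam u - of_nat m * of_real (exp u - 1 - u))"
    unfolding e4 Bochner_Integration.integral_diff[OF i1 i2] integral_mult_right_zero riesz_sum_integral(2)[OF sm] integral_exp_over_square_pole(2)[OF u]
    by (simp add: algebra_simps)
  have \<phi>b: "cmod (\<phi> (Complex \<rho> t)) \<le> C * exp (u * 4) * 9 * (1 + \<bar>t\<bar>) powr (\<kappa> - 2)" if "\<sigma> \<le> \<rho>" "\<rho> \<le> 4" for \<rho> t
  proof -
    have "cmod (\<phi> (Complex \<rho> t)) = cmod (h (Complex \<rho> t)) * exp (u * \<rho>) * (1 / cmod (Complex \<rho> t))\<^sup>2"
      by (simp add: \<phi>_def norm_mult norm_divide norm_power power_divide)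
    also have "\<dots> \<le> (C * (1 + \<bar>t\<bar>) powr \<kappa>) * exp (u * 4) * (3 / (1 + \<bar>t\<bar>))\<^sup>2"
      using bound[of "Complex \<rho> t"] that inverse_cmod_Complex_le[of \<rho> t] \<sigma> u C
      by (intro mult_mono power_mono mult_nonneg_nonneg) (auto intro: mult_left_mono)
    also have "\<dots> = C * exp (u * 4) * 9 * ((1 + \<bar>t\<bar>) powr \<kappa> / (1 + \<bar>t\<bar>)\<^sup>2)" by (simp add: power_divide mult_ac)
    also have "(1 + \<bar>t\<bar>) powr \<kappa> / (1 + \<bar>t\<bar>)\<^sup>2 = (1 + \<bar>t\<bar>) powr (\<kappa> - 2)" by (simp add: powr_diff)
    finally show ?thesis .
  qed
  have int\<sigma>: "integrable lborel (\<lambda>t. \<phi> (Complex \<sigma> t))"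
  proof (rule integrable_vertical_line[OF \<phi>h])
    show "integrable lborel (\<lambda>t. C * exp (u * 4) * 9 * (1 + \<bar>t\<bar>) powr (\<kappa> - 2))"
      using integrable_mult_right[OF integrable_one_plus_abs_powr[of "2 - \<kappa>"], of "C * exp (u * 4) * 9"] \<kappa> by simp
  qed (use \<phi>b[of \<sigma>] \<sigma> in auto)
  thus "integrable lborel (\<lambda>t. h (Complex \<sigma> t) * exp (of_real u * Complex \<sigma> t) / (Complex \<sigma> t)\<^sup>2)" by (simp only: \<phi>_def)
  have "(LINT t|lborel. \<phi> (Complex \<sigma> t)) = (LINT t|lborel. \<phi> (Complex 4 t))"
  proof (rule vertical_integral_shift[OF \<phi>h _ _ _ _ _ _ int\<sigma> int4, where g = "\<lambda>t. C * exp (u * 4) * 9 * (1 + t) powr (\<kappa> - 2)"])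
    show "((\<lambda>t. C * exp (u * 4) * 9 * (1 + t) powr (\<kappa> - 2)) \<longlongrightarrow> 0) at_top" using \<kappa> by real_asymp
  qed (use \<phi>b \<sigma> open_halfspace_Re_gt[of "1/2"] convex_halfspace_Re_gt[of "1/2"] in auto)
  thus "(LINT t|lborel. h (Complex \<sigma> t) * exp (of_real u * Complex \<sigma> t) / (Complex \<sigma> t)\<^sup>2)
      = of_real (2 * pi) * (riesz_sum Lam u - of_nat m * of_real (exp u - 1 - u))" using v4 by (simp only: \<phi>_def)
qed

text \<open>For small \<nu> > 0 the integer part of exp (v + \<nu>) equals that of exp v, so the
  Riesz sum grows exactly linearly. To the left of the logarithm of an integer the slope may differ,
  hence the one-sided limit.\<close>

lemma riesz_sum_right_derivative:
  "((\<lambda>\<nu>. (riesz_sum Lam (v + \<nu>) - of_nat m * of_real (exp (v + \<nu>) - 1 - (v + \<nu>))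
      - (riesz_sum Lam v - of_nat m * of_real (exp v - 1 - v))) / of_real \<nu>)
    \<longlongrightarrow> psiF Lam (exp v) - of_nat m * of_real (exp v - 1)) (at_right 0)"
proof -
  have "((\<lambda>\<nu>. exp (v + \<nu>)) \<longlongrightarrow> exp (v + 0)) (at_right 0)" by (intro tendsto_intros)
  from order_tendstoD(2)[OF this, of "of_int \<lfloor>exp v\<rfloor> + 1"]
  have "\<forall>\<^sub>F \<nu> in at_right 0. exp (v + \<nu>) < of_int \<lfloor>exp v\<rfloor> + 1" by simp
  hence ev: "\<forall>\<^sub>F \<nu> in at_right 0. \<lfloor>exp (v + \<nu>)\<rfloor> = \<lfloor>exp v\<rfloor> \<and> 0 < \<nu>"
    using eventually_at_right_less[of "0::real"]
  proof eventually_elim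
    case (elim \<nu>)
    have "exp v \<le> exp (v + \<nu>)" using elim by simp
    moreover have "of_int \<lfloor>exp v\<rfloor> \<le> exp v" by simp
    ultimately have "of_int \<lfloor>exp v\<rfloor> \<le> exp (v + \<nu>)" by linarith
    thus ?case using elim floor_unique by blast
  qed
  have d: "((\<lambda>\<nu>. (exp (v + \<nu>) - exp v) / \<nu> - 1) \<longlongrightarrow> exp v - 1) (at_right 0)"
  proof -
    have "((\<lambda>\<nu>. (exp (v + \<nu>) - exp v) / \<nu>) \<longlongrightarrow> exp v) (at 0)" using DERIV_exp[of v] unfolding DERIV_def .
    thus ?thesis by (intro tendsto_intros) (rule tendsto_within_subset, auto)
  qed
  have "((\<lambda>\<nu>. psiF Lam (exp v) - of_nat m * of_real ((exp (v + \<nu>) - exp v) / \<nu> - 1)) \<longlongrightarrow> psiF Lam (exp v) - of_nat m * of_real (exp v - 1)) (at_right 0)"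
    by (intro tendsto_intros d)
  moreover have "\<forall>\<^sub>F \<nu> in at_right 0. psiF Lam (exp v) - of_nat m * of_real ((exp (v + \<nu>) - exp v) / \<nu> - 1) =
      (riesz_sum Lam (v + \<nu>) - of_nat m * of_real (exp (v + \<nu>) - 1 - (v + \<nu>))
      - (riesz_sum Lam v - of_nat m * of_real (exp v - 1 - v))) / of_real \<nu>"
    using ev
  proof eventually_elim
    case (elim \<nu>)
    have "riesz_sum Lam (v + \<nu>) = riesz_sum Lam v + of_real \<nu> * psiF Lam (exp v)"
      using elim by (simp add: riesz_sum_def psiF_def sum_distrib_left algebra_simps flip: sum.distrib)
    moreover have "complex_of_real ((exp (v + \<nu>) - exp v) / \<nu> - 1) = (of_real (exp (v + \<nu>) - exp v) - of_real \<nu>) / of_real \<nu>"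
      using elim by (simp add: diff_divide_distrib)
    ultimately show ?case using elim by (simp add: field_simps)
  qed
  ultimately show ?thesis by (rule Lim_transform_eventually)
qed

text \<open>The explicit formula is applied to a second difference of Riesz sums with steps ln (1 +
  \<theta>) and \<nu>. Dividing by \<nu> and letting \<nu> tend to 0 recovers f(exp u, \<theta> exp
  u); the mean square bounds are uniform in \<nu>, as Fatou's lemma requires.\<close>

lemma mean_square_bound_of_log_deriv:
  assumes hol: "h holomorphic_on {s. 1/2 < Re s}" and \<kappa>: "0 < \<kappa>" "\<kappa> \<le> 1/4"
    and bound: "\<And>s. 1/2 + \<kappa> \<le> Re s \<Longrightarrow> Re s \<le> 4 \<Longrightarrow> cmod (h s) \<le> C * (1 + \<bar>Im s\<bar>) powr \<kappa>" and C: "0 \<le> C"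
    and h4: "\<And>t. h (Complex 4 t) = (\<Sum>n. Lam n / of_nat n powr Complex 4 t) - of_nat m / (Complex 4 t - 1)"
    and sm: "summable (\<lambda>n. norm (Lam n / of_nat n powr 4))"
  shows "\<exists>K\<ge>0. \<forall>X \<theta>. 1 \<le> X \<and> 0 < \<theta> \<and> \<theta> \<le> 1 \<longrightarrow> VF Lam m X \<theta> \<le> K * X powr (2 + 2 * \<kappa>) * \<theta> powr (1 - 3 * \<kappa>)"
proof -
  define \<sigma> where "\<sigma> = 1/2 + \<kappa>"
  have \<sigma>: "1/2 < \<sigma>" "\<sigma> \<le> 1" "0 < \<sigma>" using \<kappa> by (auto simp: \<sigma>_def)
  define s where "s t = Complex \<sigma> t" for t
  define E1 where "E1 u = riesz_sum Lam u - of_nat m * of_real (exp u - 1 - u)" for u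
  define J where "J = (LINT t|lborel. (1 + \<bar>t\<bar>) powr (-(1 + \<kappa>)))"
  have Ji: "integrable lborel (\<lambda>t::real. (1 + \<bar>t\<bar>) powr (-(1 + \<kappa>)))" using \<kappa> by (intro integrable_one_plus_abs_powr) auto
  have J0: "0 \<le> J" unfolding J_def by simp
  define K where "K = 2 * pi * exp (1/2) * ((36 * C)\<^sup>2 * J)"
  have K0: "0 \<le> K" unfolding K_def using J0 by simp
  have snz: "s t \<noteq> 0" for t using \<sigma> by (auto simp: s_def complex_eq_iff)
  have es: "exp 1 \<le> (3::real)" using e_less_272 by simp
  have \<kappa>1: "\<kappa> < 1" using \<kappa> by simp
  have ef: "integrable lborel (\<lambda>t. h (s t) * exp (of_real v * s t) / (s t)\<^sup>2)"
    "(LINT t|lborel. h (s t) * exp (of_real v * s t) / (s t)\<^sup>2) = of_real (2 * pi) * E1 v" if "0 \<le> v" for v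
    unfolding s_def E1_def
    by (rule explicit_formula[OF hol _ \<sigma>(1,2) \<kappa>1 C h4 sm that], rule bound, simp add: \<sigma>_def, assumption)+
  have main: "(\<integral>\<^sup>+u. ennreal (4 * pi\<^sup>2 * exp (- 2 * \<sigma> * u) * sqdev Lam m (exp u) (\<theta> * exp u)) * indicator {0..L} u \<partial>lborel) \<le> ennreal (K * \<theta> powr (1 - 3 * \<kappa>))"
    if \<theta>: "0 < \<theta>" "\<theta> \<le> 1" and L: "0 < L" for \<theta> L
  proof -
    define \<tau> where "\<tau> = ln (1 + \<theta>)"
    have \<tau>: "0 < \<tau>" "\<tau> \<le> \<theta>" "exp \<tau> = 1 + \<theta>" using \<theta> ln_add_one_self_le_self[of \<theta>] by (auto simp: \<tau>_def)
    \<comment> \<open>Each factor exp (x z) - 1 stands for a difference with step x in u. The two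
      differences use up the weight 1 / z^2, and the last quotient is bounded uniformly in
      \<nu>.\<close>
    define A where "A \<nu> z = h z * ((exp (of_real \<tau> * z) - 1) / z) * ((exp (of_real \<nu> * z) - 1) / (of_real \<nu> * z))" for \<nu> :: real and z
    define a where "a \<nu> t = A \<nu> (s t)" for \<nu> t
    have Ah: "A \<nu> holomorphic_on {z. 1/2 < Re z}" if "0 < \<nu>" for \<nu>
      unfolding A_def using that by (intro holomorphic_intros hol) auto
    have hb: "cmod (h (s t)) \<le> C * (1 + \<bar>t\<bar>) powr \<kappa>" for t using bound[of "s t"] \<sigma> by (simp add: s_def \<sigma>_def)
    have exb: "cmod (exp (of_real x * s t) - 1) \<le> 3 * x * cmod (s t)" "cmod (exp (of_real x * s t) - 1) \<le> 4"
      if x: "0 < x" "x \<le> 1" for x t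
    proof -
      have xs: "x * \<sigma> \<le> 1" using mult_mono[OF x(2) \<sigma>(2)] x \<sigma> by simp
      have e3: "exp (x * \<sigma>) \<le> 3" using xs es by (meson exp_le_cancel_iff order_trans)
      have "cmod (exp (of_real x * s t) - 1) \<le> exp (x * \<sigma>) * cmod (of_real x * s t)"
        using x \<sigma> by (intro norm_exp_minus_1_le) (auto simp: s_def)
      also have "\<dots> \<le> 3 * cmod (of_real x * s t)" using e3 by (intro mult_right_mono) auto
      finally show "cmod (exp (of_real x * s t) - 1) \<le> 3 * x * cmod (s t)" using x by (simp add: norm_mult)
      have "cmod (exp (of_real x * s t) - 1) \<le> exp (x * \<sigma>) + 1"
        using norm_triangle_ineq4[of "exp (of_real x * s t)" 1] by (simp add: s_def)
      thus "cmod (exp (of_real x * s t) - 1) \<le> 4" using e3 by simp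
    qed
    have inv_s: "1 / cmod (s t) \<le> 3 / (1 + \<bar>t\<bar>)" for t using inverse_cmod_Complex_le[of \<sigma> t] \<sigma> by (simp add: s_def)
    have sp: "0 < cmod (s t)" for t using snz by simp
    have q1: "cmod ((exp (of_real x * s t) - 1) / s t) \<le> 3 * x" if "0 < x" "x \<le> 1" for x t
      using exb(1)[OF that, of t] sp[of t] by (simp add: norm_divide pos_divide_le_eq)
    have q2: "cmod ((exp (of_real x * s t) - 1) / s t) \<le> 12 * (1 / (1 + \<bar>t\<bar>))" if "0 < x" "x \<le> 1" for x t
    proof -
      have "cmod ((exp (of_real x * s t) - 1) / s t) = cmod (exp (of_real x * s t) - 1) * (1 / cmod (s t))" by (simp add: norm_divide)
      also have "\<dots> \<le> 4 * (3 / (1 + \<bar>t\<bar>))" using exb(2)[OF that, of t] inv_s[of t] by (intro mult_mono) auto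
      finally show ?thesis by simp
    qed
    have \<tau>1: "\<tau> \<le> 1" using \<tau> \<theta> by simp
    have q3: "cmod ((exp (of_real \<nu> * s t) - 1) / (of_real \<nu> * s t)) \<le> 3" if "0 < \<nu>" "\<nu> \<le> 1" for \<nu> t
      using exb(1)[OF that, of t] sp[of t] that by (simp add: norm_divide norm_mult pos_divide_le_eq mult_ac)
    have a2: "(cmod (a \<nu> t))\<^sup>2 \<le> (36 * C)\<^sup>2 * \<tau> powr (1 - 3 * \<kappa>) * (1 + \<bar>t\<bar>) powr (-(1 + \<kappa>))" if \<nu>: "0 < \<nu>" "\<nu> \<le> 1" for \<nu> t
    proof -
      define b where "b = 1 + \<bar>t\<bar>"
      have b: "0 < b" "1 \<le> b" by (auto simp: b_def)
      \<comment> \<open>Two bounds for the quotient with step \<tau> are combined: \<tau> is better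
        for small |t|, 1 / b for large |t|.\<close>
      define \<mu> where "\<mu> = min \<tau> (1 / b)"
      have \<mu>: "0 < \<mu>" "\<mu> \<le> \<tau>" "\<mu> \<le> 1 / b" using \<tau> b by (auto simp: \<mu>_def)
      have q: "cmod ((exp (of_real \<tau> * s t) - 1) / s t) \<le> 12 * \<mu>"
        using q1[OF \<tau>(1) \<tau>1, of t] q2[OF \<tau>(1) \<tau>1, of t] \<tau> by (auto simp: \<mu>_def b_def min_def)
      have "cmod (a \<nu> t) \<le> (C * b powr \<kappa>) * (12 * \<mu>) * 3"
        unfolding a_def A_def norm_mult
        using hb[of t] q q3[OF \<nu>, of t] C \<mu> unfolding b_def[symmetric]
        by (intro mult_mono mult_nonneg_nonneg) auto
      hence "(cmod (a \<nu> t))\<^sup>2 \<le> (36 * C * (b powr \<kappa> * \<mu>))\<^sup>2" by (intro power_mono) (auto simp: mult_ac)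
      also have "\<dots> = (36 * C)\<^sup>2 * (b powr (2 * \<kappa>) * \<mu>\<^sup>2)"
        using b by (simp add: power_mult_distrib powr_power mult.commute)
      \<comment> \<open>The factor \<mu>^(1+3\<kappa>) \<le> b^-(1+3\<kappa>) outweighs
        b^(2\<kappa>) and leaves the integrable b^-(1+\<kappa>), while \<mu>^(1-3\<kappa>) \<le>
        \<tau>^(1-3\<kappa>) keeps the saving in \<theta>. This is the source of the exponent 1 - 3
        \<kappa>.\<close>
      also have "\<mu>\<^sup>2 = \<mu> powr (1 - 3 * \<kappa>) * \<mu> powr (1 + 3 * \<kappa>)"
      proof -
        have "\<mu> powr (1 - 3 * \<kappa>) * \<mu> powr (1 + 3 * \<kappa>) = \<mu> powr 2" unfolding powr_add[symmetric] by simp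
        thus ?thesis using \<mu> by simp
      qed
      also have "(36 * C)\<^sup>2 * (b powr (2 * \<kappa>) * (\<mu> powr (1 - 3 * \<kappa>) * \<mu> powr (1 + 3 * \<kappa>)))
          \<le> (36 * C)\<^sup>2 * (b powr (2 * \<kappa>) * (\<tau> powr (1 - 3 * \<kappa>) * (1 / b) powr (1 + 3 * \<kappa>)))"
        using \<mu> \<kappa> by (intro mult_left_mono mult_mono powr_mono2) auto
      also have "(1 / b) powr (1 + 3 * \<kappa>) = b powr (-(1 + 3 * \<kappa>))" using b by (simp only: powr_minus_divide powr_divide) (simp add: powr_one_eq_one)
      also have "(36 * C)\<^sup>2 * (b powr (2 * \<kappa>) * (\<tau> powr (1 - 3 * \<kappa>) * b powr (-(1 + 3 * \<kappa>)))) = (36 * C)\<^sup>2 * \<tau> powr (1 - 3 * \<kappa>) * (b powr (2 * \<kappa>) * b powr (-(1 + 3 * \<kappa>)))"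
        by (simp only: mult_ac)
      also have "b powr (2 * \<kappa>) * b powr (-(1 + 3 * \<kappa>)) = b powr (-(1 + \<kappa>))" unfolding powr_add[symmetric] by (simp add: algebra_simps)
      finally show ?thesis by (simp only: b_def)
    qed
    have am: "a \<nu> \<in> borel_measurable borel" if "0 < \<nu>" for \<nu>
      unfolding a_def s_def using \<sigma>
      by (intro borel_measurable_continuous_onI continuous_on_vertical_line[OF Ah[OF that]]) auto
    have ai2: "integrable lborel (\<lambda>t. (cmod (a \<nu> t))\<^sup>2)" if \<nu>: "0 < \<nu>" "\<nu> \<le> 1" for \<nu>
    proof (rule Bochner_Integration.integrable_bound[OF integrable_mult_right[OF Ji, of "(36 * C)\<^sup>2 * \<tau> powr (1 - 3 * \<kappa>)"]])
      show "AE t in lborel. norm ((cmod (a \<nu> t))\<^sup>2) \<le> norm ((36 * C)\<^sup>2 * \<tau> powr (1 - 3 * \<kappa>) * (1 + \<bar>t\<bar>) powr (-(1 + \<kappa>)))"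
        using a2[OF \<nu>] by (intro AE_I2) simp
    qed (use am[OF \<nu>(1)] in simp)
    \<comment> \<open>The weight exp (- \<sigma> u) appears because iexp (u t) = exp (- \<sigma> u)
      exp (u s) for s = \<sigma> + i t.\<close>
    have diff: "integrable lborel (a \<nu>) \<and> (LINT t|lborel. a \<nu> t * iexp (u * t)) = of_real (exp (- \<sigma> * u)) * (of_real (2 * pi) * ((E1 (u + \<tau> + \<nu>) - E1 (u + \<tau>)) / of_real \<nu> - (E1 (u + \<nu>) - E1 u) / of_real \<nu>))"
      if \<nu>: "0 < \<nu>" and u: "0 \<le> u" for \<nu> u
    proof -
      define e where "e v t = h (s t) * exp (of_real v * s t) / (s t)\<^sup>2" for v t
      have ei: "integrable lborel (e v)" and ev: "(LINT t|lborel. e v t) = of_real (2 * pi) * E1 v" if "0 \<le> v" for v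
        unfolding e_def using ef[OF that] by blast+
      define c where "c v t = (e (v + \<tau> + \<nu>) t - e (v + \<tau>) t - (e (v + \<nu>) t - e v t)) / of_real \<nu>" for v t
      have ci: "integrable lborel (c v)" if "0 \<le> v" for v
        unfolding c_def using that \<tau> \<nu> by (intro integrable_divide Bochner_Integration.integrable_diff ei) auto
      have cv: "(LINT t|lborel. c v t) = of_real (2 * pi) * ((E1 (v + \<tau> + \<nu>) - E1 (v + \<tau>)) / of_real \<nu> - (E1 (v + \<nu>) - E1 v) / of_real \<nu>)" if "0 \<le> v" for v
      proof -
        have "(LINT t|lborel. c v t) = ((LINT t|lborel. e (v + \<tau> + \<nu>) t) - (LINT t|lborel. e (v + \<tau>) t) - ((LINT t|lborel. e (v + \<nu>) t) - (LINT t|lborel. e v t))) / of_real \<nu>"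
          unfolding c_def integral_divide_zero using that \<tau> \<nu> ei by (simp add: Bochner_Integration.integral_diff)
        moreover have "0 \<le> v + \<tau> + \<nu>" "0 \<le> v + \<tau>" "0 \<le> v + \<nu>" using that \<tau> \<nu> by auto
        moreover have "(p * x - p * y - (p * z - p * w)) / n = p * ((x - y) / n - (z - w) / n)" for p x y z w n :: complex
          by (simp add: right_diff_distrib diff_divide_distrib)
        ultimately show ?thesis using that by (simp only: ev)
      qed
      have ac: "a \<nu> t * exp (of_real v * s t) = c v t" for v t
      proof -
        have "c v t = h (s t) / (s t)\<^sup>2 * (exp (of_real v * s t) * (exp (of_real \<tau> * s t) - 1) * (exp (of_real \<nu> * s t) - 1)) / of_real \<nu>"
          unfolding c_def e_def by (simp add: exp_add algebra_simps add_divide_distrib diff_divide_distrib)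
        thus ?thesis unfolding a_def A_def by (simp add: power2_eq_square mult_ac)
      qed
      have "a \<nu> = c 0" using ac[of _ 0] by auto
      moreover have "(LINT t|lborel. a \<nu> t * iexp (u * t)) = of_real (exp (- \<sigma> * u)) * (LINT t|lborel. c u t)"
      proof -
        have "a \<nu> t * iexp (u * t) = of_real (exp (- \<sigma> * u)) * c u t" for t
        proof -
          have "iexp (u * t) = of_real (exp (- \<sigma> * u)) * exp (of_real u * s t)"
            unfolding s_def Complex_eq exp_of_real[symmetric] exp_add[symmetric] by (simp add: algebra_simps)
          thus ?thesis unfolding ac[symmetric] by simp
        qed
        thus ?thesis by (simp only: integral_mult_right_zero)
      qed
      ultimately show ?thesis using ci[of 0] cv[OF u] by simp
    qed
    define w where "w k u = ennreal ((cmod (LINT t|lborel. a (1 / real (Suc k)) t * iexp (u * t)))\<^sup>2) * indicator {0..L} u" for k u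
    have \<nu>k: "0 < 1 / real (Suc k)" "1 / real (Suc k) \<le> 1" for k by auto
    have wm: "w k \<in> borel_measurable lborel" for k
    proof -
      note [measurable] = am[OF \<nu>k(1)[of k]]
      show ?thesis unfolding w_def by measurable
    qed
    have wle: "(\<integral>\<^sup>+u. w k u \<partial>lborel) \<le> ennreal (K * \<theta> powr (1 - 3 * \<kappa>))" for k
    proof -
      define \<nu> where "\<nu> = 1 / real (Suc k)"
      have \<nu>: "0 < \<nu>" "\<nu> \<le> 1" using \<nu>k[of k] by (auto simp: \<nu>_def)
      have ai: "integrable lborel (a \<nu>)" using diff[OF \<nu>(1), of 0] by simp
      note L2 = L2_fourier_bound[OF ai ai2[OF \<nu>] L]
      have "(\<integral>\<^sup>+u. w k u \<partial>lborel) \<le> (\<integral>\<^sup>+u. ennreal (indicat_real {-L..L} u *\<^sub>R (cmod (LINT t|lborel. a \<nu> t * iexp (u * t)))\<^sup>2) \<partial>lborel)"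
        unfolding w_def \<nu>_def[symmetric] by (intro nn_integral_mono) (auto simp: indicator_def)
      also have "\<dots> = ennreal (LINT u:{-L..L}|lborel. (cmod (LINT t|lborel. a \<nu> t * iexp (u * t)))\<^sup>2)"
        unfolding set_lebesgue_integral_def using L2(1)[unfolded set_integrable_def]
        by (intro nn_integral_eq_integral) auto
      also have "\<dots> \<le> ennreal (K * \<theta> powr (1 - 3 * \<kappa>))"
      proof (rule ennreal_leI)
        have "(LINT t|lborel. (cmod (a \<nu> t))\<^sup>2) \<le> (LINT t|lborel. (36 * C)\<^sup>2 * \<tau> powr (1 - 3 * \<kappa>) * (1 + \<bar>t\<bar>) powr (-(1 + \<kappa>)))"
          by (intro integral_mono ai2[OF \<nu>] integrable_mult_right Ji a2[OF \<nu>])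
        also have "\<dots> = (36 * C)\<^sup>2 * \<tau> powr (1 - 3 * \<kappa>) * J" unfolding J_def by (rule integral_mult_right_zero)
        also have "\<dots> \<le> (36 * C)\<^sup>2 * \<theta> powr (1 - 3 * \<kappa>) * J"
          using \<tau> \<kappa> J0 by (intro mult_right_mono mult_left_mono powr_mono2) auto
        finally have "2 * pi * exp (1/2) * (LINT t|lborel. (cmod (a \<nu> t))\<^sup>2) \<le> 2 * pi * exp (1/2) * ((36 * C)\<^sup>2 * \<theta> powr (1 - 3 * \<kappa>) * J)"
          by (intro mult_left_mono) auto
        also have "\<dots> = K * \<theta> powr (1 - 3 * \<kappa>)" unfolding K_def by (simp only: mult_ac)
        finally show "(LINT u:{-L..L}|lborel. (cmod (LINT t|lborel. a \<nu> t * iexp (u * t)))\<^sup>2) \<le> K * \<theta> powr (1 - 3 * \<kappa>)"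
          by (rule order_trans[OF L2(2)])
      qed
      finally show ?thesis .
    qed
    have "(\<integral>\<^sup>+u. ennreal (4 * pi\<^sup>2 * exp (- 2 * \<sigma> * u) * sqdev Lam m (exp u) (\<theta> * exp u)) * indicator {0..L} u \<partial>lborel) = (\<integral>\<^sup>+u. liminf (\<lambda>k. w k u) \<partial>lborel)"
    proof (intro nn_integral_cong)
      fix u :: real
      show "ennreal (4 * pi\<^sup>2 * exp (- 2 * \<sigma> * u) * sqdev Lam m (exp u) (\<theta> * exp u)) * indicator {0..L} u = liminf (\<lambda>k. w k u)"
      proof (cases "u \<in> {0..L}")
        case True
        hence u: "0 \<le> u" by simp
        have fl: "filterlim (\<lambda>k. 1 / real (Suc k)) (at_right 0) sequentially" by real_asymp
        note rd = filterlim_compose[OF riesz_sum_right_derivative[of Lam _ m] fl, folded E1_def]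
        have "(\<lambda>k. (E1 (u + \<tau> + 1 / real (Suc k)) - E1 (u + \<tau>)) / of_real (1 / real (Suc k)) - (E1 (u + 1 / real (Suc k)) - E1 u) / of_real (1 / real (Suc k)))
            \<longlonglongrightarrow> (psiF Lam (exp (u + \<tau>)) - of_nat m * of_real (exp (u + \<tau>) - 1)) - (psiF Lam (exp u) - of_nat m * of_real (exp u - 1))"
          by (intro tendsto_diff rd)
        also have "(psiF Lam (exp (u + \<tau>)) - of_nat m * of_real (exp (u + \<tau>) - 1)) - (psiF Lam (exp u) - of_nat m * of_real (exp u - 1))
            = psiF Lam (exp u + \<theta> * exp u) - psiF Lam (exp u) - of_nat m * of_real (\<theta> * exp u)"
        proof -
          have "exp (u + \<tau>) = exp u + \<theta> * exp u" using \<tau>(3) by (simp add: exp_add algebra_simps)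
          thus ?thesis by (simp add: algebra_simps)
        qed
        finally have "(\<lambda>k. (cmod (of_real (exp (- \<sigma> * u)) * (of_real (2 * pi) * ((E1 (u + \<tau> + 1 / real (Suc k)) - E1 (u + \<tau>)) / of_real (1 / real (Suc k)) - (E1 (u + 1 / real (Suc k)) - E1 u) / of_real (1 / real (Suc k))))))\<^sup>2)
            \<longlonglongrightarrow> (cmod (of_real (exp (- \<sigma> * u)) * (of_real (2 * pi) * (psiF Lam (exp u + \<theta> * exp u) - psiF Lam (exp u) - of_nat m * of_real (\<theta> * exp u)))))\<^sup>2"
          by (intro tendsto_power tendsto_norm tendsto_mult_left)
        also have "(cmod (of_real (exp (- \<sigma> * u)) * (of_real (2 * pi) * (psiF Lam (exp u + \<theta> * exp u) - psiF Lam (exp u) - of_nat m * of_real (\<theta> * exp u)))))\<^sup>2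
            = 4 * pi\<^sup>2 * exp (- 2 * \<sigma> * u) * sqdev Lam m (exp u) (\<theta> * exp u)"
        proof -
          have "(exp (- \<sigma> * u))\<^sup>2 = exp (- 2 * \<sigma> * u)" by (simp add: power2_eq_square exp_add[symmetric])
          thus ?thesis unfolding norm_mult norm_of_real power_mult_distrib sqdev_def by (simp add: mult_ac)
        qed
        finally have "(\<lambda>k. ennreal ((cmod (LINT t|lborel. a (1 / real (Suc k)) t * iexp (u * t)))\<^sup>2)) \<longlonglongrightarrow> ennreal (4 * pi\<^sup>2 * exp (- 2 * \<sigma> * u) * sqdev Lam m (exp u) (\<theta> * exp u))"
          unfolding diff[OF \<nu>k(1) u, THEN conjunct2] by (rule tendsto_ennrealI)
        hence "(\<lambda>k. w k u) \<longlonglongrightarrow> ennreal (4 * pi\<^sup>2 * exp (- 2 * \<sigma> * u) * sqdev Lam m (exp u) (\<theta> * exp u))"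
          unfolding w_def using True by simp
        from lim_imp_Liminf[OF _ this] True show ?thesis by simp
      next
        case False
        hence "(\<lambda>k. w k u) = (\<lambda>_. 0)" by (auto simp: w_def)
        thus ?thesis using False by (simp add: Liminf_const)
      qed
    qed
    also have "\<dots> \<le> liminf (\<lambda>k. \<integral>\<^sup>+u. w k u \<partial>lborel)" by (rule nn_integral_liminf[OF wm])
    also have "\<dots> \<le> ennreal (K * \<theta> powr (1 - 3 * \<kappa>))"
      using wle by (intro Liminf_le) (auto intro: always_eventually)
    finally show ?thesis .
  qed
  have "VF Lam m X \<theta> \<le> K * X powr (2 + 2 * \<kappa>) * \<theta> powr (1 - 3 * \<kappa>)" if X: "1 \<le> X" and \<theta>: "0 < \<theta>" "\<theta> \<le> 1" for X \<theta>
  proof (cases "X = 1")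
    case True
    have "VF Lam m X \<theta> = 0" unfolding VF_def True by simp
    thus ?thesis using K0 X \<theta> by simp
  next
    case False
    define L where "L = ln X"
    have L: "0 < L" "exp L = X" using X False by (auto simp: L_def)
    have "ennreal (VF Lam m X \<theta>) = (\<integral>\<^sup>+x. ennreal (sqdev Lam m x (\<theta> * x)) * indicator {exp 0..exp L} x \<partial>lborel)"
      unfolding VF_sqdev using \<theta> L by (subst nn_integral_sqdev_linear) auto
    also have "\<dots> = (\<integral>\<^sup>+x. ennreal (sqdev Lam m x (\<theta> * x) * indicat_real {exp 0..exp L} x) \<partial>lborel)"
      by (intro nn_integral_cong) (auto simp: indicator_def)
    also have "\<dots> = (\<integral>\<^sup>+u. ennreal (sqdev Lam m (exp u) (\<theta> * exp u) * exp u * indicat_real {0..L} u) \<partial>lborel)"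
    proof (rule nn_integral_substitution)
      show "set_borel_measurable borel {exp 0..exp L} (\<lambda>x. sqdev Lam m x (\<theta> * x))"
        unfolding set_borel_measurable_def by measurable
    qed (use L in \<open>auto intro!: derivative_eq_intros continuous_intros\<close>)
    also have "\<dots> \<le> (\<integral>\<^sup>+u. ennreal (X powr (1 + 2 * \<sigma>)) * (ennreal (4 * pi\<^sup>2 * exp (- 2 * \<sigma> * u) * sqdev Lam m (exp u) (\<theta> * exp u)) * indicator {0..L} u) \<partial>lborel)"
    proof (intro nn_integral_mono)
      fix u :: real
      show "ennreal (sqdev Lam m (exp u) (\<theta> * exp u) * exp u * indicat_real {0..L} u) \<le> ennreal (X powr (1 + 2 * \<sigma>)) * (ennreal (4 * pi\<^sup>2 * exp (- 2 * \<sigma> * u) * sqdev Lam m (exp u) (\<theta> * exp u)) * indicator {0..L} u)"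
      proof (cases "u \<in> {0..L}")
        case True
        \<comment> \<open>The substitution x = exp u contributes exp u, and the mean square bound
          carries the weight exp (- 2 \<sigma> u). Removing both costs X^(1+2\<sigma>) =
          X^(2+2\<kappa>); the factor 4 pi^2 \<ge> 1 is given away.\<close>
        have "exp u = exp ((1 + 2 * \<sigma>) * u) * exp (- 2 * \<sigma> * u)" unfolding exp_add[symmetric] by (simp add: algebra_simps)
        also have "\<dots> \<le> exp ((1 + 2 * \<sigma>) * L) * (4 * pi\<^sup>2 * exp (- 2 * \<sigma> * u))"
        proof (intro mult_mono)
          have "1 * 1 \<le> 4 * pi\<^sup>2" using pi_gt3 by (intro mult_mono) (auto simp: one_le_power)
          from mult_right_mono[OF this, of "exp (- 2 * \<sigma> * u)"] show "exp (- 2 * \<sigma> * u) \<le> 4 * pi\<^sup>2 * exp (- 2 * \<sigma> * u)" by simp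
        qed (use True \<sigma> in auto)
        also have "exp ((1 + 2 * \<sigma>) * L) = X powr (1 + 2 * \<sigma>)" using X by (simp add: powr_def L_def)
        finally have "sqdev Lam m (exp u) (\<theta> * exp u) * exp u \<le> sqdev Lam m (exp u) (\<theta> * exp u) * (X powr (1 + 2 * \<sigma>) * (4 * pi\<^sup>2 * exp (- 2 * \<sigma> * u)))"
          by (intro mult_left_mono) auto
        hence "sqdev Lam m (exp u) (\<theta> * exp u) * exp u \<le> X powr (1 + 2 * \<sigma>) * (4 * pi\<^sup>2 * exp (- 2 * \<sigma> * u) * sqdev Lam m (exp u) (\<theta> * exp u))"
          by (simp only: mult_ac)
        from ennreal_leI[OF this] show ?thesis using True by (simp add: ennreal_mult)
      qed simp
    qed
    also have "\<dots> = ennreal (X powr (1 + 2 * \<sigma>)) * (\<integral>\<^sup>+u. (ennreal (4 * pi\<^sup>2 * exp (- 2 * \<sigma> * u) * sqdev Lam m (exp u) (\<theta> * exp u)) * indicator {0..L} u) \<partial>lborel)"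
      by (intro nn_integral_cmult) measurable
    also have "\<dots> \<le> ennreal (X powr (1 + 2 * \<sigma>)) * ennreal (K * \<theta> powr (1 - 3 * \<kappa>))"
      by (intro mult_left_mono main \<theta> L) auto
    also have "\<dots> = ennreal (X powr (1 + 2 * \<sigma>) * (K * \<theta> powr (1 - 3 * \<kappa>)))" using K0 by (subst ennreal_mult) auto
    finally have "VF Lam m X \<theta> \<le> X powr (1 + 2 * \<sigma>) * (K * \<theta> powr (1 - 3 * \<kappa>))" using K0 by (subst (asm) ennreal_le_iff) auto
    moreover have "1 + 2 * \<sigma> = 2 + 2 * \<kappa>" by (simp add: \<sigma>_def)
    ultimately show ?thesis by (simp add: mult_ac)
  qed
  thus ?thesis using K0 by blast
qed

lemma selberg_GRH_mean_square:
  assumes data: "selberg_data F a m Q lam mu eps" and grh: "GRH F m"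
    and Lam: "\<forall>s. 1 < Re s \<longrightarrow> ((\<lambda>n. Lam n / of_nat n powr s) sums (- (deriv F s / F s)))"
    and \<kappa>: "0 < \<kappa>" "\<kappa> \<le> 1/4"
  shows "\<exists>K\<ge>0. \<forall>X \<theta>. 1 \<le> X \<and> 0 < \<theta> \<and> \<theta> \<le> 1 \<longrightarrow> VF Lam m X \<theta> \<le> K * X powr (2 + 2 * \<kappa>) * \<theta> powr (1 - 3 * \<kappa>)"
proof -
  obtain G where G: "G holomorphic_on UNIV" "\<And>s. s \<noteq> 1 \<Longrightarrow> G s = (s - 1) ^ m * F s" "\<And>s. 1/2 < Re s \<Longrightarrow> G s \<noteq> 0"
    "\<And>\<sigma>0 \<kappa>. 1/2 < \<sigma>0 \<Longrightarrow> \<sigma>0 < 4 \<Longrightarrow> 0 < \<kappa> \<Longrightarrow> \<exists>C\<ge>0. \<forall>s. \<sigma>0 \<le> Re s \<and> Re s \<le> 4 \<longrightarrow> cmod (deriv G s / G s) \<le> C * (1 + \<bar>Im s\<bar>) powr \<kappa>"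
    using selberg_GRH_log_deriv[OF data grh] by metis
  obtain C where C: "0 \<le> C" "\<And>s. 1/2 + \<kappa> \<le> Re s \<Longrightarrow> Re s \<le> 4 \<Longrightarrow> cmod (deriv G s / G s) \<le> C * (1 + \<bar>Im s\<bar>) powr \<kappa>"
    using G(4)[of "1/2 + \<kappa>" \<kappa>] \<kappa> by auto
  define h where "h s = - (deriv G s / G s)" for s
  have hol: "h holomorphic_on {s. 1/2 < Re s}" unfolding h_def
    using G(3) by (intro holomorphic_intros holomorphic_on_subset[OF holomorphic_deriv[OF G(1)]] holomorphic_on_subset[OF G(1)]) auto
  have h4: "h z = (\<Sum>n. Lam n / of_nat n powr z) - of_nat m / (z - 1)" if z: "1 < Re z" for z
  proof -
    have z1: "z - 1 \<noteq> 0" using z by auto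
    have oS: "open {s. 1 < Re s}" by (rule open_halfspace_Re_gt)
    have Gz: "G w = (w - 1) ^ m * F w" if "w \<in> {s. 1 < Re s}" for w
      by (rule G(2)) (use that in auto)
    have "(\<lambda>w. G w / (w - 1) ^ m) holomorphic_on {s. 1 < Re s}"
      by (intro holomorphic_intros holomorphic_on_subset[OF G(1)]) auto
    hence "F holomorphic_on {s. 1 < Re s}"
    proof (rule holomorphic_transform)
      fix w assume "w \<in> {s. 1 < Re s}"
      thus "G w / (w - 1) ^ m = F w" using Gz[of w] by auto
    qed
    hence F': "(F has_field_derivative deriv F z) (at z)" using z oS by (intro holomorphic_derivI[of F]) auto
    have Fz: "F z \<noteq> 0" using G(3)[of z] Gz[of z] z by auto
    have "((\<lambda>w. (w - 1) ^ m * F w) has_field_derivative of_nat m * (z - 1) ^ (m - 1) * F z + (z - 1) ^ m * deriv F z) (at z)"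
      using F' by (auto intro!: derivative_eq_intros)
    hence "(G has_field_derivative of_nat m * (z - 1) ^ (m - 1) * F z + (z - 1) ^ m * deriv F z) (at z)"
      by (rule has_field_derivative_transform_within_open[OF _ oS]) (use Gz z in auto)
    hence "deriv G z = of_nat m * (z - 1) ^ (m - 1) * F z + (z - 1) ^ m * deriv F z" by (rule DERIV_imp_deriv)
    \<comment> \<open>Subtraction truncates at m = 0, where both sides are 0.\<close>
    moreover have "of_nat m * (z - 1) ^ (m - 1) = of_nat m / (z - 1) * (z - 1) ^ m"
      using z1 by (cases m) auto
    ultimately have "deriv G z = (z - 1) ^ m * F z * (of_nat m / (z - 1) + deriv F z / F z)"
      using Fz by (simp add: algebra_simps)
    hence "deriv G z / G z = of_nat m / (z - 1) + deriv F z / F z"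
      using Gz[of z] z Fz z1 by simp
    moreover have "(\<Sum>n. Lam n / of_nat n powr z) = - (deriv F z / F z)" using Lam z sums_unique by metis
    ultimately show ?thesis by (simp add: h_def)
  qed
  \<comment> \<open>Convergence at 3/2 bounds the terms there, so at 4 they are O(n^(-5/2)), which
    gives absolute convergence.\<close>
  have sm: "summable (\<lambda>n. norm (Lam n / of_nat n powr 4))"
  proof -
    have "summable (\<lambda>n. Lam n / of_nat n powr of_real (3/2))" using Lam by (intro sums_summable) (auto dest!: spec[of _ "of_real (3/2)"])
    from summable_LIMSEQ_zero[OF this] have "Bseq (\<lambda>n. Lam n / of_nat n powr of_real (3/2))"
      by (intro convergent_imp_Bseq) (auto simp: convergent_def)
    then obtain B where B: "\<And>n. norm (Lam n / of_nat n powr of_real (3/2)) \<le> B" by (auto simp: Bseq_def)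
    have le: "norm (norm (Lam n / of_nat n powr 4)) \<le> B * real n powr (- (5/2))" for n
    proof (cases "n = 0")
      case False
      hence "norm (Lam n / of_nat n powr 4) = norm (Lam n / of_nat n powr of_real (3/2)) * (real n powr (3/2) / real n powr 4)"
        unfolding norm_divide by (subst (1 2) norm_of_nat_powr) auto
      also have "real n powr (3/2) / real n powr 4 = real n powr (- (5/2))" unfolding powr_diff[symmetric] by simp
      also have "norm (Lam n / of_nat n powr of_real (3/2)) * real n powr (- (5/2)) \<le> B * real n powr (- (5/2))"
        by (intro mult_right_mono B) auto
      finally show ?thesis by simp
    qed simp
    have "summable (\<lambda>n. real n powr (- (5/2)))" by (subst summable_real_powr_iff) simp
    hence "summable (\<lambda>n. B * real n powr (- (5/2)))" by (rule summable_mult)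
    thus ?thesis by (rule summable_comparison_test'[of _ 0]) (rule le)
  qed
  show ?thesis
  proof (rule mean_square_bound_of_log_deriv[OF hol \<kappa> _ C(1) _ sm])
    show "cmod (h s) \<le> C * (1 + \<bar>Im s\<bar>) powr \<kappa>" if "1/2 + \<kappa> \<le> Re s" "Re s \<le> 4" for s
      using C(2)[OF that] by (simp add: h_def)
    show "h (Complex 4 t) = (\<Sum>n. Lam n / of_nat n powr Complex 4 t) - of_nat m / (Complex 4 t - 1)" for t
      by (rule h4) simp
  qed
qed

section \<open>From fixed to proportional interval lengths\<close>

lemma tVF_difference:
  assumes "1 \<le> p" "p \<le> q" "0 \<le> h"
  shows "(\<integral>\<^sup>+x. ennreal (sqdev Lam m x h) * indicator {p..q} x \<partial>lborel) = ennreal (tVF Lam m q h - tVF Lam m p h)"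
proof -
  have "tVF Lam m p h + integral {p..q} (\<lambda>x. sqdev Lam m x h) = tVF Lam m q h"
    unfolding tVF_sqdev using assms
    by (intro Henstock_Kurzweil_Integration.integral_combine sqdev_integrable_on[where H = h]) auto
  moreover have "(\<integral>\<^sup>+x. ennreal (sqdev Lam m x h) * indicator {p..q} x \<partial>lborel) = ennreal (integral {p..q} (\<lambda>x. sqdev Lam m x h))"
    using assms by (intro nn_integral_sqdev[where H = h]) auto
  moreover have "integral {p..q} (\<lambda>x. sqdev Lam m x h) = tVF Lam m q h - tVF Lam m p h"
    using calculation(1) by linarith
  ultimately show ?thesis by (simp only:)
qed

text \<open>\<delta> y^2 A is the main term of \<open>tVF\<close> at (y, \<delta> y) minus
  \<open>tVF\<close> at (y / (1 + \<eta>), \<delta> y). From \<eta> - \<eta>^2 \<le> ln (1 + \<eta>)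
  \<le> \<eta> it follows that A is \<eta> (L + d) up to a relative error 2 \<eta>; here the
  additional d in the main term arises.\<close>

lemma sector_weight_bounds:
  fixes \<eta> L d :: real
  assumes "0 < \<eta>" "\<eta> \<le> 1" "0 \<le> L" "0 \<le> d"
  defines "A \<equiv> (\<eta> * L + d * ln (1 + \<eta>)) / (1 + \<eta>)"
  shows "0 \<le> A" "A \<le> \<eta> * (L + d)" "\<eta> * (1 - 2 * \<eta>) * (L + d) \<le> A"
proof -
  have ln0: "0 \<le> ln (1 + \<eta>)" and ln1: "ln (1 + \<eta>) \<le> \<eta>" using assms ln_add_one_self_le_self[of \<eta>] by auto
  have ln2: "\<eta> - \<eta>\<^sup>2 \<le> ln (1 + \<eta>)" using ln_one_plus_pos_lower_bound[of \<eta>] assms by simp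
  show "0 \<le> A" unfolding A_def using assms ln0 by (intro divide_nonneg_pos add_nonneg_nonneg mult_nonneg_nonneg) auto
  have num: "\<eta> * L + d * ln (1 + \<eta>) \<le> \<eta> * (L + d)" using mult_left_mono[OF ln1 assms(4)] by (simp add: algebra_simps)
  also have "\<dots> \<le> \<eta> * (L + d) * (1 + \<eta>)" using assms by (simp add: algebra_simps)
  finally show "A \<le> \<eta> * (L + d)" unfolding A_def using assms by (simp add: pos_divide_le_eq)
  have "\<eta> * (1 - 2 * \<eta>) * (L + d) * (1 + \<eta>) = (L + d) * (\<eta> - \<eta>\<^sup>2) - 2 * \<eta> ^ 3 * (L + d)"
    by (simp add: algebra_simps power2_eq_square power3_eq_cube)
  also have "\<dots> \<le> (L + d) * (\<eta> - \<eta>\<^sup>2)" using assms by simp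
  also have "\<dots> \<le> \<eta> * L + d * (\<eta> - \<eta>\<^sup>2)" using assms by (simp add: algebra_simps)
  also have "\<dots> \<le> \<eta> * L + d * ln (1 + \<eta>)" using mult_left_mono[OF ln2 assms(4)] by simp
  finally show "\<eta> * (1 - 2 * \<eta>) * (L + d) \<le> A" unfolding A_def using assms by (simp add: pos_le_divide_eq)
qed

text \<open>The factor \<eta> cancels from both sector inequalities. For the upper one (1 +
  \<eta>)^3 \<le> 1 + 7 \<eta> leaves 7/2 \<eta> M, for the lower one \<eta> M suffices; the
  constant 4 covers both. The term with X1 pays for the missing initial part of the main
  term.\<close>

lemma sector_evaluation:
  fixes P Err :: real
  assumes \<eta>: "0 < \<eta>" "\<eta> \<le> 1" and \<delta>: "0 < \<delta>" and L: "0 \<le> L" "0 \<le> d" and X: "0 \<le> X1" "2 * X1 \<le> X" and Qn: "0 \<le> Qn"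
    and A: "A = (\<eta> * L + d * ln (1 + \<eta>)) / (1 + \<eta>)"
    and up: "\<eta> * (P - Err) \<le> (1 + \<eta>) * (\<delta> * A * ((1 + \<eta>) * X)\<^sup>2 / 2 + Qn)"
    and lo: "\<delta> * A * (X\<^sup>2 - ((1 + \<eta>) * X1)\<^sup>2) / 2 \<le> \<eta> * (P + Err) + Qn"
  shows "\<bar>P - \<delta> * X\<^sup>2 * (L + d) / 2\<bar> \<le> Err + 2 * (Qn / \<eta>) + 4 * \<eta> * \<delta> * X\<^sup>2 * (L + d) + 2 * \<delta> * X1\<^sup>2 * (L + d)"
proof -
  note Ab = sector_weight_bounds[OF \<eta> L, folded A]
  define M where "M = \<delta> * X\<^sup>2 * (L + d)"
  have M0: "0 \<le> M" unfolding M_def using \<delta> L by simp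
  have R0: "0 \<le> 2 * \<delta> * X1\<^sup>2 * (L + d)" using \<delta> L by simp
  have Q1: "0 \<le> Qn / \<eta>" using Qn \<eta> by simp
  have e2: "\<eta>\<^sup>2 \<le> \<eta>" "\<eta> ^ 3 \<le> \<eta>" using \<eta> power_decreasing[of 1 2 \<eta>] power_decreasing[of 1 3 \<eta>] by auto
  have "P - Err \<le> (1 + \<eta>) * (\<delta> * (L + d) * ((1 + \<eta>) * X)\<^sup>2 / 2 + Qn / \<eta>)"
  proof -
    have "\<eta> * (P - Err) \<le> (1 + \<eta>) * (\<delta> * (\<eta> * (L + d)) * ((1 + \<eta>) * X)\<^sup>2 / 2 + Qn)"
      using \<eta> \<delta> Ab(2) by (intro order_trans[OF up] mult_left_mono add_right_mono divide_right_mono mult_right_mono) auto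
    also have "\<dots> = \<eta> * ((1 + \<eta>) * (\<delta> * (L + d) * ((1 + \<eta>) * X)\<^sup>2 / 2 + Qn / \<eta>))" using \<eta> by (simp add: field_simps)
    finally show ?thesis using \<eta> by simp
  qed
  also have "\<dots> = (1 + \<eta>) ^ 3 * M / 2 + (1 + \<eta>) * (Qn / \<eta>)"
    unfolding M_def by (simp add: power_mult_distrib power2_eq_square power3_eq_cube algebra_simps)
  also have "\<dots> \<le> (1 + 7 * \<eta>) * M / 2 + 2 * (Qn / \<eta>)"
  proof (intro add_mono divide_right_mono mult_right_mono)
    have "(1 + \<eta>) ^ 3 = 1 + 3 * \<eta> + 3 * \<eta>\<^sup>2 + \<eta> ^ 3" by (simp add: power3_eq_cube power2_eq_square algebra_simps)
    thus "(1 + \<eta>) ^ 3 \<le> 1 + 7 * \<eta>" using e2 by linarith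
  qed (use \<eta> M0 Q1 in auto)
  finally have U: "P \<le> M / 2 + Err + 2 * (Qn / \<eta>) + 7 / 2 * (\<eta> * M)" by (simp add: algebra_simps add_divide_distrib)
  have sq: "0 \<le> X\<^sup>2 - ((1 + \<eta>) * X1)\<^sup>2" "((1 + \<eta>) * X1)\<^sup>2 \<le> 4 * X1\<^sup>2"
  proof -
    have "(1 + \<eta>) * X1 \<le> 2 * X1" using \<eta> X by (intro mult_right_mono) auto
    hence "((1 + \<eta>) * X1)\<^sup>2 \<le> (2 * X1)\<^sup>2" "((1 + \<eta>) * X1)\<^sup>2 \<le> X\<^sup>2" using X \<eta> by (intro power_mono; simp)+
    thus "0 \<le> X\<^sup>2 - ((1 + \<eta>) * X1)\<^sup>2" "((1 + \<eta>) * X1)\<^sup>2 \<le> 4 * X1\<^sup>2" by (auto simp: power_mult_distrib)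
  qed
  define W where "W = X\<^sup>2 - ((1 + \<eta>) * X1)\<^sup>2"
  have "\<delta> * (\<eta> * (1 - 2 * \<eta>) * (L + d)) * W / 2 \<le> \<delta> * A * W / 2"
    using Ab(3) \<delta> sq(1) unfolding W_def by (intro divide_right_mono mult_right_mono mult_left_mono) auto
  also have "\<dots> \<le> \<eta> * (P + Err) + Qn" unfolding W_def by (rule lo)
  also have "\<dots> = \<eta> * (P + Err + Qn / \<eta>)" using \<eta> by (simp add: distrib_left)
  also have "\<delta> * (\<eta> * (1 - 2 * \<eta>) * (L + d)) * W / 2 = \<eta> * (\<delta> * (1 - 2 * \<eta>) * (L + d) * W / 2)"
    by (simp only: mult_ac times_divide_eq_right times_divide_eq_left)
  finally have "\<eta> * (\<delta> * (1 - 2 * \<eta>) * (L + d) * W / 2) \<le> \<eta> * (P + Err + Qn / \<eta>)" .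
  hence l1: "\<delta> * (1 - 2 * \<eta>) * (L + d) * W / 2 \<le> P + Err + Qn / \<eta>" using \<eta> by simp
  have "\<delta> * (L + d) * (X\<^sup>2 - 4 * X1\<^sup>2 - 2 * \<eta> * X\<^sup>2) \<le> \<delta> * (L + d) * ((1 - 2 * \<eta>) * W)"
  proof (intro mult_left_mono)
    have "(1 - 2 * \<eta>) * W = W - 2 * \<eta> * W" by (simp add: algebra_simps)
    moreover have "2 * \<eta> * W \<le> 2 * \<eta> * X\<^sup>2" using \<eta> unfolding W_def by (intro mult_left_mono) auto
    ultimately show "X\<^sup>2 - 4 * X1\<^sup>2 - 2 * \<eta> * X\<^sup>2 \<le> (1 - 2 * \<eta>) * W" using sq(2) unfolding W_def by linarith
  qed (use \<delta> L in auto)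
  moreover have "\<delta> * (L + d) * (X\<^sup>2 - 4 * X1\<^sup>2 - 2 * \<eta> * X\<^sup>2) = 2 * (M / 2 - 2 * \<delta> * X1\<^sup>2 * (L + d) - \<eta> * M)"
    unfolding M_def by (simp add: right_diff_distrib mult_ac)
  moreover have "\<delta> * (L + d) * ((1 - 2 * \<eta>) * W) = 2 * (\<delta> * (1 - 2 * \<eta>) * (L + d) * W / 2)"
    by (simp add: mult_ac)
  ultimately have "2 * (M / 2 - 2 * \<delta> * X1\<^sup>2 * (L + d) - \<eta> * M) \<le> 2 * (\<delta> * (1 - 2 * \<eta>) * (L + d) * W / 2)"
    by (simp only:)
  hence "M / 2 - 2 * \<delta> * X1\<^sup>2 * (L + d) - \<eta> * M \<le> \<delta> * (1 - 2 * \<eta>) * (L + d) * W / 2"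
    by (rule mult_left_le_imp_le) simp
  hence V: "M / 2 - 2 * \<delta> * X1\<^sup>2 * (L + d) - \<eta> * M \<le> P + Err + Qn / \<eta>" using l1 by linarith
  have "\<bar>P - M / 2\<bar> \<le> Err + 2 * q + 4 * e + r"
    if "P \<le> M / 2 + Err + 2 * q + 7 / 2 * e" "M / 2 - r - e \<le> P + Err + q" "0 \<le> r" "0 \<le> q" "0 \<le> e" for q e r
    using that by (simp add: abs_le_iff)
  from this[OF U V R0 Q1] have "\<bar>P - M / 2\<bar> \<le> Err + 2 * (Qn / \<eta>) + 4 * (\<eta> * M) + 2 * \<delta> * X1\<^sup>2 * (L + d)"
    using \<eta> M0 by simp
  thus ?thesis unfolding M_def by (simp add: mult.assoc)
qed

text \<open>X1 is twice the point \<delta>^(-1/B3) from which on \<delta> Y \<ge> Y^(1-B3). The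
  factor 2 is there because the lower end y / (1 + \<eta>) of a slice may be as small as y /
  2.\<close>

lemma tVF_to_VF_sector:
  assumes B: "0 < B1" "0 < B3" and c: "0 < c" "c \<le> 2" and d: "0 \<le> d" and \<eta>: "0 < \<eta>" "\<eta> \<le> 1"
    and \<delta>: "0 < \<delta>" "\<delta> \<le> k2 * X powr (- B1)" and k2: "0 < k2" and L: "0 \<le> d * ln (1 / \<delta>) + K0"
    and X1: "X1 = 2 * \<delta> powr (- 1 / B3)" "1 \<le> \<delta> powr (- 1 / B3)" "X0 \<le> \<delta> powr (- 1 / B3)" "2 * X1 \<le> X"
    and Ch: "0 \<le> Ch"
    and hyp: "\<And>Y h. X0 \<le> Y \<Longrightarrow> Y powr (1 - B3) \<le> h \<Longrightarrow> h \<le> 2 * k2 * 2 powr B1 * Y powr (1 - B1) \<Longrightarrow>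
       \<bar>tVF Lam m Y h - h * Y * (d * ln (Y / h) + K0)\<bar> \<le> Ch * h * Y powr (1 - c)"
    and Err: "\<And>\<kappa>. 0 < \<kappa> \<Longrightarrow> \<kappa> \<le> \<eta> \<Longrightarrow> \<bar>P - integral {X1..X} (\<lambda>x. sqdev Lam m x ((1 + \<kappa>) * \<delta> * x))\<bar> \<le> Err"
    and P: "0 \<le> P" and Err0: "0 \<le> Err"
  shows "\<bar>P - \<delta> * X\<^sup>2 * (d * ln (1 / \<delta>) + K0 + d) / 2\<bar>
    \<le> Err + 2 * (3 * Ch * \<delta> * (2 * X) powr (2 - c) * ln (2 * X) / \<eta>)
      + 4 * \<eta> * \<delta> * X\<^sup>2 * (d * ln (1 / \<delta>) + K0 + d) + 2 * \<delta> * X1\<^sup>2 * (d * ln (1 / \<delta>) + K0 + d)"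
proof -
  define L where "L = d * ln (1 / \<delta>) + K0"
  define A where "A = (\<eta> * L + d * ln (1 + \<eta>)) / (1 + \<eta>)"
  have \<eta>1: "0 < 1 + \<eta>" "1 + \<eta> \<le> 2" using \<eta> by auto
  have X1': "2 \<le> X1" "X1 \<le> X" "0 < X" "1 \<le> X" using X1 by auto
  \<comment> \<open>The length h = \<delta> y serves both ends of a slice, so relative to an end Y
    it lies between \<delta> Y and 2 \<delta> Y. Together with Y \<le> 2 X this accounts for the
    constant 2 k2 2^B1 in the upper range of the hypothesis.\<close>
  have rng: "\<bar>tVF Lam m Y h - h * Y * (d * ln (Y / h) + K0)\<bar> \<le> Ch * h * Y powr (1 - c)"
    if Y: "X1 / 2 \<le> Y" "Y \<le> 2 * X" and h: "\<delta> * Y \<le> h" "h \<le> 2 * (\<delta> * Y)" for Y h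
  proof (rule hyp)
    have Yp: "0 < Y" using Y X1' by linarith
    show "X0 \<le> Y" using Y X1 by simp
    have "\<delta> * Y powr B3 \<ge> 1"
    proof -
      have "(\<delta> powr (- 1 / B3)) powr B3 \<le> Y powr B3" using Y X1 B by (intro powr_mono2) auto
      moreover have "(\<delta> powr (- 1 / B3)) powr B3 = 1 / \<delta>"
      proof -
        have "- 1 / B3 * B3 = - 1" using B by simp
        thus ?thesis unfolding powr_powr using \<delta>(1) by (simp only: powr_minus_divide powr_one less_imp_le)
      qed
      ultimately have "1 / \<delta> \<le> Y powr B3" by (simp only:)
      thus ?thesis using \<delta>(1) by (simp add: pos_divide_le_eq mult.commute)
    qed
    hence "1 * Y powr (1 - B3) \<le> (\<delta> * Y powr B3) * Y powr (1 - B3)" by (intro mult_right_mono) auto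
    also have "(\<delta> * Y powr B3) * Y powr (1 - B3) = \<delta> * Y" using Yp by (simp add: mult.assoc powr_add[symmetric])
    finally show "Y powr (1 - B3) \<le> h" using h by simp
    have "X powr (- B1) \<le> (Y / 2) powr (- B1)" using Y Yp B by (intro powr_mono2') auto
    also have "(Y / 2) powr (- B1) = 2 powr B1 * Y powr (- B1)" using Yp by (simp add: powr_divide powr_minus field_simps)
    finally have "k2 * X powr (- B1) \<le> k2 * (2 powr B1 * Y powr (- B1))" using k2 by (intro mult_left_mono) auto
    hence "\<delta> * Y \<le> k2 * (2 powr B1 * Y powr (- B1)) * Y" using \<delta> Yp by (intro mult_right_mono) auto
    also have "\<dots> = k2 * 2 powr B1 * Y powr (1 - B1)" using Yp powr_add[of Y "-B1" 1] by (simp add: mult_ac)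
    finally show "h \<le> 2 * k2 * 2 powr B1 * Y powr (1 - B1)" using h by simp
  qed
  have D: "\<bar>(tVF Lam m y (\<delta> * y) - tVF Lam m (y / (1 + \<eta>)) (\<delta> * y)) - \<delta> * y\<^sup>2 * A\<bar> \<le> 3 * Ch * \<delta> * y powr (2 - c)"
    if y: "X1 \<le> y" "y \<le> (1 + \<eta>) * X" for y
  proof -
    have yp: "0 < y" "1 \<le> y" using y X1' by auto
    define z where "z = y / (1 + \<eta>)"
    have zp: "0 < z" and yz: "y = (1 + \<eta>) * z" using yp \<eta>1 by (auto simp: z_def)
    have y2: "y \<le> 2 * X" using y mult_right_mono[OF \<eta>1(2), of X] X1' by linarith
    have zy: "z \<le> y" "y \<le> 2 * z" unfolding yz using zp \<eta> by (auto simp: algebra_simps)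
    have e1: "\<bar>tVF Lam m y (\<delta> * y) - \<delta> * y * y * (d * ln (y / (\<delta> * y)) + K0)\<bar> \<le> Ch * (\<delta> * y) * y powr (1 - c)"
      using y y2 X1' yp \<delta> by (intro rng) auto
    have e2: "\<bar>tVF Lam m z (\<delta> * y) - \<delta> * y * z * (d * ln (z / (\<delta> * y)) + K0)\<bar> \<le> Ch * (\<delta> * y) * z powr (1 - c)"
    proof (rule rng)
      show "X1 / 2 \<le> z" "z \<le> 2 * X" using zy y y2 by auto
      show "\<delta> * z \<le> \<delta> * y" "\<delta> * y \<le> 2 * (\<delta> * z)" using \<delta> zy by auto
    qed
    have "y / (\<delta> * y) = 1 / \<delta>" using yp by simp
    hence m1: "\<delta> * y * y * (d * ln (y / (\<delta> * y)) + K0) = \<delta> * y\<^sup>2 * L" by (simp add: L_def power2_eq_square)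
    have lnz: "ln (z / (\<delta> * y)) = ln (1 / \<delta>) - ln (1 + \<eta>)"
      unfolding yz using zp \<delta> \<eta>1 by (simp add: ln_div ln_mult)
    have alg: "\<delta> * y * z * (d * (p - q) + K0) = \<delta> * y\<^sup>2 * ((d * p + K0 - d * q) / (1 + \<eta>))" for p q
      unfolding z_def by (simp add: power2_eq_square algebra_simps)
    have m2: "\<delta> * y * z * (d * ln (z / (\<delta> * y)) + K0) = \<delta> * y\<^sup>2 * ((L - d * ln (1 + \<eta>)) / (1 + \<eta>))"
      unfolding lnz L_def by (rule alg)
    have Aeq: "L - (L - d * ln (1 + \<eta>)) / (1 + \<eta>) = A" unfolding A_def using \<eta>1 by (simp add: field_simps)
    have mm: "\<delta> * y\<^sup>2 * L - \<delta> * y\<^sup>2 * ((L - d * ln (1 + \<eta>)) / (1 + \<eta>)) = \<delta> * y\<^sup>2 * A"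
      unfolding Aeq[symmetric] by (simp only: right_diff_distrib)
    \<comment> \<open>For c > 1 the power is decreasing; z \<ge> y / 2 and c \<le> 2 limit the loss
      to a factor 2. The errors at y and z then add up to 3 Ch.\<close>
    have zc: "z powr (1 - c) \<le> 2 * y powr (1 - c)"
    proof (cases "c \<le> 1")
      case True
      hence "z powr (1 - c) \<le> y powr (1 - c)" using zy zp by (intro powr_mono2) auto
      thus ?thesis using powr_ge_zero[of y "1 - c"] by linarith
    next
      case False
      have "y powr (1 - c) = (1 + \<eta>) powr (1 - c) * z powr (1 - c)" unfolding yz using zp \<eta>1 by (intro powr_mult)
      moreover have "(1 + \<eta>) powr (- 1) \<le> (1 + \<eta>) powr (1 - c)" using \<eta> c by (intro powr_mono) auto
      moreover have "1/2 \<le> (1 + \<eta>) powr (- 1)" using \<eta>1 by (simp add: powr_minus field_simps)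
      ultimately have "1/2 * z powr (1 - c) \<le> y powr (1 - c)" by (metis mult_right_mono order_trans powr_ge_zero)
      thus ?thesis by simp
    qed
    have yy: "y * y powr (1 - c) = y powr (2 - c)" using yp powr_add[of y 1 "1 - c"] by simp
    have "Ch * (\<delta> * y) * z powr (1 - c) \<le> Ch * (\<delta> * y) * (2 * y powr (1 - c))"
      using Ch \<delta> yp zc by (intro mult_left_mono) auto
    hence "Ch * (\<delta> * y) * y powr (1 - c) + Ch * (\<delta> * y) * z powr (1 - c) \<le> 3 * Ch * \<delta> * (y * y powr (1 - c))"
      by (simp add: algebra_simps)
    hence ee: "Ch * (\<delta> * y) * y powr (1 - c) + Ch * (\<delta> * y) * z powr (1 - c) \<le> 3 * Ch * \<delta> * y powr (2 - c)"
      by (simp only: yy)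
    have "\<bar>v - v' - w\<bar> \<le> r" if "\<bar>v - p\<bar> \<le> r1" "\<bar>v' - p'\<bar> \<le> r2" "p - p' = w" "r1 + r2 \<le> r" for v v' p p' r1 r2 w r :: real
      using that by linarith
    from this[OF e1[unfolded m1] e2[unfolded m2] mm ee] show ?thesis by (simp only: z_def)
  qed
  have nn: "(\<integral>\<^sup>+x. ennreal (sqdev Lam m x (\<delta> * y)) * indicator {y / (1 + \<eta>)..y} x \<partial>lborel)
      = ennreal (tVF Lam m y (\<delta> * y) - tVF Lam m (y / (1 + \<eta>)) (\<delta> * y))" if "X1 \<le> y" for y
  proof (rule tVF_difference)
    have "1 * (1 + \<eta>) \<le> y" using order_trans[OF order_trans[OF \<eta>1(2) X1'(1)] that] by simp
    thus "1 \<le> y / (1 + \<eta>)" using \<eta>1 by (simp add: pos_le_divide_eq)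
    have "y * 1 \<le> y * (1 + \<eta>)" using that X1' \<eta> by (intro mult_left_mono) auto
    thus "y / (1 + \<eta>) \<le> y" using \<eta>1 by (simp add: pos_divide_le_eq)
    show "0 \<le> \<delta> * y" using \<delta> that X1' by simp
  qed
  have A0: "0 \<le> A" "A \<le> \<eta> * (L + d)" "\<eta> * (1 - 2 * \<eta>) * (L + d) \<le> A"
    using sector_weight_bounds[OF \<eta>, of L d] assms(11) d unfolding A_def L_def by auto
  have ray: "(\<integral>\<^sup>+x. ennreal (sqdev Lam m x ((1 + \<kappa>) * \<delta> * x)) * indicator {X1..X} x \<partial>lborel)
      = ennreal (integral {X1..X} (\<lambda>x. sqdev Lam m x ((1 + \<kappa>) * \<delta> * x)))" if "0 < \<kappa>" for \<kappa>
    using that \<delta> X1' by (intro nn_integral_sqdev_linear) auto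
  have gm: "(\<lambda>z. sqdev Lam m (fst z) (snd z)) \<in> borel_measurable (borel \<Otimes>\<^sub>M borel)" by measurable
  have X12: "(1 + \<eta>) * X1 \<le> X"
    using mult_right_mono[OF \<eta>1(2), of X1] X1' X1(4) by linarith
  note sec = sector_average[where g = "sqdev Lam m" and U = "P + Err" and V = "P - Err" and A = A and E = "3 * Ch" and c = c and X = X and ?X1.0 = X1 and \<delta> = \<delta> and \<eta> = \<eta>]
  have S: "\<eta> * (P - Err) \<le> (1 + \<eta>) * (\<delta> * A * ((1 + \<eta>) * X)\<^sup>2 / 2 + 3 * Ch * \<delta> * (2 * X) powr (2 - c) * ln (2 * X))
    \<and> \<delta> * A * (X\<^sup>2 - ((1 + \<eta>) * X1)\<^sup>2) / 2 \<le> \<eta> * (P + Err) + 3 * Ch * \<delta> * (2 * X) powr (2 - c) * ln (2 * X)"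
  proof (rule conjI; rule sec)
    show "1 \<le> X1" using X1' by simp
    show "1 \<le> X1" using X1' by simp
    show "0 \<le> P + Err" "0 \<le> P + Err" using P Err0 by auto
    show "0 \<le> 3 * Ch" "0 \<le> 3 * Ch" using Ch by auto
    fix \<kappa> assume "0 < \<kappa>" "\<kappa> \<le> \<eta>"
    thus r: "(\<integral>\<^sup>+x. ennreal (sqdev Lam m x ((1 + \<kappa>) * \<delta> * x)) * indicator {X1..X} x \<partial>lborel) \<le> ennreal (P + Err)"
      "ennreal (P - Err) \<le> (\<integral>\<^sup>+x. ennreal (sqdev Lam m x ((1 + \<kappa>) * \<delta> * x)) * indicator {X1..X} x \<partial>lborel)"
      using Err[of \<kappa>] unfolding ray[OF \<open>0 < \<kappa>\<close>] by (auto intro!: ennreal_leI)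
    thus "(\<integral>\<^sup>+x. ennreal (sqdev Lam m x ((1 + \<kappa>) * \<delta> * x)) * indicator {X1..X} x \<partial>lborel) \<le> ennreal (P + Err)"
      "ennreal (P - Err) \<le> (\<integral>\<^sup>+x. ennreal (sqdev Lam m x ((1 + \<kappa>) * \<delta> * x)) * indicator {X1..X} x \<partial>lborel)" .
  next
    fix y assume y: "X1 \<le> y" "y \<le> (1 + \<eta>) * X"
    have "0 \<le> \<delta> * y\<^sup>2 * A" "0 \<le> 3 * Ch * \<delta> * y powr (2 - c)" using \<delta> A0 Ch by auto
    moreover have "(\<integral>\<^sup>+x. ennreal (sqdev Lam m x (\<delta> * y)) * indicator {y / (1 + \<eta>)..y} x \<partial>lborel) \<le> ennreal (\<delta> * y\<^sup>2 * A + 3 * Ch * \<delta> * y powr (2 - c))"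
      unfolding nn[OF y(1)] using D[OF y] by (intro ennreal_leI) linarith
    moreover have "ennreal (\<delta> * y\<^sup>2 * A) \<le> (\<integral>\<^sup>+x. ennreal (sqdev Lam m x (\<delta> * y)) * indicator {y / (1 + \<eta>)..y} x \<partial>lborel) + ennreal (3 * Ch * \<delta> * y powr (2 - c))"
    proof -
      \<comment> \<open>\<open>ennreal\<close> sends a negative difference to 0, so the lower bound
        is first obtained for max T 0.\<close>
      define T where "T = tVF Lam m y (\<delta> * y) - tVF Lam m (y / (1 + \<eta>)) (\<delta> * y)"
      have "\<delta> * y\<^sup>2 * A \<le> max T 0 + 3 * Ch * \<delta> * y powr (2 - c)" using D[OF y] unfolding T_def by linarith
      from ennreal_leI[OF this] have "ennreal (\<delta> * y\<^sup>2 * A) \<le> ennreal (max T 0) + ennreal (3 * Ch * \<delta> * y powr (2 - c))"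
        using \<open>0 \<le> 3 * Ch * \<delta> * y powr (2 - c)\<close> by (subst (asm) ennreal_plus) auto
      moreover have "ennreal (max T 0) = ennreal T" by (simp add: max_def ennreal_neg)
      ultimately show ?thesis unfolding nn[OF y(1)] T_def by simp
    qed
    ultimately show "(\<integral>\<^sup>+x. ennreal (sqdev Lam m x (\<delta> * y)) * indicator {y / (1 + \<eta>)..y} x \<partial>lborel) \<le> ennreal (\<delta> * y\<^sup>2 * A + 3 * Ch * \<delta> * y powr (2 - c))"
      "ennreal (\<delta> * y\<^sup>2 * A) \<le> (\<integral>\<^sup>+x. ennreal (sqdev Lam m x (\<delta> * y)) * indicator {y / (1 + \<eta>)..y} x \<partial>lborel) + ennreal (3 * Ch * \<delta> * y powr (2 - c))"
      "(\<integral>\<^sup>+x. ennreal (sqdev Lam m x (\<delta> * y)) * indicator {y / (1 + \<eta>)..y} x \<partial>lborel) \<le> ennreal (\<delta> * y\<^sup>2 * A + 3 * Ch * \<delta> * y powr (2 - c))"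
      "ennreal (\<delta> * y\<^sup>2 * A) \<le> (\<integral>\<^sup>+x. ennreal (sqdev Lam m x (\<delta> * y)) * indicator {y / (1 + \<eta>)..y} x \<partial>lborel) + ennreal (3 * Ch * \<delta> * y powr (2 - c))"
      by blast+
  qed (use gm \<delta> \<eta> c X12 A0 in auto)
  have Q0: "0 \<le> 3 * Ch * \<delta> * (2 * X) powr (2 - c) * ln (2 * X)" using Ch \<delta> X1' by simp
  show ?thesis
    using sector_evaluation[OF \<eta> \<delta>(1) _ d _ X1(4) Q0 A_def, of P Err] S assms(11) X1' unfolding L_def by auto
qed

lemma VF_asymptotics_of_tVF:
  fixes B1 B2 B3 c d K0 :: real
  assumes B: "0 < B1" "B1 \<le> B2" "B2 < B3" and c: "0 < c" and d: "0 < d"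
    and mean_square: "\<And>\<kappa>. 0 < \<kappa> \<Longrightarrow> \<kappa> \<le> 1/4 \<Longrightarrow>
      \<exists>K\<ge>0. \<forall>X \<theta>. 1 \<le> X \<and> 0 < \<theta> \<and> \<theta> \<le> 1 \<longrightarrow> VF Lam m X \<theta> \<le> K * X powr (2 + 2 * \<kappa>) * \<theta> powr (1 - 3 * \<kappa>)"
    and hyp: "\<And>k1 k2. 0 < k1 \<Longrightarrow> 0 < k2 \<Longrightarrow> \<exists>C X0. \<forall>X h.
           X0 \<le> X \<and> k1 * X powr (1 - B3) \<le> h \<and> h \<le> k2 * X powr (1 - B1) \<longrightarrow>
           \<bar>tVF Lam m X h - h * X * (d * ln (X / h) + K0)\<bar> \<le> C * h * X powr (1 - c)"
    and e: "0 < e" and k: "0 < k1" "0 < k2"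
  shows "\<exists>C X0. \<forall>X \<delta>. X0 \<le> X \<and> k1 * X powr (- B2) \<le> \<delta> \<and> \<delta> \<le> k2 * X powr (- B1) \<longrightarrow>
           \<bar>VF Lam m X \<delta> - 1/2 * \<delta> * X\<^sup>2 * (d * ln (1 / \<delta>) + K0 + d)\<bar>
           \<le> C * (\<delta> powr (1 - e) * X powr (2 - c / 3)
                 + \<delta> powr (1 - e) * X\<^sup>2 * (\<delta> * X powr B3) powr (- 2 / (3 * B3)))"
proof -

  \<comment> \<open>Choice of parameters and the GRH bound with its losses made explicit\<close>
  have B3: "0 < B3" and B2: "0 < B2" using B by auto
  \<comment> \<open>Slicing requires c \<le> 2. A larger exponent is cut down here, and the
    difference is made up at the end by the second error term.\<close>
  define c' where "c' = min c 2"
  have c': "0 < c'" "c' \<le> 2" "c' \<le> c" using c by (auto simp: c'_def)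
  \<comment> \<open>The total loss of the GRH bound is X to the power 2 \<kappa> + 3 \<kappa> (B2 +
    4/3) = \<kappa> (3 B2 + 6); this choice keeps it below \<open>Z X\<close>, that is X^(e
    B1).\<close>
  define \<kappa> where "\<kappa> = min (1/4) (e * B1 / (3 * B2 + 6))"
  have \<kappa>: "0 < \<kappa>" "\<kappa> \<le> 1/4" "\<kappa> * (3 * B2 + 6) \<le> e * B1"
  proof -
    have "0 < e * B1 / (3 * B2 + 6)" using e B B2 by simp
    thus "0 < \<kappa>" by (simp add: \<kappa>_def)
    show "\<kappa> \<le> 1/4" unfolding \<kappa>_def by (rule min.cobounded1)
    have "\<kappa> \<le> e * B1 / (3 * B2 + 6)" unfolding \<kappa>_def by (rule min.cobounded2)
    thus "\<kappa> * (3 * B2 + 6) \<le> e * B1" using B2 by (subst (asm) pos_le_divide_eq) auto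
  qed
  obtain K where K: "0 \<le> K" "\<And>X \<theta>. 1 \<le> X \<Longrightarrow> 0 < \<theta> \<Longrightarrow> \<theta> \<le> 1 \<Longrightarrow> VF Lam m X \<theta> \<le> K * X powr (2 + 2 * \<kappa>) * \<theta> powr (1 - 3 * \<kappa>)"
    using mean_square[OF \<kappa>(1,2)] by blast
  obtain Ch' Xh where hyp': "\<And>Y h. Xh \<le> Y \<Longrightarrow> 1 * Y powr (1 - B3) \<le> h \<Longrightarrow> h \<le> 2 * k2 * 2 powr B1 * Y powr (1 - B1) \<Longrightarrow>
       \<bar>tVF Lam m Y h - h * Y * (d * ln (Y / h) + K0)\<bar> \<le> Ch' * h * Y powr (1 - c)"
    using hyp[of 1 "2 * k2 * 2 powr B1"] k by auto
  define Ch where "Ch = max Ch' 0"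
  have Ch: "0 \<le> Ch" by (simp add: Ch_def)
  define Z where "Z X = X powr (e * B1)" for X
  define C1 where "C1 = 2 * K * k1 powr (- (3 * \<kappa>))"
  have C1: "0 \<le> C1" unfolding C1_def using K by simp
  \<comment> \<open>Here \<xi> bounds the slope \<theta> from above and is itself not too small, so
    \<xi>^(1-3\<kappa>) is \<xi> times a small power of X. The exponent - B2 - 4/3 is the one that
    \<eta> \<delta> obeys, because \<eta> = X^(-2c'/3) \<ge> X^(-4/3).\<close>
  have gb: "VF Lam m Y \<theta> \<le> C1 * Y\<^sup>2 * \<xi> * Z X"
    if X: "1 \<le> X" and Y: "1 \<le> Y" "Y \<le> 2 * X" and \<theta>: "0 < \<theta>" "\<theta> \<le> \<xi>" "\<xi> \<le> 1" and \<xi>: "k1 * X powr (- B2 - 4/3) \<le> \<xi>" for X Y \<theta> \<xi>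
  proof -
    have "Y powr (2 + 2 * \<kappa>) = Y\<^sup>2 * Y powr (2 * \<kappa>)" using Y by (simp add: powr_add)
    also have "\<dots> \<le> Y\<^sup>2 * (2 * X powr (2 * \<kappa>))"
    proof (rule mult_left_mono)
      have "Y powr (2 * \<kappa>) \<le> (2 * X) powr (2 * \<kappa>)" using Y \<kappa> by (intro powr_mono2) auto
      also have "\<dots> = 2 powr (2 * \<kappa>) * X powr (2 * \<kappa>)" using X by (simp add: powr_mult)
      also have "\<dots> \<le> 2 powr 1 * X powr (2 * \<kappa>)" using \<kappa> by (intro mult_right_mono powr_mono) auto
      finally show "Y powr (2 * \<kappa>) \<le> 2 * X powr (2 * \<kappa>)" by simp
    qed simp
    finally have y: "Y powr (2 + 2 * \<kappa>) \<le> Y\<^sup>2 * (2 * X powr (2 * \<kappa>))" .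
    have "\<theta> powr (1 - 3 * \<kappa>) \<le> \<xi> powr (1 - 3 * \<kappa>)" using \<theta> \<kappa> by (intro powr_mono2) auto
    also have "\<dots> = \<xi> * \<xi> powr (- (3 * \<kappa>))" using \<theta> powr_add[of \<xi> 1 "- (3 * \<kappa>)"] by simp
    also have "\<dots> \<le> \<xi> * (k1 powr (- (3 * \<kappa>)) * X powr (3 * \<kappa> * (B2 + 4/3)))"
    proof (rule mult_left_mono)
      have "\<xi> powr (- (3 * \<kappa>)) \<le> (k1 * X powr (- B2 - 4/3)) powr (- (3 * \<kappa>))"
        using \<xi> \<kappa> k X by (intro powr_mono2') auto
      also have "\<dots> = k1 powr (- (3 * \<kappa>)) * (X powr (- B2 - 4/3)) powr (- (3 * \<kappa>))" using k X by (intro powr_mult)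
      also have "(X powr (- B2 - 4/3)) powr (- (3 * \<kappa>)) = X powr (3 * \<kappa> * (B2 + 4/3))" unfolding powr_powr by (simp add: algebra_simps)
      finally show "\<xi> powr (- (3 * \<kappa>)) \<le> k1 powr (- (3 * \<kappa>)) * X powr (3 * \<kappa> * (B2 + 4/3))" .
    qed (use \<theta> in auto)
    finally have t: "\<theta> powr (1 - 3 * \<kappa>) \<le> \<xi> * (k1 powr (- (3 * \<kappa>)) * X powr (3 * \<kappa> * (B2 + 4/3)))" .
    have "VF Lam m Y \<theta> \<le> K * Y powr (2 + 2 * \<kappa>) * \<theta> powr (1 - 3 * \<kappa>)" using K(2)[OF Y(1) \<theta>(1)] \<theta> by simp
    also have "\<dots> \<le> K * (Y\<^sup>2 * (2 * X powr (2 * \<kappa>))) * (\<xi> * (k1 powr (- (3 * \<kappa>)) * X powr (3 * \<kappa> * (B2 + 4/3))))"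
      using K(1) y t by (intro mult_mono mult_left_mono) auto
    also have "\<dots> = C1 * Y\<^sup>2 * \<xi> * (X powr (2 * \<kappa>) * X powr (3 * \<kappa> * (B2 + 4/3)))" unfolding C1_def by (simp only: mult_ac)
    also have "\<dots> \<le> C1 * Y\<^sup>2 * \<xi> * Z X"
    proof (rule mult_left_mono)
      have "2 * \<kappa> + 3 * \<kappa> * (B2 + 4/3) = \<kappa> * (3 * B2 + 6)" by (simp add: algebra_simps)
      thus "X powr (2 * \<kappa>) * X powr (3 * \<kappa> * (B2 + 4/3)) \<le> Z X"
        unfolding powr_add[symmetric] Z_def using \<kappa>(3) X by (simp only:) (rule powr_mono)
    qed (use C1 \<theta> in auto)
    finally show ?thesis .
  qed
  \<comment> \<open>The fourth condition puts X1 below X / 2 and the last one makes \<delta> X^B3 at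
    least 1; both rest on B2 < B3. The fifth makes the bracket in the main term nonnegative.\<close>
  have ev: "\<forall>\<^sub>F X in at_top. 1 \<le> X \<and> k2 * X powr (- B1) \<le> 1 \<and> max 1 Xh \<le> (k2 * X powr (- B1)) powr (- 1 / B3) \<and>
      4 * (k1 * X powr (- B2)) powr (- 1 / B3) \<le> X \<and> 0 \<le> d * ln (1 / (k2 * X powr (- B1))) + K0 \<and> 1 \<le> k1 * X powr (B3 - B2)"
  proof (intro eventually_conj)
    have p1: "0 < B1 / B3" and p2: "B2 / B3 < 1" and p3: "0 < B3 - B2" using B B3 by auto
    show "\<forall>\<^sub>F X::real in at_top. 1 \<le> X" by (rule eventually_ge_at_top)
    show "\<forall>\<^sub>F X in at_top. k2 * X powr (- B1) \<le> 1" using k B by real_asymp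
    have "filterlim (\<lambda>X. k2 powr (- 1 / B3) * X powr (B1 / B3)) at_top at_top" using k p1 by real_asymp
    hence "\<forall>\<^sub>F X in at_top. max 1 Xh \<le> k2 powr (- 1 / B3) * X powr (B1 / B3)" by (simp only: filterlim_at_top)
    moreover have "k2 powr (- 1 / B3) * X powr (B1 / B3) = (k2 * X powr (- B1)) powr (- 1 / B3)" for X
      using k by (subst powr_mult) (auto simp: powr_powr)
    ultimately show "\<forall>\<^sub>F X in at_top. max 1 Xh \<le> (k2 * X powr (- B1)) powr (- 1 / B3)" by (simp only:)
    have "\<forall>\<^sub>F X in at_top. 4 * (k1 powr (- 1 / B3) * X powr (B2 / B3)) \<le> X" using k p2 by real_asymp
    moreover have "k1 powr (- 1 / B3) * X powr (B2 / B3) = (k1 * X powr (- B2)) powr (- 1 / B3)" for X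
      using k by (subst powr_mult) (auto simp: powr_powr)
    ultimately show "\<forall>\<^sub>F X in at_top. 4 * (k1 * X powr (- B2)) powr (- 1 / B3) \<le> X" by (simp only:)
    show "\<forall>\<^sub>F X in at_top. 0 \<le> d * ln (1 / (k2 * X powr (- B1))) + K0" using d k B by real_asymp
    show "\<forall>\<^sub>F X in at_top. 1 \<le> k1 * X powr (B3 - B2)" using k p3 by real_asymp
  qed
  then obtain X0 where X0: "\<And>X. X0 \<le> X \<Longrightarrow> 1 \<le> X \<and> k2 * X powr (- B1) \<le> 1 \<and> max 1 Xh \<le> (k2 * X powr (- B1)) powr (- 1 / B3) \<and>
      4 * (k1 * X powr (- B2)) powr (- 1 / B3) \<le> X \<and> 0 \<le> d * ln (1 / (k2 * X powr (- B1))) + K0 \<and> 1 \<le> k1 * X powr (B3 - B2)"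
    by (auto simp: eventually_at_top_linorder)
  define C2 where "C2 = d * (B2 / (e * B1) + \<bar>ln k1\<bar>) + \<bar>K0\<bar> + d"
  define C3 where "C3 = 1 + 1 / (e * B1)"
  define C5 where "C5 = k2 powr (2 / (3 * B3))"
  define C4 where "C4 = 9 * C1 + 24 * Ch * C3 + 4 * C2"
  define Cf where "Cf = k2 powr e * (C4 * (1 + C5) + 4 * (C1 + 2 * C2))"
  have eB: "0 < e * B1" using e B by simp
  have C2: "0 \<le> C2" unfolding C2_def using d B2 eB by simp
  have C3: "0 \<le> C3" unfolding C3_def using eB by simp
  have C4: "0 \<le> C4" unfolding C4_def using C1 C2 C3 Ch by simp
  have C5: "0 < C5" unfolding C5_def using k by simp
  have final: "\<bar>VF Lam m X \<delta> - 1/2 * \<delta> * X\<^sup>2 * (d * ln (1 / \<delta>) + K0 + d)\<bar>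
      \<le> Cf * (\<delta> powr (1 - e) * X powr (2 - c / 3) + \<delta> powr (1 - e) * X\<^sup>2 * (\<delta> * X powr B3) powr (- 2 / (3 * B3)))"
    if XX: "X0 \<le> X" and \<delta>l: "k1 * X powr (- B2) \<le> \<delta>" and \<delta>u: "\<delta> \<le> k2 * X powr (- B1)" for X \<delta>
  proof -

    \<comment> \<open>Estimates for fixed X and \<delta>\<close>
    note E = X0[OF XX]
    have X: "1 \<le> X" "0 < X" using E by auto
    have k1X: "0 < k1 * X powr (- B2)" using k X by simp
    have \<delta>: "0 < \<delta>" "\<delta> \<le> 1" using k1X \<delta>l \<delta>u E by auto
    define z where "z = Z X"
    have z1: "1 \<le> z" unfolding z_def Z_def using X eB by (simp add: ge_one_powr_ge_zero)
    define \<eta> where "\<eta> = X powr (- (2 * c' / 3))"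
    define \<tau> where "\<tau> = X powr (- (c' / 3))"
    have \<eta>: "0 < \<eta>" "\<eta> \<le> 1" and \<tau>: "0 < \<tau>" "\<tau> \<le> 1"
    proof -
      have "X powr (- p) \<le> 1" if "0 \<le> p" for p using powr_mono[of "- p" 0 X] X that by simp
      thus "\<eta> \<le> 1" "\<tau> \<le> 1" unfolding \<eta>_def \<tau>_def using c' by simp_all
      show "0 < \<eta>" "0 < \<tau>" unfolding \<eta>_def \<tau>_def using X by simp_all
    qed
    have \<tau>\<tau>: "\<eta> = \<tau> * \<tau>" unfolding \<eta>_def \<tau>_def powr_add[symmetric] by simp
    have \<eta>\<tau>: "\<eta> \<le> \<tau>" unfolding \<tau>\<tau> using \<tau> by (simp add: mult_left_le)
    define Y1 where "Y1 = \<delta> powr (- 1 / B3)"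
    define X1 where "X1 = 2 * Y1"
    have Y1: "1 \<le> Y1" "Xh \<le> Y1" "4 * Y1 \<le> X"
    proof -
      have "(k2 * X powr (- B1)) powr (- 1 / B3) \<le> Y1" unfolding Y1_def using \<delta> \<delta>u B3 by (intro powr_mono2') auto
      thus "1 \<le> Y1" "Xh \<le> Y1" using E by auto
      have "Y1 \<le> (k1 * X powr (- B2)) powr (- 1 / B3)" unfolding Y1_def using k1X \<delta>l B3 by (intro powr_mono2') auto
      thus "4 * Y1 \<le> X" using E by auto
    qed
    have Y2: "max 1 Xh \<le> Y1" using Y1 by simp
    define l where "l = d * ln (1 / \<delta>) + K0"
    have l0: "0 \<le> l"
    proof -
      have "ln (1 / (k2 * X powr (- B1))) \<le> ln (1 / \<delta>)"
        using \<delta> \<delta>u k X by (subst ln_le_cancel_iff) (auto intro!: divide_left_mono)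
      hence "d * ln (1 / (k2 * X powr (- B1))) \<le> d * ln (1 / \<delta>)" using d by (intro mult_left_mono) auto
      thus ?thesis using E unfolding l_def by linarith
    qed
    have lnX: "ln X \<le> z / (e * B1)"
    proof -
      have "ln z = e * B1 * ln X" unfolding z_def Z_def using X by (simp add: ln_powr)
      moreover have "ln z \<le> z" using ln_le_minus_one[of z] z1 by simp
      ultimately have "ln X * (e * B1) \<le> z" by (simp add: mult.commute)
      thus ?thesis using eB by (simp only: pos_le_divide_eq)
    qed
    have lz: "l + d \<le> C2 * z"
    proof -
      have "ln (1 / \<delta>) \<le> ln (1 / (k1 * X powr (- B2)))"
        using \<delta> \<delta>l k X by (subst ln_le_cancel_iff) (auto intro!: divide_left_mono)
      also have "\<dots> = B2 * ln X - ln k1" using k X by (simp add: ln_div ln_mult ln_powr)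
      also have "\<dots> \<le> B2 * (z / (e * B1)) + \<bar>ln k1\<bar> * z"
      proof -
        have "B2 * ln X \<le> B2 * (z / (e * B1))" using lnX B2 by (intro mult_left_mono) auto
        moreover have "\<bar>ln k1\<bar> * 1 \<le> \<bar>ln k1\<bar> * z" using z1 by (intro mult_left_mono) auto
        ultimately show ?thesis by linarith
      qed
      also have "\<dots> = (B2 / (e * B1) + \<bar>ln k1\<bar>) * z" by (simp add: distrib_right)
      finally have "d * ln (1 / \<delta>) \<le> d * ((B2 / (e * B1) + \<bar>ln k1\<bar>) * z)" using d by (intro mult_left_mono) auto
      moreover have "\<bar>K0\<bar> * 1 \<le> \<bar>K0\<bar> * z" "d * 1 \<le> d * z" by (intro mult_left_mono z1; use d in simp)+
      moreover have "C2 * z = d * ((B2 / (e * B1) + \<bar>ln k1\<bar>) * z) + \<bar>K0\<bar> * z + d * z" unfolding C2_def by (simp only: distrib_right mult.assoc)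
      ultimately show ?thesis unfolding l_def by linarith
    qed
    have ln2: "ln (2 * X) \<le> C3 * z"
    proof -
      have "ln (2 * X) = ln 2 + ln X" using X by (simp add: ln_mult)
      moreover have "ln 2 \<le> (1::real)" using ln_le_minus_one[of 2] by simp
      moreover have "C3 * z = z + z / (e * B1)" unfolding C3_def by (simp add: distrib_right)
      ultimately show ?thesis using lnX z1 by linarith
    qed
    have \<xi>\<delta>: "k1 * X powr (- B2 - 4/3) \<le> \<delta>" "k1 * X powr (- B2 - 4/3) \<le> \<eta> * \<delta>" "\<eta> * \<delta> \<le> 1"
    proof -
      have "X powr (- 4/3) \<le> \<eta>" unfolding \<eta>_def using X c' by (intro powr_mono) auto
      hence "X powr (- 4/3) * (k1 * X powr (- B2)) \<le> \<eta> * \<delta>" using \<delta>l k1X \<eta> by (intro mult_mono) auto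
      moreover have "X powr (- 4/3) * (k1 * X powr (- B2)) = k1 * X powr (- B2 - 4/3)"
        using powr_add[of X "- B2" "- 4/3"] by (simp add: mult_ac)
      ultimately show 2: "k1 * X powr (- B2 - 4/3) \<le> \<eta> * \<delta>" by (simp only:)
      have 3: "\<eta> * \<delta> \<le> 1 * \<delta>" using \<eta> \<delta> by (intro mult_right_mono) auto
      thus "\<eta> * \<delta> \<le> 1" using \<delta>(2) by linarith
      show "k1 * X powr (- B2 - 4/3) \<le> \<delta>" using 2 3 by simp
    qed
    define P where "P = integral {X1..X} (\<lambda>x. sqdev Lam m x (\<delta> * x))"
    have X1: "2 \<le> X1" "2 * X1 \<le> X" "X1 \<le> X" "1 \<le> X1" using Y1 by (auto simp: X1_def)
    have P0: "0 \<le> P" unfolding P_def using \<delta> X1 by (intro integral_nonneg sqdev_linear_integrable_on) auto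
    have VP: "VF Lam m X \<delta> = VF Lam m X1 \<delta> + P"
      unfolding VF_sqdev P_def using \<delta> X1
      by (intro Henstock_Kurzweil_Integration.integral_combine[symmetric] sqdev_linear_integrable_on) auto
    \<comment> \<open>The constant 9 is 8 + 1: in \<open>VF_shift_comparison\<close> the first term
      has the factor 2 / \<tau> times 4 \<eta>, which is 8 \<tau> because \<eta> = \<tau>^2 and the
      range is doubled; the second term has the factor \<tau>.\<close>
    define Err where "Err = 9 * C1 * (\<delta> * z) * (X\<^sup>2 * \<tau>)"
    have Err0: "0 \<le> Err" unfolding Err_def using C1 \<delta> z1 \<tau> by simp
    have Errb: "\<bar>P - integral {X1..X} (\<lambda>x. sqdev Lam m x ((1 + \<nu>) * \<delta> * x))\<bar> \<le> Err" if \<nu>: "0 < \<nu>" "\<nu> \<le> \<eta>" for \<nu>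
    proof -
      have \<nu>1: "\<nu> \<le> 1" using \<nu> \<eta> by simp
      have th: "0 < \<nu> * \<delta> / (1 + \<delta>)" "\<nu> * \<delta> / (1 + \<delta>) \<le> \<eta> * \<delta>"
      proof -
        show "0 < \<nu> * \<delta> / (1 + \<delta>)" using \<nu> \<delta> by simp
        have "\<nu> * \<delta> / (1 + \<delta>) \<le> \<nu> * \<delta> / 1" using \<nu> \<delta> by (intro divide_left_mono) auto
        also have "\<dots> \<le> \<eta> * \<delta>" using \<nu> \<delta> by (simp add: mult_right_mono)
        finally show "\<nu> * \<delta> / (1 + \<delta>) \<le> \<eta> * \<delta>" .
      qed
      have a: "VF Lam m (2 * X) (\<nu> * \<delta> / (1 + \<delta>)) \<le> C1 * (2 * X)\<^sup>2 * (\<eta> * \<delta>) * z"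
        unfolding z_def using X th \<xi>\<delta> by (intro gb) auto
      have b: "VF Lam m X \<delta> \<le> C1 * X\<^sup>2 * \<delta> * z" unfolding z_def using X \<delta> \<xi>\<delta> by (intro gb) auto
      have "\<bar>P - integral {X1..X} (\<lambda>x. sqdev Lam m x ((1 + \<nu>) * \<delta> * x))\<bar>
          \<le> 2 / \<tau> * VF Lam m (2 * X) (\<nu> * \<delta> / (1 + \<delta>)) + \<tau> * VF Lam m X \<delta>"
        unfolding P_def by (rule VF_shift_comparison[OF \<delta> \<nu>(1) \<nu>1 X1(4,3) \<tau>])
      also have "\<dots> \<le> 2 / \<tau> * (C1 * (2 * X)\<^sup>2 * (\<eta> * \<delta>) * z) + \<tau> * (C1 * X\<^sup>2 * \<delta> * z)"
        using a b \<tau> by (intro add_mono mult_left_mono) auto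
      also have "2 / \<tau> * (C1 * (2 * X)\<^sup>2 * (\<eta> * \<delta>) * z) = 8 * (C1 * (\<delta> * z) * (X\<^sup>2 * \<tau>))"
        unfolding \<tau>\<tau> using \<tau> by (simp add: power_mult_distrib)
      also have "\<tau> * (C1 * X\<^sup>2 * \<delta> * z) = C1 * (\<delta> * z) * (X\<^sup>2 * \<tau>)" by (simp only: mult_ac)
      also have "8 * (C1 * (\<delta> * z) * (X\<^sup>2 * \<tau>)) + C1 * (\<delta> * z) * (X\<^sup>2 * \<tau>) = Err"
        unfolding Err_def by (simp add: mult_ac)
      finally show ?thesis .
    qed
    have hyp2: "\<bar>tVF Lam m Y h - h * Y * (d * ln (Y / h) + K0)\<bar> \<le> Ch * h * Y powr (1 - c')"
      if "max 1 Xh \<le> Y" "Y powr (1 - B3) \<le> h" "h \<le> 2 * k2 * 2 powr B1 * Y powr (1 - B1)" for Y h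
    proof -
      have h0: "0 \<le> h" using that(2) powr_ge_zero order_trans by blast
      have "\<bar>tVF Lam m Y h - h * Y * (d * ln (Y / h) + K0)\<bar> \<le> Ch' * h * Y powr (1 - c)" using that by (intro hyp') auto
      also have "\<dots> \<le> Ch * h * Y powr (1 - c')"
        using h0 that(1) c' Ch by (intro mult_mono mult_right_mono powr_mono) (auto simp: Ch_def)
      finally show ?thesis .
    qed
    define Qt where "Qt = 3 * Ch * \<delta> * (2 * X) powr (2 - c') * ln (2 * X) / \<eta>"
    have sector: "\<bar>P - \<delta> * X\<^sup>2 * (l + d) / 2\<bar> \<le> Err + 2 * Qt + 4 * \<eta> * \<delta> * X\<^sup>2 * (l + d) + 2 * \<delta> * X1\<^sup>2 * (l + d)"
      unfolding l_def Qt_def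
    proof (rule tVF_to_VF_sector[OF B(1) B3 c'(1,2) less_imp_le[OF d] \<eta> \<delta>(1) \<delta>u k(2) l0[unfolded l_def] X1_def[unfolded Y1_def] Y1(1)[unfolded Y1_def] Y2[unfolded Y1_def] X1(2) Ch _ _ P0 Err0])
      show "\<bar>tVF Lam m Y h - h * Y * (d * ln (Y / h) + K0)\<bar> \<le> Ch * h * Y powr (1 - c')"
        if "max 1 Xh \<le> Y" "Y powr (1 - B3) \<le> h" "h \<le> 2 * k2 * 2 powr B1 * Y powr (1 - B1)" for Y h
        by (rule hyp2[OF that])
      show "\<bar>P - integral {X1..X} (\<lambda>x. sqdev Lam m x ((1 + \<nu>) * \<delta> * x))\<bar> \<le> Err" if "0 < \<nu>" "\<nu> \<le> \<eta>" for \<nu>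
        by (rule Errb[OF that])
    qed
    define S where "S = X\<^sup>2 * \<tau>"
    have S0: "0 \<le> S" unfolding S_def using \<tau> by simp
    have Qb: "Qt \<le> 12 * Ch * C3 * (\<delta> * z) * S"
    proof -
      have "(2 * X) powr (2 - c') / \<eta> = 2 powr (2 - c') * (X powr (2 - c') / \<eta>)" using X by (simp add: powr_mult)
      also have "X powr (2 - c') / \<eta> = S"
      proof -
        have "X powr (2 - c') / \<eta> = X powr ((2 - c') - (- (2 * c' / 3)))" unfolding \<eta>_def powr_diff ..
        also have "(2 - c') - (- (2 * c' / 3)) = 2 + - (c' / 3)" by simp
        also have "X powr (2 + - (c' / 3)) = X powr 2 * \<tau>" unfolding \<tau>_def by (rule powr_add)
        finally show ?thesis using X by (simp add: S_def)
      qed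
      finally have q: "(2 * X) powr (2 - c') / \<eta> = 2 powr (2 - c') * S" .
      have "2 powr (2 - c') \<le> 2 powr (2::real)" using c' by (intro powr_mono) auto
      hence "2 powr (2 - c') * S \<le> 4 * S" using S0 by (intro mult_right_mono) auto
      hence "3 * Ch * \<delta> * (2 powr (2 - c') * S) \<le> 3 * Ch * \<delta> * (4 * S)"
        by (rule mult_left_mono) (use Ch \<delta> in simp)
      hence "3 * Ch * \<delta> * (2 powr (2 - c') * S) * ln (2 * X) \<le> 3 * Ch * \<delta> * (4 * S) * (C3 * z)"
        by (rule mult_mono[OF _ ln2]) (use Ch \<delta> S0 X in simp_all)
      moreover have "Qt = 3 * Ch * \<delta> * (2 powr (2 - c') * S) * ln (2 * X)" unfolding Qt_def q[symmetric] by simp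
      moreover have "3 * Ch * \<delta> * (4 * S) * (C3 * z) = 12 * Ch * C3 * (\<delta> * z) * S" by simp
      ultimately show ?thesis by (simp only:)
    qed
    have t3: "4 * \<eta> * \<delta> * X\<^sup>2 * (l + d) \<le> 4 * C2 * (\<delta> * z) * S"
    proof -
      have "(\<eta> * (l + d)) * (4 * \<delta> * X\<^sup>2) \<le> (\<tau> * (C2 * z)) * (4 * \<delta> * X\<^sup>2)"
        using \<eta>\<tau> lz l0 d \<tau> \<eta> \<delta> by (intro mult_right_mono mult_mono) auto
      thus ?thesis unfolding S_def by (simp add: mult_ac)
    qed
    have t4: "2 * \<delta> * X1\<^sup>2 * (l + d) \<le> 2 * C2 * (\<delta> * z) * X1\<^sup>2"
    proof -
      have "(2 * \<delta> * X1\<^sup>2) * (l + d) \<le> (2 * \<delta> * X1\<^sup>2) * (C2 * z)" using lz \<delta> by (intro mult_left_mono) auto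
      thus ?thesis by (simp add: mult_ac)
    qed
    have t5: "VF Lam m X1 \<delta> \<le> C1 * (\<delta> * z) * X1\<^sup>2"
    proof -
      have "VF Lam m X1 \<delta> \<le> C1 * X1\<^sup>2 * \<delta> * z" unfolding z_def using X X1 \<delta> \<xi>\<delta> by (intro gb) auto
      thus ?thesis by (simp add: mult_ac)
    qed
    define M where "M = \<delta> * X\<^sup>2 * (l + d) / 2"
    have tot: "\<bar>VF Lam m X \<delta> - M\<bar> \<le> \<delta> * z * (C4 * S + (C1 + 2 * C2) * X1\<^sup>2)"
    proof -
      have "\<bar>VF Lam m X \<delta> - M\<bar> \<le> VF Lam m X1 \<delta> + \<bar>P - M\<bar>"
        using VF_nonneg[of \<delta> Lam m X1] \<delta> unfolding VP by linarith
      also have "\<dots> \<le> C1 * (\<delta> * z) * X1\<^sup>2 + (Err + 2 * (12 * Ch * C3 * (\<delta> * z) * S) + 4 * C2 * (\<delta> * z) * S + 2 * C2 * (\<delta> * z) * X1\<^sup>2)"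
        using t5 sector Qb t3 t4 unfolding M_def by linarith
      also have "\<dots> = \<delta> * z * (C4 * S + (C1 + 2 * C2) * X1\<^sup>2)"
        unfolding C4_def Err_def S_def[symmetric] by (simp add: algebra_simps)
      finally show ?thesis .
    qed

    \<comment> \<open>Passage to the two error terms of the statement\<close>
    define W where "W = (\<delta> * X powr B3) powr (- 2 / (3 * B3))"
    have dX: "1 \<le> \<delta> * X powr B3"
    proof -
      have "1 \<le> k1 * X powr (B3 - B2)" using E by simp
      also have "\<dots> = k1 * X powr (- B2) * X powr B3" using powr_add[of X "- B2" B3] by (simp add: mult.assoc)
      also have "\<dots> \<le> \<delta> * X powr B3" using \<delta>l by (intro mult_right_mono) auto
      finally show ?thesis .
    qed
    \<comment> \<open>X1^2 / X^2 equals 4 (\<delta> X^B3)^(-2/B3), and since \<delta> X^B3 \<ge> 1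
      the exponent may be weakened to -2/(3 B3).\<close>
    have X1W: "X1\<^sup>2 \<le> 4 * (X\<^sup>2 * W)"
    proof -
      have "Y1\<^sup>2 = \<delta> powr (- 2 / B3)"
      proof -
        have "Y1\<^sup>2 = \<delta> powr (- 1 / B3 + - 1 / B3)" unfolding powr_add Y1_def power2_eq_square ..
        thus ?thesis by (simp add: field_simps)
      qed
      also have "\<dots> = X\<^sup>2 * (\<delta> * X powr B3) powr (- 2 / B3)"
      proof -
        have "(\<delta> * X powr B3) powr (- 2 / B3) = \<delta> powr (- 2 / B3) * X powr (B3 * (- 2 / B3))"
          using \<delta> X by (simp add: powr_mult powr_powr)
        also have "B3 * (- 2 / B3) = - 2" using B3 by simp
        also have "X powr (- 2) = 1 / X\<^sup>2" using X by (simp add: powr_minus_divide)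
        finally show ?thesis using X by simp
      qed
      also have "\<dots> \<le> X\<^sup>2 * W" unfolding W_def using dX B3 by (intro mult_left_mono powr_mono) (auto simp: field_simps)
      finally show ?thesis by (simp add: X1_def power_mult_distrib)
    qed
    have W0: "0 \<le> W" by (simp add: W_def)
    \<comment> \<open>For c > 2 the slicing error S is X^(4/3), larger than X^(2-c/3). The second
      error term absorbs it: \<delta> X^B3 is at most k2 X^(B3-B1), so W is at least a constant
      times X^(-2/3).\<close>
    have SW: "S \<le> X powr (2 - c / 3) + C5 * (X\<^sup>2 * W)"
    proof (cases "c \<le> 2")
      case True
      have "S = X powr (2 - c / 3)" unfolding S_def \<tau>_def c'_def using True X powr_add[of X 2 "- (c / 3)"] by simp
      thus ?thesis using C5 W0 by simp
    next
      case False
      have "X powr (- (2/3)) \<le> C5 * W"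
      proof -
        have "(k2 * X powr (B3 - B1)) powr (- 2 / (3 * B3)) \<le> W" unfolding W_def
        proof (rule powr_mono2')
          have "\<delta> * X powr B3 \<le> k2 * X powr (- B1) * X powr B3" using \<delta>u by (intro mult_right_mono) auto
          thus "\<delta> * X powr B3 \<le> k2 * X powr (B3 - B1)" using powr_add[of X "- B1" B3] by (simp add: mult.assoc)
          show "0 < \<delta> * X powr B3" using dX by linarith
        qed (use B3 in auto)
        hence "C5 * (k2 * X powr (B3 - B1)) powr (- 2 / (3 * B3)) \<le> C5 * W" using C5 by (intro mult_left_mono) auto
        moreover have "C5 * (k2 * X powr (B3 - B1)) powr (- 2 / (3 * B3)) = X powr ((B3 - B1) * (- 2 / (3 * B3)))"
        proof -
          have "(k2 * X powr (B3 - B1)) powr (- 2 / (3 * B3)) = k2 powr (- 2 / (3 * B3)) * X powr ((B3 - B1) * (- 2 / (3 * B3)))"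
            using k X by (simp add: powr_mult powr_powr)
          moreover have "C5 * k2 powr (- 2 / (3 * B3)) = 1" unfolding C5_def powr_add[symmetric] using k by simp
          ultimately show ?thesis by (simp add: mult.assoc[symmetric])
        qed
        moreover have "X powr (- (2/3)) \<le> X powr ((B3 - B1) * (- 2 / (3 * B3)))"
        proof (rule powr_mono)
          have "(B3 - B1) * (- 2 / (3 * B3)) = - (2/3) + 2 * B1 / (3 * B3)" using B3 by (simp add: field_simps)
          thus "- (2/3) \<le> (B3 - B1) * (- 2 / (3 * B3))" using B B3 by simp
        qed (use X in simp)
        ultimately show ?thesis by linarith
      qed
      hence "X\<^sup>2 * X powr (- (2/3)) \<le> X\<^sup>2 * (C5 * W)" by (intro mult_left_mono) auto
      moreover have "S = X\<^sup>2 * X powr (- (2/3))" unfolding S_def \<tau>_def c'_def using False by simp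
      ultimately have "S \<le> C5 * (X\<^sup>2 * W)" by (simp add: mult.left_commute)
      thus ?thesis by (rule add_increasing[OF powr_ge_zero])
    qed
    \<comment> \<open>The accumulated loss z = X^(e B1) becomes \<delta>^(-e) up to a constant,
      through the upper bound on \<delta>.\<close>
    have \<delta>z: "\<delta> * z \<le> k2 powr e * \<delta> powr (1 - e)"
    proof -
      have "(k2 * X powr (- B1)) powr (- e) \<le> \<delta> powr (- e)" using \<delta> \<delta>u e by (intro powr_mono2') auto
      moreover have "(k2 * X powr (- B1)) powr (- e) = k2 powr (- e) * z"
        unfolding z_def Z_def using k X by (simp add: powr_mult powr_powr mult.commute)
      ultimately have "k2 powr e * (k2 powr (- e) * z) \<le> k2 powr e * \<delta> powr (- e)" by (intro mult_left_mono) auto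
      moreover have "k2 powr e * (k2 powr (- e) * z) = z" using k by (simp add: powr_minus field_simps)
      ultimately have "\<delta> * z \<le> \<delta> * (k2 powr e * \<delta> powr (- e))" using \<delta> by (intro mult_left_mono) auto
      also have "\<dots> = k2 powr e * \<delta> powr (1 - e)" using \<delta> powr_add[of \<delta> 1 "- e"] by simp
      finally show ?thesis .
    qed
    define Tm where "Tm = X powr (2 - c / 3) + X\<^sup>2 * W"
    have T0: "0 \<le> Tm" unfolding Tm_def using W0 by simp
    have in1: "C4 * S + (C1 + 2 * C2) * X1\<^sup>2 \<le> (C4 * (1 + C5) + 4 * (C1 + 2 * C2)) * Tm"
    proof -
      have q0: "0 \<le> X powr (2 - c / 3)" "0 \<le> X\<^sup>2 * W" using W0 by auto
      have "(1 + C5) * Tm = (X powr (2 - c / 3) + C5 * (X\<^sup>2 * W)) + (X\<^sup>2 * W + C5 * X powr (2 - c / 3))"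
        unfolding Tm_def by (simp only: distrib_left distrib_right mult_1_left add_ac)
      moreover have "0 \<le> X\<^sup>2 * W + C5 * X powr (2 - c / 3)" using q0 C5 by simp
      ultimately have "S \<le> (1 + C5) * Tm" using SW by (simp only: add_increasing2)
      hence "C4 * S \<le> C4 * ((1 + C5) * Tm)" using C4 by (intro mult_left_mono) auto
      moreover have "X1\<^sup>2 \<le> 4 * Tm"
        unfolding Tm_def by (rule order_trans[OF X1W mult_left_mono]) (use q0 in simp_all)
      hence "(C1 + 2 * C2) * X1\<^sup>2 \<le> (C1 + 2 * C2) * (4 * Tm)" using C1 C2 by (intro mult_left_mono) auto
      ultimately show ?thesis by (simp add: algebra_simps)
    qed
    have "\<bar>VF Lam m X \<delta> - M\<bar> \<le> (k2 powr e * \<delta> powr (1 - e)) * ((C4 * (1 + C5) + 4 * (C1 + 2 * C2)) * Tm)"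
      by (rule order_trans[OF tot mult_mono[OF \<delta>z in1]]) (use C1 C2 C4 S0 in simp_all)
    also have "\<dots> = Cf * (\<delta> powr (1 - e) * X powr (2 - c / 3) + \<delta> powr (1 - e) * X\<^sup>2 * W)"
      unfolding Cf_def Tm_def by (simp add: algebra_simps)
    finally show ?thesis unfolding W_def M_def l_def by (simp add: mult.commute)
  qed
  show ?thesis by (intro exI[of _ Cf] exI[of _ X0]) (use final in blast)
qed

theorem theoremD1:
  fixes F :: "complex \<Rightarrow> complex" and a Lam :: "nat \<Rightarrow> complex" and m :: nat
    and Q :: real and lam :: "real list" and mu :: "complex list" and eps :: complex
    and B1 B2 B3 c :: real
  assumes "selberg_data F a m Q lam mu eps"
    and "primitive_selberg F"
    and "GRH F m"
    and "\<forall>s. 1 < Re s \<longrightarrow> ((\<lambda>n. Lam n / of_nat n powr s) sums (- (deriv F s / F s)))"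
    and "0 < B1" and "B1 \<le> B2" and "B2 < B3" and "B3 < 1 / degF lam"
    and "0 < c"
    and "\<forall>k1>0. \<forall>k2>0. \<exists>C X0. \<forall>X h.
           X0 \<le> X \<and> k1 * X powr (1 - B3) \<le> h \<and> h \<le> k2 * X powr (1 - B1) \<longrightarrow>
           \<bar>tVF Lam m X h - h * X * (degF lam * ln (X / h) + ln (condF Q lam)
              - (euler_mascheroni + ln (2 * pi)) * degF lam)\<bar> \<le> C * h * X powr (1 - c)"
  shows "\<forall>e>0. \<forall>k1>0. \<forall>k2>0. \<exists>C X0. \<forall>X \<delta>.
           X0 \<le> X \<and> k1 * X powr (- B2) \<le> \<delta> \<and> \<delta> \<le> k2 * X powr (- B1) \<longrightarrow>
           \<bar>VF Lam m X \<delta> - 1/2 * \<delta> * X\<^sup>2 * (degF lam * ln (1 / \<delta>) + ln (condF Q lam)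
              + (1 - euler_mascheroni - ln (2 * pi)) * degF lam)\<bar>
           \<le> C * (\<delta> powr (1 - e) * X powr (2 - c / 3)
                 + \<delta> powr (1 - e) * X\<^sup>2 * (\<delta> * X powr B3) powr (- 2 / (3 * B3)))"
proof (intro allI impI)
  fix e k1 k2 :: real
  assume e: "0 < e" "0 < k1" "0 < k2"
  define K0 where "K0 = ln (condF Q lam) - (euler_mascheroni + ln (2 * pi)) * degF lam"
  \<comment> \<open>As 0 < B3 < 1 / degF, and 1 / 0 is 0, the degree is positive.\<close>
  have "0 < 1 / degF lam" using assms(5-8) by linarith
  hence d: "0 < degF lam" by simp
  have eq1: "degF lam * t + ln (condF Q lam) - (euler_mascheroni + ln (2 * pi)) * degF lam = degF lam * t + K0" for t
    by (simp add: K0_def)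
  \<comment> \<open>The constants in hypothesis and conclusion differ by exactly one degree, the d
    produced by slicing.\<close>
  have eq2: "degF lam * t + ln (condF Q lam) + (1 - euler_mascheroni - ln (2 * pi)) * degF lam = degF lam * t + K0 + degF lam" for t
    by (simp add: K0_def algebra_simps)
  show "\<exists>C X0. \<forall>X \<delta>. X0 \<le> X \<and> k1 * X powr (- B2) \<le> \<delta> \<and> \<delta> \<le> k2 * X powr (- B1) \<longrightarrow>
           \<bar>VF Lam m X \<delta> - 1/2 * \<delta> * X\<^sup>2 * (degF lam * ln (1 / \<delta>) + ln (condF Q lam)
              + (1 - euler_mascheroni - ln (2 * pi)) * degF lam)\<bar>
           \<le> C * (\<delta> powr (1 - e) * X powr (2 - c / 3)
                 + \<delta> powr (1 - e) * X\<^sup>2 * (\<delta> * X powr B3) powr (- 2 / (3 * B3)))"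
    unfolding eq2
  proof (rule VF_asymptotics_of_tVF[OF assms(5-7,9) d _ _ e])
    show "\<exists>K\<ge>0. \<forall>X \<theta>. 1 \<le> X \<and> 0 < \<theta> \<and> \<theta> \<le> 1 \<longrightarrow> VF Lam m X \<theta> \<le> K * X powr (2 + 2 * \<kappa>) * \<theta> powr (1 - 3 * \<kappa>)"
      if "0 < \<kappa>" "\<kappa> \<le> 1/4" for \<kappa>
      by (rule selberg_GRH_mean_square[OF assms(1,3,4) that])
    show "\<exists>C X0. \<forall>X h. X0 \<le> X \<and> k1 * X powr (1 - B3) \<le> h \<and> h \<le> k2 * X powr (1 - B1) \<longrightarrow>
           \<bar>tVF Lam m X h - h * X * (degF lam * ln (X / h) + K0)\<bar> \<le> C * h * X powr (1 - c)" if "0 < k1" "0 < k2" for k1 k2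
      using assms(10) that unfolding eq1 by blast
  qed
qed

end
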